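(* Let $a,b$ be positive integers with $\gcd(a,b)=1$ and let $r$ be an integer with $\gcd(a,(r-1)b)=1$ and $r^b\equiv 1\pmod a$. Let $G=(\mathbb{Z}_a\rtimes_\alpha\mathbb{Z}_b)\rtimes_\theta\mathbb{Z}$, where $\alpha\colon\mathbb{Z}_b\to\operatorname{Aut}(\mathbb{Z}_a)$ is given by $\alpha(1_b)(1_a)=r\cdot 1_a$ and $\theta\colon\mathbb{Z}\to\operatorname{Aut}(\mathbb{Z}_a\rtimes_\alpha\mathbb{Z}_b)$ is given by $\theta(1)(1_a)=c_a\cdot 1_a$ and $\theta(1)(1_b)=c\cdot 1_a+c_b\cdot 1_b$, with $c,c_a,c_b$ integers for which these formulas define an automorphism $\theta(1)$. For $j\ge 1$ put $\delta_j=\gcd(r^j-1,a)$, $A_j=\gcd(c_a^j-1,\delta_j)$ and $B_j=\gcd(c_b^j-1,b)$. Then \[ H^n(G;\mathbb{Z})\cong\begin{cases}\mathbb{Z},&\text{if } n=0\text{ or }n=1,\\ \mathbb{Z}_{A_j}\oplus\mathbb{Z}_{B_j},&\text{if } n=2j\text{ or }n=2j+1\ (\text{and } j>0).\end{cases} \] Moreover, there are a generator $[\tilde\eta]$ of $H^1(G;\mathbb{Z})$, generators $[\tilde\varphi_a^i]$ and $[\tilde\varphi_b^i]$ of $H^{2i}(G;\mathbb{Z})$ for each $i>0$ with $\langle[\tilde\varphi_a^i]\rangle\cong\mathbb{Z}_{A_i}$ and $\langle[\tilde\varphi_b^i]\rangle\cong\mathbb{Z}_{B_i}$, and generators $[\tilde\psi_a^i]$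 and $[\tilde\psi_b^i]$ of $H^{2i+1}(G;\mathbb{Z})$ for each $i>0$ with $\langle[\tilde\psi_a^i]\rangle\cong\mathbb{Z}_{A_i}$ and $\langle[\tilde\psi_b^i]\rangle\cong\mathbb{Z}_{B_i}$, such that for all $i,j>0$: \begin{align*} &[\tilde\varphi_a^i]\smile[\tilde\eta]=\frac{\delta_i}{\gcd(\delta_i,c_a^i-1)}[\tilde\psi_a^i],\qquad [\tilde\varphi_b^i]\smile[\tilde\eta]=\frac{b}{\gcd(b,c_b^i-1)}[\tilde\psi_b^i],\\ &[\tilde\psi_a^i]\smile[\tilde\eta]=0,\qquad [\tilde\psi_b^i]\smile[\tilde\eta]=0,\\ &[\tilde\varphi_a^i]\smile[\tilde\varphi_a^j]=\frac{a\gcd(\delta_{i+j},c_a^{i+j}-1)}{\gcd(\delta_i,c_a^i-1)\gcd(\delta_j,c_a^j-1)}[\tilde\varphi_a^{i+j}],\\ &[\tilde\varphi_b^i]\smile[\tilde\varphi_b^j]=\frac{b\gcd(b,c_b^{i+j}-1)}{\gcd(b,c_b^i-1)\gcd(b,c_b^j-1)}[\tilde\varphi_b^{i+j}],\\ &[\tilde\varphi_a^i]\smile[\tilde\varphi_b^j]=0,\\ &[\tilde\varphi_a^i]\smile[\tilde\psi_a^j]=\frac{a\,\delta_{i+j}}{\delta_j\gcd(\delta_i,c_a^i-1)}[\tilde\psi_a^{i+j}],\qquad [\tilde\varphi_b^i]\smile[\tilde\psi_b^j]=\frac{b}{\gcd(b,c_b^i-1)}[\tilde\psi_b^{i+j}],\\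 &[\tilde\varphi_a^i]\smile[\tilde\psi_b^j]=0,\qquad [\tilde\varphi_b^i]\smile[\tilde\psi_a^j]=0,\\ &[\tilde\psi_a^i]\smile[\tilde\psi_a^j]=0,\qquad [\tilde\psi_a^i]\smile[\tilde\psi_b^j]=0,\qquad [\tilde\psi_b^i]\smile[\tilde\psi_b^j]=0. \end{align*} Finally, let $d$ and $d_{c_a}$ be the orders of $r$ and $c_a$ in $\mathcal{U}(\mathbb{Z}_a)$, let $d_{c_b}$ be the order of $c_b$ in $\mathcal{U}(\mathbb{Z}_b)$, and let $p=\operatorname{lcm}(d,d_{c_a},d_{c_b})$. Then \[ ([\tilde\varphi_a^p]+[\tilde\varphi_b^p])\smile\underline{\phantom{M}}\colon H^n(G;\mathbb{Z})\to H^{n+2p}(G;\mathbb{Z}) \] is an isomorphism for all $n\ge 2$.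
   Context: $\mathbb{Z}_m=\mathbb{Z}/m\mathbb{Z}$ with generator $1_m$, and $\mathcal{U}(\mathbb{Z}_m)$ is the group of units of the ring $\mathbb{Z}_m$. Elements of the semidirect product $\mathbb{Z}_a\rtimes_\alpha\mathbb{Z}_b$ are written additively as $u\cdot 1_a+v\cdot 1_b$. All cohomology is group cohomology with trivial $\mathbb{Z}$ coefficients, and $\smile$ is the cup product. *)

theory Defs
  imports "HOL-Algebra.Algebra" "HOL-Number_Theory.Cong"
begin

text \<open>
  The action is by automorphisms on the left factor: writing \<open>u + v\<close> for \<open>(u, v)\<close>, conjugation
  gives \<open>v + u - v = \<alpha> v u\<close>.
\<close>

definition semidirect_product ::
    "('a, 'm) monoid_scheme \<Rightarrow> ('b, 'n) monoid_scheme \<Rightarrow> ('b \<Rightarrow> 'a \<Rightarrow> 'a) \<Rightarrow> ('a \<times> 'b) monoid"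
  where
  "semidirect_product N K \<alpha> =
    \<lparr>carrier = carrier N \<times> carrier K,
     monoid.mult = (\<lambda>(u, v) (u', v'). (u \<otimes>\<^bsub>N\<^esub> \<alpha> v u', v \<otimes>\<^bsub>K\<^esub> v')),
     one = (\<one>\<^bsub>N\<^esub>, \<one>\<^bsub>K\<^esub>)\<rparr>"


section \<open>Group cohomology with trivial integer coefficients\<close>

text \<open>
  We use the (non-normalized) inhomogeneous bar complex. An \<open>n\<close>-cochain is a function from
  \<open>n\<close>-tuples of group elements, represented as lists of length \<open>n\<close>, to the integers; it is
  extensional, i.e. \<open>undefined\<close> away from these tuples. The cochains form a group under pointwise
  addition, which, as everywhere in HOL-Algebra's group theory, is written multiplicatively.
\<close>

definition tuples :: "('g, 'm) monoid_scheme \<Rightarrow> nat \<Rightarrow> 'g list set"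
  where "tuples G n = {xs. length xs = n \<and> set xs \<subseteq> carrier G}"

definition cochain_group :: "('g, 'm) monoid_scheme \<Rightarrow> nat \<Rightarrow> ('g list \<Rightarrow> int) monoid"
  where "cochain_group G n = product_group (tuples G n) (\<lambda>_. integer_group)"

text \<open>
  \<open>(d f)(g\<^sub>0, \<dots>, g\<^sub>n) = f(g\<^sub>1, \<dots>, g\<^sub>n) + (\<Sum>i<n. (-1)\<^sup>i\<^sup>+\<^sup>1 f(\<dots>, g\<^sub>i g\<^sub>i\<^sub>+\<^sub>1, \<dots>)) + (-1)\<^sup>n\<^sup>+\<^sup>1 f(g\<^sub>0, \<dots>, g\<^sub>n\<^sub>-\<^sub>1)\<close>
\<close>

definition coboundary_map ::
    "('g, 'm) monoid_scheme \<Rightarrow> nat \<Rightarrow> ('g list \<Rightarrow> int) \<Rightarrow> ('g list \<Rightarrow> int)"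
  where
  "coboundary_map G n f =
    (\<lambda>xs \<in> tuples G (Suc n).
        f (tl xs)
        + (\<Sum>i<n. (- 1) ^ Suc i * f (take i xs @ (xs ! i \<otimes>\<^bsub>G\<^esub> xs ! Suc i) # drop (i + 2) xs))
        + (- 1) ^ Suc n * f (butlast xs))"

definition cocycles :: "('g, 'm) monoid_scheme \<Rightarrow> nat \<Rightarrow> ('g list \<Rightarrow> int) set"
  where "cocycles G n = kernel (cochain_group G n) (cochain_group G (Suc n)) (coboundary_map G n)"

primrec coboundaries :: "('g, 'm) monoid_scheme \<Rightarrow> nat \<Rightarrow> ('g list \<Rightarrow> int) set"
  where
  "coboundaries G 0 = {\<one>\<^bsub>cochain_group G 0\<^esub>}"
| "coboundaries G (Suc n) = coboundary_map G n ` carrier (cochain_group G n)"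

definition cohomology :: "('g, 'm) monoid_scheme \<Rightarrow> nat \<Rightarrow> ('g list \<Rightarrow> int) set monoid"
  where "cohomology G n = (cochain_group G n)\<lparr>carrier := cocycles G n\<rparr> Mod coboundaries G n"

definition cup_cochain ::
    "('g, 'm) monoid_scheme \<Rightarrow> nat \<Rightarrow> nat \<Rightarrow> ('g list \<Rightarrow> int) \<Rightarrow> ('g list \<Rightarrow> int) \<Rightarrow> ('g list \<Rightarrow> int)"
  where "cup_cochain G p q f g = (\<lambda>xs \<in> tuples G (p + q). f (take p xs) * g (drop p xs))"

text \<open>
  The cup product of a class of degree \<open>p\<close> and a class of degree \<open>q\<close>. As in \<^const>\<open>rcoset_mult\<close>, the
  union runs over all representatives; they all contribute the same coset.
\<close>

definition cup ::
    "('g, 'm) monoid_scheme \<Rightarrow> nat \<Rightarrow> nat \<Rightarrow>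
      ('g list \<Rightarrow> int) set \<Rightarrow> ('g list \<Rightarrow> int) set \<Rightarrow> ('g list \<Rightarrow> int) set"
  where
  "cup G p q U V =
    (\<Union>f\<in>U. \<Union>g\<in>V. coboundaries G (p + q) #>\<^bsub>cochain_group G (p + q)\<^esub> cup_cochain G p q f g)"

end

theory Submission
  imports Defs "HOL-Library.Function_Algebras" "HOL-Library.Countable_Set"
    "HOL-Number_Theory.Residues"
begin

text \<open>
  Write \<open>N\<close> for the finite group \<open>\<int>\<^sub>a \<rtimes> \<int>\<^sub>b\<close> and \<open>t\<close> for the generator of the infinite cyclic
  factor, so that \<open>G\<close> is generated by \<open>N\<close> and \<open>t\<close>. A cochain of degree \<open>n\<close> in homogeneous form is
  a function of \<open>n + 1\<close> points of the set \<open>X\<close> underlying \<open>G\<close>. Every subgroup of \<open>G\<close> acts freely on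
  \<open>X\<close> by left translation, so the cochains invariant under a subgroup compute the cohomology of
  that subgroup. In this model restriction is inclusion, transfer is a sum of translates, an
  element that normalizes a subgroup acts by translation, and the cup product is one formula for
  all subgroups.

  \<^emph>\<open>Cyclic groups.\<close> Let \<open>s\<close> generate a group of order \<open>m\<close>, and let \<open>\<alpha>\<close> be a coordinate on \<open>X\<close> that
  \<open>s\<close> increases by one modulo \<open>m\<close>. The class \<open>x\<close> of \<open>d((d \<alpha>) div m)\<close> has degree two, and because
  the kernel of the norm is the image of \<open>1 - s\<close>, multiplication by \<open>x\<close> is periodicity
  (\<open>periodicity_surj\<close>, \<open>periodicity_inj\<close>). Hence the cohomology is \<open>\<int>/m\<close>, generated by \<open>x\<^sup>i\<close>, in
  degree \<open>2 i > 0\<close>, and zero in odd degrees. A substitution that multiplies \<open>\<alpha>\<close> by \<open>c\<close> multiplies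
  \<open>x\<close> by \<open>c\<close> (\<open>pull_gen2\<close>).

  \<^emph>\<open>The group \<open>N\<close>.\<close> As \<open>a\<close> and \<open>b\<close> are coprime, transfer shows that a class of \<open>N\<close> is determined
  by its restrictions to \<open>\<int>\<^sub>a\<close> and \<open>\<int>\<^sub>b\<close> (\<open>cobd_N_if\<close>). In degree \<open>2 i > 0\<close> these are \<open>u x\<^sub>a\<^sup>i\<close>
  and \<open>v x\<^sub>b\<^sup>i\<close>, which gives the class coordinates \<open>(u, v)\<close> in \<open>\<int>/a \<times> \<int>/b\<close>. The pairs that occur
  are those with \<open>(r\<^sup>i - 1) u = 0\<close>. In odd degrees there is nothing. Coordinates multiply under
  the cup product, and \<open>t\<close> multiplies them by \<open>(c\<^sub>a\<^sup>i, c\<^sub>b\<^sup>i)\<close>.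

  \<^emph>\<open>The group \<open>G\<close>.\<close> On cochains invariant under \<open>N\<close> the map \<open>1 - t\<close> is onto
  (\<open>inv_N_subtract_t_surj\<close>), which yields the Wang sequence in explicit form. An even class of \<open>G\<close>
  is the same as a class of \<open>N\<close> fixed by \<open>t\<close>. An odd class is represented by \<open>d h\<close> with \<open>h\<close>
  invariant under \<open>N\<close>; then \<open>h - t h\<close> is a cocycle of \<open>N\<close>, well defined up to the image of \<open>1 -
  t\<close>. The class of degree one belongs to \<open>h - t h = 1\<close>. Thus an even class has the coordinates of
  its restriction to \<open>N\<close>, and an odd class has those of \<open>h - t h\<close>. The generators have coordinates
  \<open>(a/A\<^sub>i, 0)\<close> and \<open>(0, b/B\<^sub>i)\<close> in even degrees, \<open>(a/\<delta>\<^sub>i, 0)\<close> and \<open>(0, 1)\<close> in odd degrees.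

  For an even cocycle \<open>E\<close> of \<open>G\<close> one has \<open>E \<smile> d h = d(E \<smile> h)\<close> and \<open>E \<smile> h - t (E \<smile> h) = E \<smile> (h - t
  h)\<close>, so coordinates multiply here as well, and each product formula becomes an identity between
  coordinates. A product of two odd classes vanishes over \<open>N\<close>, where the first factor is a
  coboundary, and therefore vanishes. Finally \<open>\<phi>\<^sub>a\<^sup>p + \<phi>\<^sub>b\<^sup>p\<close> has coordinates \<open>(1, 1)\<close>, because
  \<open>A\<^sub>p = a\<close> and \<open>B\<^sub>p = b\<close>.
\<close>

section \<open>Homogeneous cochains\<close>

text \<open>
  The alternating sum over the omitted point. Recursion on the first point makes the complex
  visibly contractible, and lets identities be proved by induction on the list.
\<close>
fun codiff :: "('x list \<Rightarrow> int) \<Rightarrow> 'x list \<Rightarrow> int" where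
  "codiff F [] = 0"
| "codiff F (x # xs) = F xs - codiff (\<lambda>ys. F (x # ys)) xs"

definition pull :: "('x \<Rightarrow> 'x) \<Rightarrow> ('x list \<Rightarrow> int) \<Rightarrow> 'x list \<Rightarrow> int"
  where "pull g F xs = F (map g xs)"

definition hcup :: "nat \<Rightarrow> ('x list \<Rightarrow> int) \<Rightarrow> ('x list \<Rightarrow> int) \<Rightarrow> 'x list \<Rightarrow> int"
  where "hcup p F G xs = F (take (Suc p) xs) * G (drop p xs)"

definition hunit :: "'x list \<Rightarrow> int"
  where "hunit xs = (if length xs = 1 then 1 else 0)"

text \<open>
  Functions supported on lists of length \<open>n + 1\<close>. Fixing the value to be zero elsewhere makes
  equality of cochains equality of functions.
\<close>
definition cochains :: "nat \<Rightarrow> ('x list \<Rightarrow> int) set"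
  where "cochains n = {F. \<forall>xs. length xs \<noteq> Suc n \<longrightarrow> F xs = 0}"

definition inv_cochains :: "('x \<Rightarrow> 'x) set \<Rightarrow> nat \<Rightarrow> ('x list \<Rightarrow> int) set"
  where "inv_cochains S n = {F \<in> cochains n. \<forall>g\<in>S. pull g F = F}"

definition cocyc :: "('x \<Rightarrow> 'x) set \<Rightarrow> nat \<Rightarrow> ('x list \<Rightarrow> int) set"
  where "cocyc S n = {F \<in> inv_cochains S n. codiff F = 0}"

text \<open>
  As the complex starts in degree zero, only the zero cochain bounds there.
\<close>
primrec cobd :: "('x \<Rightarrow> 'x) set \<Rightarrow> nat \<Rightarrow> ('x list \<Rightarrow> int) set" where
  "cobd S 0 = {0}"
| "cobd S (Suc n) = codiff ` inv_cochains S n"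

lemma of_int_fun_apply [simp]: "of_int k x = (of_int k :: 'b::ring_1)"
  by (cases k) (simp_all add: fun_Compl_def)

lemma minus_one_power_fun_apply [simp]: "((-1) ^ n :: 'a \<Rightarrow> int) x = (-1) ^ n"
  by (induction n) auto

text \<open>
  Folds the constant function to which pointwise simplification of the zero cochain leads.
\<close>
declare zero_fun_def [symmetric, simp]

lemma sum_fun_apply: "(\<Sum>i\<in>I. F i) x = (\<Sum>i\<in>I. F i x)"
  using sum_comp_morphism[of "\<lambda>f. f x" F I] by (simp add: comp_def)

subsection \<open>The differential\<close>

lemma codiff_add: "codiff (F + G) = codiff F + codiff G"
proof -
  have "codiff (\<lambda>ys. F ys + G ys) xs = codiff F xs + codiff G xs" for xs
    by (induction xs arbitrary: F G) auto
  then show ?thesis by (simp add: fun_eq_iff plus_fun_def)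
qed

lemma codiff_scale: "codiff (of_int k * F) = of_int k * codiff F"
proof -
  have "codiff (\<lambda>ys. k * F ys) xs = k * codiff F xs" for xs
    by (induction xs arbitrary: F) (auto simp: right_diff_distrib)
  then show ?thesis by (simp add: fun_eq_iff times_fun_def)
qed

lemma codiff_uminus: "codiff (- F) = - codiff F"
  using codiff_scale[of "-1" F] by simp

lemma codiff_diff: "codiff (F - G) = codiff F - codiff G"
  using codiff_add[of F "-G"] by (simp add: codiff_uminus)

lemma codiff_zero [simp]: "codiff 0 = 0"
  using codiff_diff[of 0 0] by simp

lemma codiff_sum: "codiff (\<Sum>i\<in>I. F i) = (\<Sum>i\<in>I. codiff (F i))"
  using sum_comp_morphism[of codiff F I] by (simp add: codiff_add comp_def)

lemma codiff_codiff [simp]: "codiff (codiff F) = 0"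
proof
  fix xs show "codiff (codiff F) xs = 0 xs"
  proof (induction xs arbitrary: F)
    case (Cons x xs)
    have "(\<lambda>ys. codiff F (x # ys)) = F - codiff (\<lambda>ys. F (x # ys))"
      by auto
    then show ?case using Cons by (simp add: codiff_diff)
  qed simp
qed

lemma codiff_pull: "codiff (pull g F) = pull g (codiff F)"
proof -
  have "codiff (\<lambda>ys. F (map g ys)) xs = codiff F (map g xs)" for xs
    by (induction xs arbitrary: F) (auto dest: meta_spec[of _ "\<lambda>ys. F (g _ # ys)"])
  then show ?thesis by (simp add: fun_eq_iff pull_def[abs_def])
qed

lemma codiff_cochains: "F \<in> cochains n \<Longrightarrow> codiff F \<in> cochains (Suc n)"
proof -
  have "(\<And>ys. Suc (length ys) \<noteq> length xs \<or> xs = [] \<or> F ys = 0) \<Longrightarrow> codiff F xs = 0" for xs and F :: "'a list \<Rightarrow> int"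
  proof (induction xs arbitrary: F)
    case (Cons x xs)
    have "codiff (\<lambda>ys. F (x # ys)) xs = 0"
      by (rule Cons.IH) (metis Cons.prems length_Cons list.distinct(1))
    moreover have "F xs = 0" using Cons.prems[of xs] by simp
    ultimately show ?case by simp
  qed simp
  then show "F \<in> cochains n \<Longrightarrow> codiff F \<in> cochains (Suc n)"
    by (fastforce simp: cochains_def)
qed

text \<open>
  The cone on an arbitrary point \<open>x\<^sub>0\<close> contracts the full complex. It destroys invariance, which
  is why the invariant subcomplexes have cohomology.
\<close>
lemma acyclic:
  assumes "F \<in> cochains (Suc n)" "codiff F = 0"
  shows "\<exists>h\<in>cochains n. codiff h = F"
proof -
  fix x0 :: 'a
  define h where "h = (\<lambda>xs. F (x0 # xs))"
  have "codiff h xs = F xs" for xs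
    using fun_cong[OF assms(2), of "x0 # xs"] by (simp add: h_def)
  moreover have "h \<in> cochains n" using assms(1) by (auto simp: h_def cochains_def)
  ultimately show ?thesis by blast
qed

lemma acyclic_0:
  assumes "F \<in> cochains 0" "codiff F = 0"
  shows "\<exists>k. F = of_int k * hunit"
proof -
  fix x0 :: 'a
  have eq: "F [x] = F [x0]" for x
    using fun_cong[OF assms(2), of "[x0, x]"] by simp
  have "F xs = (of_int (F [x0]) * hunit) xs" for xs
  proof (cases "length xs = 1")
    case True
    then obtain x where "xs = [x]" by (auto simp: length_Suc_conv)
    then show ?thesis using eq by (simp add: hunit_def)
  next
    case False then show ?thesis using assms(1) by (simp add: cochains_def hunit_def)
  qed
  then show ?thesis by blast
qed

lemma codiff_hunit [simp]: "codiff hunit = 0"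
proof
  fix xs :: "'a list"
  have 0: "codiff (\<lambda>ws. 0::int) zs = 0" for zs :: "'a list"
    by (induction zs) auto
  have *: "codiff (\<lambda>ys. hunit (x # ys)) ys = (if length ys = 1 then 1 else 0)" for x and ys :: "'a list"
    by (cases ys) (auto simp: hunit_def 0)
  show "codiff hunit xs = 0 xs"
    by (cases xs) (simp_all add: *, simp_all add: hunit_def)
qed

lemma cochains_iff: "F \<in> cochains n \<longleftrightarrow> (\<forall>xs. F xs \<noteq> 0 \<longrightarrow> length xs = Suc n)"
  by (auto simp: cochains_def)

lemma pull_add: "pull g (F + G) = pull g F + pull g G" and
  pull_diff: "pull g (F - G) = pull g F - pull g G" and
  pull_uminus: "pull g (- F) = - pull g F" and
  pull_scale: "pull g (of_int k * F) = of_int k * pull g F" and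
  pull_0 [simp]: "pull g 0 = 0" and
  pull_hunit [simp]: "pull g hunit = hunit" and
  pull_sign: "pull g ((-1) ^ n * F) = (-1) ^ n * pull g F"
  by (auto simp: pull_def hunit_def)

lemma pull_sum: "pull g (\<Sum>i\<in>I. F i) = (\<Sum>i\<in>I. pull g (F i))"
  using sum_comp_morphism[of "pull g" F I] by (simp add: pull_add comp_def)

lemma pull_comp: "pull g (pull h F) = pull (h \<circ> g) F"
  by (auto simp: pull_def)

lemma pull_id [simp]: "pull id F = F" "pull (\<lambda>x. x) F = F"
  by (auto simp: pull_def)

lemma pull_cochains: "F \<in> cochains n \<Longrightarrow> pull g F \<in> cochains n"
  by (simp add: cochains_def pull_def)

lemma pull_funpow_fixed: "pull g F = F \<Longrightarrow> pull (g ^^ i) F = F"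
  by (induction i) (simp_all add: funpow_swap1 pull_comp[symmetric] del: funpow.simps(2) add: funpow_Suc_right)

subsection \<open>The cup product\<close>

lemma hcup_cochains: "F \<in> cochains p \<Longrightarrow> G \<in> cochains q \<Longrightarrow> hcup p F G \<in> cochains (p + q)"
  unfolding cochains_iff hcup_def by (auto simp: min_def split: if_splits)

lemma hcup_bilinear:
  "hcup p (F + F') G = hcup p F G + hcup p F' G"
  "hcup p F (G + G') = hcup p F G + hcup p F G'"
  "hcup p (F - F') G = hcup p F G - hcup p F' G"
  "hcup p F (G - G') = hcup p F G - hcup p F G'"
  "hcup p (of_int k * F) G = of_int k * hcup p F G"
  "hcup p F (of_int k * G) = of_int k * hcup p F G"
  "hcup p F ((-1) ^ n * G) = (-1) ^ n * hcup p F G"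
  "hcup p 0 G = 0" "hcup p F 0 = 0"
  by (auto simp: hcup_def algebra_simps)

lemma hcup_sum: "hcup p F (\<Sum>i\<in>I. G i) = (\<Sum>i\<in>I. hcup p F (G i))"
  using sum_comp_morphism[of "hcup p F" G I] by (simp add: hcup_bilinear comp_def)

lemma pull_hcup: "pull g (hcup p F G) = hcup p (pull g F) (pull g G)"
  by (auto simp: pull_def hcup_def take_map drop_map)

lemma hcup_assoc: "hcup (p + q) (hcup p F G) K = hcup p F (hcup q G K)"
  by (rule ext) (simp add: hcup_def min_def drop_take add.commute)

lemma hcup_hunit_right: "F \<in> cochains p \<Longrightarrow> hcup p F hunit = F"
  unfolding hcup_def hunit_def cochains_def by (auto simp: fun_eq_iff)

text \<open>
  The Leibniz rule. Both cochains have to be homogeneous: on a list that is too short the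
  truncations in \<^const>\<open>hcup\<close> would yield spurious terms.
\<close>
lemma codiff_hcup:
  assumes "F \<in> cochains p" "G \<in> cochains q"
  shows "codiff (hcup p F G) = hcup (Suc p) (codiff F) G + (-1) ^ p * hcup p F (codiff G)"
proof
  fix xs
  have main: "length xs \<ge> p + 2 \<Longrightarrow>
    codiff (hcup p F G) xs = codiff F (take (p + 2) xs) * G (drop (Suc p) xs) + (-1) ^ p * (F (take (Suc p) xs) * codiff G (drop p xs))"
    for F :: "'a list \<Rightarrow> int" and xs p
  proof (induction p arbitrary: F xs)
    case 0
    then obtain x y zs where xs: "xs = x # y # zs" by (auto simp: numeral_2_eq_2 Suc_le_length_iff)
    have "(\<lambda>ys. hcup 0 F G (x # ys)) = of_int (F [x]) * (\<lambda>ys. G (x # ys))"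
      by (auto simp: hcup_def)
    then have "codiff (hcup 0 F G) xs = hcup 0 F G (y # zs) - (of_int (F [x]) * codiff (\<lambda>ys. G (x # ys))) (y # zs)"
      unfolding xs using codiff_scale[of "F [x]" "\<lambda>ys. G (x # ys)"] by (metis codiff.simps(2))
    then show ?case by (simp add: xs hcup_def algebra_simps)
  next
    case (Suc p)
    then obtain x ys where xs: "xs = x # ys" and l: "length ys \<ge> p + 2"
      by (cases xs) auto
    have e: "(\<lambda>zs. hcup (Suc p) F G (x # zs)) = hcup p (\<lambda>zs. F (x # zs)) G"
      by (auto simp: hcup_def)
    show ?case unfolding xs codiff.simps e Suc.IH[OF l]
      by (simp add: hcup_def algebra_simps)
  qed
  have "codiff (hcup p F G) \<in> cochains (Suc (p + q))" "hcup (Suc p) (codiff F) G \<in> cochains (Suc (p + q))"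
    "hcup p F (codiff G) \<in> cochains (Suc (p + q))"
    using assms codiff_cochains hcup_cochains[of F p "codiff G" "Suc q"] hcup_cochains[of "codiff F" "Suc p" G q]
    by (auto intro: codiff_cochains hcup_cochains)
  then have "length xs < p + 2 \<Longrightarrow> codiff (hcup p F G) xs = 0 \<and> hcup (Suc p) (codiff F) G xs = 0 \<and> hcup p F (codiff G) xs = 0"
    by (auto simp: cochains_def)
  then show "codiff (hcup p F G) xs = (hcup (Suc p) (codiff F) G + (-1) ^ p * hcup p F (codiff G)) xs"
    using main[of p xs F] by (cases "length xs < p + 2") (auto simp: hcup_def)
qed

subsection \<open>Invariant cochains\<close>

lemma cochains_closed:
  "0 \<in> cochains n" "F \<in> cochains n \<Longrightarrow> G \<in> cochains n \<Longrightarrow> F + G \<in> cochains n"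
  "F \<in> cochains n \<Longrightarrow> G \<in> cochains n \<Longrightarrow> F - G \<in> cochains n"
  "F \<in> cochains n \<Longrightarrow> of_int k * F \<in> cochains n"
  "F \<in> cochains n \<Longrightarrow> (-1) ^ m * F \<in> cochains n"
  "hunit \<in> cochains 0"
  by (auto simp: cochains_def hunit_def)

lemma cochains_sum: "(\<And>i. i \<in> I \<Longrightarrow> F i \<in> cochains n) \<Longrightarrow> (\<Sum>i\<in>I. F i) \<in> cochains n"
  by (induction I rule: infinite_finite_induct) (auto intro: cochains_closed)

lemma inv_cochains_closed:
  "0 \<in> inv_cochains S n" "F \<in> inv_cochains S n \<Longrightarrow> G \<in> inv_cochains S n \<Longrightarrow> F + G \<in> inv_cochains S n"
  "F \<in> inv_cochains S n \<Longrightarrow> G \<in> inv_cochains S n \<Longrightarrow> F - G \<in> inv_cochains S n"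
  "F \<in> inv_cochains S n \<Longrightarrow> of_int k * F \<in> inv_cochains S n"
  "F \<in> inv_cochains S n \<Longrightarrow> (-1) ^ m * F \<in> inv_cochains S n"
  "hunit \<in> inv_cochains S 0"
  by (auto simp: inv_cochains_def cochains_closed pull_add pull_diff pull_scale pull_sign)

lemma inv_cochains_hcup: "F \<in> inv_cochains S p \<Longrightarrow> G \<in> inv_cochains S q \<Longrightarrow> hcup p F G \<in> inv_cochains S (p + q)"
  by (auto simp: inv_cochains_def hcup_cochains pull_hcup)

lemma inv_cochains_codiff: "F \<in> inv_cochains S n \<Longrightarrow> codiff F \<in> inv_cochains S (Suc n)"
  by (auto simp: inv_cochains_def codiff_cochains codiff_pull[symmetric])

lemma inv_cochains_cochains: "F \<in> inv_cochains S n \<Longrightarrow> F \<in> cochains n"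
  by (simp add: inv_cochains_def)

lemma inv_cochains_mono: "F \<in> inv_cochains S n \<Longrightarrow> S' \<subseteq> S \<Longrightarrow> F \<in> inv_cochains S' n"
  by (auto simp: inv_cochains_def)

lemma cocyc_closed:
  "0 \<in> cocyc S n" "F \<in> cocyc S n \<Longrightarrow> G \<in> cocyc S n \<Longrightarrow> F + G \<in> cocyc S n"
  "F \<in> cocyc S n \<Longrightarrow> G \<in> cocyc S n \<Longrightarrow> F - G \<in> cocyc S n"
  "F \<in> cocyc S n \<Longrightarrow> of_int k * F \<in> cocyc S n"
  "hunit \<in> cocyc S 0"
  by (auto simp: cocyc_def inv_cochains_closed codiff_add codiff_diff codiff_scale)

lemma cocyc_hcup: "F \<in> cocyc S p \<Longrightarrow> G \<in> cocyc S q \<Longrightarrow> hcup p F G \<in> cocyc S (p + q)"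
  by (auto simp: cocyc_def inv_cochains_hcup codiff_hcup[OF inv_cochains_cochains inv_cochains_cochains] hcup_bilinear)

lemma cocyc_mono: "F \<in> cocyc S n \<Longrightarrow> S' \<subseteq> S \<Longrightarrow> F \<in> cocyc S' n"
  by (auto simp: cocyc_def inv_cochains_mono)

lemma cocyc_inv: "F \<in> cocyc S n \<Longrightarrow> F \<in> inv_cochains S n"
  by (simp add: cocyc_def)

lemma cocyc_cochains: "F \<in> cocyc S n \<Longrightarrow> F \<in> cochains n"
  by (simp add: cocyc_def inv_cochains_def)

lemma cobd_closed:
  "0 \<in> cobd S n" "F \<in> cobd S n \<Longrightarrow> G \<in> cobd S n \<Longrightarrow> F + G \<in> cobd S n"
  "F \<in> cobd S n \<Longrightarrow> G \<in> cobd S n \<Longrightarrow> F - G \<in> cobd S n"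
  "F \<in> cobd S n \<Longrightarrow> of_int k * F \<in> cobd S n"
     apply (cases n; auto simp: image_iff intro!: bexI[OF _ inv_cochains_closed(1)]; fail)
    apply (cases n; auto simp: codiff_add[symmetric] intro!: imageI inv_cochains_closed; fail)
   apply (cases n; auto simp: codiff_diff[symmetric] intro!: imageI inv_cochains_closed; fail)
  apply (cases n; auto simp: codiff_scale[symmetric] intro!: imageI inv_cochains_closed; fail)
  done

lemma cobd_cocyc: "F \<in> cobd S n \<Longrightarrow> F \<in> cocyc S n"
  by (cases n) (auto simp: cocyc_closed, auto simp: cocyc_def inv_cochains_codiff)

lemma cobd_mono: "F \<in> cobd S n \<Longrightarrow> S' \<subseteq> S \<Longrightarrow> F \<in> cobd S' n"
  by (cases n) (auto intro: imageI inv_cochains_mono)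

lemma cobd_uminus: "F \<in> cobd S n \<Longrightarrow> - F \<in> cobd S n"
  using cobd_closed(4)[of F S n "-1"] by simp

lemma cobd_minus_commute: "F - G \<in> cobd S n \<Longrightarrow> G - F \<in> cobd S n"
  using cobd_uminus by fastforce

lemma cobd_trans: "F - G \<in> cobd S n \<Longrightarrow> G - K \<in> cobd S n \<Longrightarrow> F - K \<in> cobd S n"
  using cobd_closed(2)[of "F - G" S n "G - K"] by simp

lemma sign_square_fun: "(-1) ^ n * ((-1) ^ n * F) = (F :: 'a \<Rightarrow> int)"
  by (metis left_minus_one_mult_self mult.assoc)

lemma cocyc_hcup_cobd:
  assumes "F \<in> cocyc S p" "G \<in> cobd S q"
  shows "hcup p F G \<in> cobd S (p + q)"
proof (cases q)
  case (Suc m)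
  then obtain h where h: "h \<in> inv_cochains S m" "G = codiff h" using assms by auto
  have "hcup p F G = codiff ((-1) ^ p * hcup p F h)"
  proof -
    have "codiff ((-1) ^ p * hcup p F h) = (-1) ^ p * codiff (hcup p F h)"
      using codiff_scale[of "(-1) ^ p" "hcup p F h"] by simp
    also have "\<dots> = (-1) ^ p * ((-1) ^ p * hcup p F G)"
      using codiff_hcup[OF cocyc_cochains[OF assms(1)] inv_cochains_cochains[OF h(1)]] assms(1) h(2)
      by (simp add: cocyc_def hcup_bilinear)
    finally show ?thesis by (simp add: sign_square_fun)
  qed
  moreover have "(-1) ^ p * hcup p F h \<in> inv_cochains S (p + m)"
    by (intro inv_cochains_closed inv_cochains_hcup cocyc_inv assms h)
  ultimately show ?thesis using Suc by (metis add_Suc_right cobd.simps(2) image_eqI)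
qed (use assms in \<open>auto simp: hcup_bilinear cobd_closed\<close>)

lemma cobd_hcup_cocyc:
  assumes "F \<in> cobd S p" "G \<in> cocyc S q"
  shows "hcup p F G \<in> cobd S (p + q)"
proof (cases p)
  case (Suc m)
  then obtain h where h: "h \<in> inv_cochains S m" "F = codiff h" using assms by auto
  have "hcup p F G = codiff (hcup m h G)"
    using codiff_hcup[OF inv_cochains_cochains[OF h(1)] cocyc_cochains[OF assms(2)]] assms(2) h(2) Suc
    by (simp add: cocyc_def hcup_bilinear)
  moreover have "hcup m h G \<in> inv_cochains S (m + q)"
    by (intro inv_cochains_hcup cocyc_inv assms h)
  ultimately show ?thesis using Suc by (metis add_Suc cobd.simps(2) image_eqI)
qed (use assms in \<open>auto simp: hcup_bilinear cobd_closed\<close>)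

lemma hcup_cong_cobd:
  assumes "F \<in> cocyc S p" "F' - F \<in> cobd S p" "G \<in> cocyc S q" "G' - G \<in> cobd S q"
  shows "hcup p F' G' - hcup p F G \<in> cobd S (p + q)"
proof -
  have F': "F' \<in> cocyc S p"
    using cocyc_closed(2)[OF assms(1) cobd_cocyc[OF assms(2)]] by simp
  have "hcup p F' G' - hcup p F G = hcup p F' (G' - G) + hcup p (F' - F) G"
    by (simp add: hcup_bilinear)
  then show ?thesis
    using cocyc_hcup_cobd[OF F' assms(4)] cobd_hcup_cocyc[OF assms(2,3)] by (simp add: cobd_closed)
qed

section \<open>Cyclic groups\<close>

lemma inv_cochains_singleton: "F \<in> inv_cochains {g} n \<longleftrightarrow> F \<in> cochains n \<and> pull g F = F"
  by (simp add: inv_cochains_def)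

text \<open>
  Here \<open>s\<close> generates a cyclic group of order \<open>m\<close>. The existence of the coordinate says that the
  action is free: \<open>crd\<close> identifies each orbit with \<open>\<int>/m\<close>.
\<close>
locale cyclic_action =
  fixes s :: "'x \<Rightarrow> 'x" and m :: nat and crd :: "'x \<Rightarrow> int"
  assumes m_pos: "m > 0"
    and s_order: "s ^^ m = id"
    and crd_ge: "0 \<le> crd x" and crd_less: "crd x < int m"
    and crd_s: "crd (s x) = (crd x + 1) mod int m"
begin

definition norm :: "('x list \<Rightarrow> int) \<Rightarrow> 'x list \<Rightarrow> int"
  where "norm F = (\<Sum>i<m. pull (s ^^ i) F)"

lemma norm_cochains: "F \<in> cochains n \<Longrightarrow> norm F \<in> cochains n"
  unfolding norm_def by (intro cochains_sum pull_cochains)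

lemma pull_s_norm: "pull s (norm F) = norm F"
proof -
  have "pull s (norm F) = (\<Sum>i<m. pull (s ^^ Suc i) F)"
    by (simp add: norm_def pull_sum pull_comp funpow_Suc_right del: funpow.simps)
  also have "\<dots> = (\<Sum>i=0..<m. pull (s ^^ Suc i) F)" by (simp add: atLeast0LessThan)
  also have "\<dots> = norm F + (pull (s ^^ m) F - pull (s ^^ 0) F)"
    using sum.atLeast_Suc_lessThan_Suc_shift[of "\<lambda>i. pull (s ^^ i) F" 0 m] sum.atLeast_Suc_lessThan[of 0 "Suc m" "\<lambda>i. pull (s ^^ i) F"]
    by (simp add: norm_def atLeast0LessThan comp_def lessThan_Suc algebra_simps del: funpow.simps)
  finally show ?thesis by (simp add: s_order)
qed

lemma norm_pull: "norm (pull s F) = norm F"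
proof -
  have "norm (pull s F) = pull s (norm F)"
    unfolding norm_def pull_sum by (simp add: pull_comp funpow_swap1 comp_def)
  then show ?thesis by (simp add: pull_s_norm)
qed

lemma norm_diff: "norm (F - G) = norm F - norm G"
  by (simp add: norm_def pull_diff sum_subtractf)

lemma norm_scale: "norm (of_int k * F) = of_int k * norm F"
  by (simp add: norm_def pull_scale sum_distrib_left)

lemma norm_codiff: "norm (codiff F) = codiff (norm F)"
  by (simp add: norm_def codiff_sum codiff_pull)

lemma norm_inv: "F \<in> cochains n \<Longrightarrow> norm F \<in> inv_cochains {s} n"
  by (simp add: inv_cochains_singleton norm_cochains pull_s_norm)

lemma norm_fixed: "pull s F = F \<Longrightarrow> norm F = of_int (int m) * F"
  by (simp add: norm_def pull_funpow_fixed)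

lemma norm_hcup: "pull s F = F \<Longrightarrow> norm (hcup p F G) = hcup p F (norm G)"
  by (simp add: norm_def hcup_sum pull_hcup pull_funpow_fixed)

text \<open>
  Freeness makes the full cochain complex coinduced, so the kernel of the norm is the image of \<open>1
  - s\<close>. A preimage \<open>k\<close> sums the values along the orbit from the given tuple up to the tuple whose
  first point has the largest coordinate \<open>m - 1\<close>; one step further the sum runs over the whole
  orbit, and vanishes.
\<close>
lemma norm_zero_imp:
  assumes "F \<in> cochains n" "norm F = 0"
  shows "\<exists>k\<in>cochains n. F = k - pull s k"
proof -
  \<comment> \<open>The number of steps from \<open>x\<close> to the point past coordinate \<open>m - 1\<close>; it lies between \<open>1\<close> and \<open>m\<close>.\<close>
  define st where "st x = nat (int m - crd x)" for x
  define k where "k xs = (if xs = [] then 0 else \<Sum>i<st (hd xs). F (map (s ^^ i) xs))" for xs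
  have "F xs = k xs - k (map s xs)" for xs
  proof (cases xs)
    case Nil then show ?thesis using assms(1) by (simp add: k_def cochains_def)
  next
    case (Cons x ys)
    have N: "(\<Sum>i<m. F (map (s ^^ i) zs)) = 0" for zs
      using fun_cong[OF assms(2), of zs] by (simp add: norm_def pull_def sum_fun_apply)
    have shift: "(\<Sum>i<j. F (map (s ^^ i) (map s xs))) = (\<Sum>i<j. F (map (s ^^ Suc i) xs))" for j
      by (simp add: funpow_Suc_right del: funpow.simps)
    show ?thesis
    proof (cases "crd x = int m - 1")
      case True
      then have "st x = 1" "st (s x) = m" using crd_s[of x] by (simp_all add: st_def)
      then show ?thesis using N[of "map s xs"] Cons by (simp add: k_def del: map_map)
    next
      case False
      then have c: "crd x + 1 < int m" using crd_less[of x] by simp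
      then have "crd (s x) = crd x + 1" using crd_s[of x] crd_ge[of x] by simp
      then have st: "st x = Suc (st (s x))" using c by (simp add: st_def nat_diff_distrib)
      have "k xs = (\<Sum>i<Suc (st (s x)). F (map (s ^^ i) xs))" using Cons st by (simp add: k_def)
      also have "\<dots> = F xs + (\<Sum>i<st (s x). F (map (s ^^ Suc i) xs))"
        by (subst sum.lessThan_Suc_shift) simp
      also have "\<dots> = F xs + k (map s xs)"
        using shift[of "st (s x)"] Cons by (simp add: k_def del: map_map funpow.simps)
      finally show ?thesis by simp
    qed
  qed
  moreover have "k \<in> cochains n" using assms(1) by (auto simp: cochains_def k_def)
  ultimately show ?thesis by (intro bexI[of _ k]) (auto simp: pull_def)
qed

definition crd0 :: "'x list \<Rightarrow> int"
  where "crd0 xs = (if length xs = 1 then crd (hd xs) else 0)"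

definition last0 :: "'x list \<Rightarrow> int"
  where "last0 xs = (if length xs = 1 \<and> crd (hd xs) = int m - 1 then 1 else 0)"

text \<open>
  The carry of addition modulo \<open>m\<close>, up to sign: \<open>carry\<close> takes \<open>-1\<close> on a pair whose coordinate
  drops and \<open>0\<close> otherwise. Together with \<open>step\<close>, the coordinate difference reduced modulo \<open>m\<close>, it
  splits \<open>d \<alpha>\<close>.
\<close>
definition carry :: "'x list \<Rightarrow> int"
  where "carry xs = codiff crd0 xs div int m"

definition step :: "'x list \<Rightarrow> int"
  where "step = codiff crd0 - of_int (int m) * carry"

text \<open>
  As \<open>step\<close> is invariant and \<open>d step = - m gen2\<close>, this is up to sign the Bockstein of the class of
  degree one that \<open>step\<close> defines modulo \<open>m\<close>.
\<close>
definition gen2 :: "'x list \<Rightarrow> int"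
  where "gen2 = codiff carry"

lemma crd0_cochains: "crd0 \<in> cochains 0" and last0_cochains: "last0 \<in> cochains 0"
  by (auto simp: cochains_def crd0_def last0_def)

lemma carry_cochains: "carry \<in> cochains 1"
  using codiff_cochains[OF crd0_cochains] by (auto simp: cochains_def carry_def)

lemma pull_crd0: "pull s crd0 = crd0 + hunit - of_int (int m) * last0"
proof
  fix xs :: "'x list"
  have "crd (s x) = crd x + 1 - int m * (if crd x = int m - 1 then 1 else 0)" for x
    using crd_s[of x] crd_ge[of x] crd_less[of x] by auto
  then show "pull s crd0 xs = (crd0 + hunit - of_int (int m) * last0) xs"
    by (cases xs) (auto simp: pull_def crd0_def hunit_def last0_def)
qed

lemma pull_carry: "pull s carry = carry - codiff last0"
proof
  fix xs :: "'x list"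
  have "pull s carry xs = codiff (pull s crd0) xs div int m"
    by (simp add: codiff_pull) (simp add: pull_def carry_def)
  also have "codiff (pull s crd0) = codiff crd0 - of_int (int m) * codiff last0"
    by (simp add: pull_crd0 codiff_add codiff_diff codiff_scale[symmetric] del: of_int_of_nat_eq)
  also have "\<dots> xs div int m = (codiff crd0 xs + int m * (- codiff last0 xs)) div int m" by simp
  also have "\<dots> = (carry - codiff last0) xs"
    using m_pos by (subst div_mult_self2) (auto simp: carry_def)
  finally show "pull s carry xs = (carry - codiff last0) xs" .
qed

text \<open>
  Each orbit meets the points of coordinate \<open>m - 1\<close> exactly once.
\<close>
lemma norm_last0: "norm last0 = hunit"
proof
  fix xs :: "'x list"
  have crd_pow: "crd ((s ^^ i) x) = (crd x + int i) mod int m" for i x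
  proof (induction i)
    case 0 then show ?case using crd_ge crd_less by simp
  next
    case (Suc i) then show ?case by (simp add: crd_s mod_simps ac_simps)
  qed
  show "norm last0 xs = hunit xs"
  proof (cases "length xs = 1")
    case True
    then obtain x where xs: "xs = [x]" by (auto simp: length_Suc_conv)
    have "norm last0 xs = (\<Sum>i<m. if (crd x + int i) mod int m = int m - 1 then 1 else 0)"
      by (simp add: norm_def sum_fun_apply pull_def xs last0_def crd_pow)
    also have "\<dots> = (\<Sum>i<m. if i = nat (int m - 1 - crd x) then 1 else 0)"
    proof (rule sum.cong[OF refl])
      fix i assume i: "i \<in> {..<m}"
      have "(crd x + int i) mod int m = (if crd x + int i < int m then crd x + int i else crd x + int i - int m)"
        using i crd_ge[of x] crd_less[of x] minus_mod_self2[of "crd x + int i" "int m"] mod_pos_pos_trivial[of "crd x + int i - int m" "int m"]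
        by (cases "crd x + int i < int m") simp_all
      then show "(if (crd x + int i) mod int m = int m - 1 then 1 else 0) = (if i = nat (int m - 1 - crd x) then 1 else (0::int))"
        using i crd_ge[of x] crd_less[of x] by auto
    qed
    also have "\<dots> = 1" using crd_ge[of x] crd_less[of x] m_pos by (subst sum.delta) auto
    finally show ?thesis by (simp add: xs hunit_def)
  next
    case False then show ?thesis by (simp add: norm_def sum_fun_apply pull_def last0_def hunit_def)
  qed
qed

lemma gen2_cocyc: "gen2 \<in> cocyc {s} 2"
  using codiff_cochains[OF carry_cochains]
  by (simp add: cocyc_def inv_cochains_singleton gen2_def codiff_pull[symmetric] pull_carry codiff_diff numeral_2_eq_2)

lemma step_cochains: "step \<in> cochains 1"
  unfolding step_def using codiff_cochains[OF crd0_cochains] by (intro cochains_closed carry_cochains) simp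

lemma pull_step: "pull s step = step"
  unfolding step_def pull_diff codiff_pull[symmetric] pull_scale pull_carry pull_crd0
  by (simp add: codiff_add codiff_diff codiff_scale[of "int m", simplified] algebra_simps)

lemma codiff_step: "codiff step = - (of_int (int m) * gen2)"
  by (simp only: step_def codiff_diff codiff_scale gen2_def codiff_codiff) simp

lemma m_gen2_cobd: "of_int (int m) * gen2 \<in> cobd {s} 2"
proof -
  have "codiff step \<in> cobd {s} (Suc 1)"
    unfolding cobd.simps by (rule imageI) (simp add: inv_cochains_singleton step_cochains pull_step del: One_nat_def)
  from cobd_uminus[OF this] show ?thesis by (simp add: codiff_step numeral_2_eq_2 del: cobd.simps)
qed

text \<open>
  Write \<open>u\<close> for \<open>last0\<close> and \<open>v\<close> for \<open>carry\<close>, so that \<open>norm u = 1\<close>, \<open>d u = v - s v\<close> and \<open>gen2 = d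
  v\<close>. Two successive dimension shifts, \<open>F = d h\<close> and \<open>h - s h = d h\<^sub>1\<close>, send \<open>F\<close> to the norm \<open>G\<close>
  of \<open>h\<^sub>1\<close>. The same two shifts send \<open>G \<smile> gen2\<close> to the norm of \<open>G \<smile> u\<close>, which is \<open>G\<close> again.
\<close>
lemma periodicity_surj:
  assumes F: "F \<in> cocyc {s} (n + 2)"
  shows "\<exists>G\<in>cocyc {s} n. F - hcup n G gen2 \<in> cobd {s} (n + 2)"
proof -
  have Fc: "F \<in> cochains (Suc (Suc n))" "codiff F = 0" "pull s F = F"
    using F by (auto simp: cocyc_def inv_cochains_singleton)
  obtain h where h: "h \<in> cochains (Suc n)" "codiff h = F" using acyclic[OF Fc(1,2)] by blast
  have "codiff (h - pull s h) = 0" by (simp add: codiff_diff codiff_pull h Fc)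
  then obtain h1 where h1: "h1 \<in> cochains n" "codiff h1 = h - pull s h"
    using acyclic cochains_closed(3)[OF h(1) pull_cochains[OF h(1)]] by metis
  define G where "G = norm h1"
  have G: "G \<in> cocyc {s} n"
    by (simp add: G_def cocyc_def norm_inv h1 norm_codiff[symmetric] norm_diff norm_pull)
  then have Gs: "G \<in> cochains n" "pull s G = G" "codiff G = 0"
    by (auto simp: cocyc_def inv_cochains_singleton)
  have "norm (h1 - hcup n G last0) = 0"
    using Gs by (simp add: norm_diff norm_hcup norm_last0 hcup_hunit_right G_def[symmetric])
  moreover have "h1 - hcup n G last0 \<in> cochains n"
    using hcup_cochains[OF Gs(1) last0_cochains] h1 by (auto intro: cochains_closed)
  ultimately obtain k where k: "k \<in> cochains n" "h1 - hcup n G last0 = k - pull s k"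
    using norm_zero_imp by blast
  define sg :: "'x list \<Rightarrow> int" where "sg = (-1) ^ n"
  have sg2: "sg * (sg * K) = K" and pull_sg: "pull s (sg * K) = sg * pull s K" for K
    by (simp_all only: sg_def sign_square_fun pull_sign)
  have "h - pull s h - sg * hcup n G (codiff last0) = codiff k - pull s (codiff k)"
    using arg_cong[OF k(2), of codiff] codiff_hcup[OF Gs(1) last0_cochains] Gs(3) h1(2)
    by (simp add: codiff_diff codiff_pull hcup_bilinear sg_def)
  then have hs: "pull s h = h - sg * hcup n G (codiff last0) - codiff k + pull s (codiff k)"
    by (simp add: algebra_simps)
  define e where "e = h - sg * hcup n G carry - codiff k"
  have "pull s e = e"
    unfolding e_def pull_diff pull_sg pull_hcup pull_carry Gs(2) hcup_bilinear hs by (simp add: algebra_simps)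
  moreover have "e \<in> cochains (Suc n)"
    unfolding e_def sg_def using hcup_cochains[OF Gs(1) carry_cochains] h(1) codiff_cochains[OF k(1)]
    by (auto intro!: cochains_closed)
  ultimately have "e \<in> inv_cochains {s} (Suc n)" by (simp add: inv_cochains_singleton)
  moreover have "codiff e = F - hcup n G gen2"
  proof -
    have "codiff (sg * hcup n G carry) = sg * (sg * hcup n G gen2)"
      using codiff_scale[of "(-1) ^ n" "hcup n G carry"] codiff_hcup[OF Gs(1) carry_cochains] Gs(3)
      by (simp add: sg_def hcup_bilinear gen2_def)
    then show ?thesis by (simp add: e_def codiff_diff h sg2)
  qed
  ultimately have "F - hcup n G gen2 \<in> cobd {s} (n + 2)" by (auto simp: image_iff intro!: bexI[of _ e])
  then show ?thesis using G by blast
qed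

text \<open>
  Reverses the two dimension shifts of \<open>periodicity_surj\<close>. In positive degrees the closed cochain
  \<open>l\<close> is exact, so \<open>G\<close> bounds; in degree zero it is constant and \<open>G\<close> is a multiple of \<open>m\<close>.
\<close>
lemma periodicity_inj:
  assumes G: "G \<in> cocyc {s} n" and c: "hcup n G gen2 \<in> cobd {s} (n + 2)"
  shows "\<exists>l. codiff l = 0 \<and> l \<in> cochains n \<and> G = norm l"
proof -
  have Gs: "G \<in> cochains n" "pull s G = G" "codiff G = 0"
    using G by (auto simp: cocyc_def inv_cochains_singleton)
  obtain h where h: "h \<in> cochains (Suc n)" "pull s h = h" "hcup n G gen2 = codiff h"
    using c by (auto simp: inv_cochains_singleton)
  define sg :: "'x list \<Rightarrow> int" where "sg = (-1) ^ n"
  have sg2: "sg * (sg * K) = K" and pull_sg: "pull s (sg * K) = sg * pull s K" for K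
    by (simp_all only: sg_def sign_square_fun pull_sign)
  have "codiff (sg * hcup n G carry) = sg * (sg * hcup n G gen2)"
      using codiff_scale[of "(-1) ^ n" "hcup n G carry"] codiff_hcup[OF Gs(1) carry_cochains] Gs(3)
      by (simp add: sg_def hcup_bilinear gen2_def)
  then have "codiff (sg * hcup n G carry - h) = 0"
    by (simp add: codiff_diff h sg2)
  moreover have "sg * hcup n G carry - h \<in> cochains (Suc n)"
    unfolding sg_def using hcup_cochains[OF Gs(1) carry_cochains] h(1) by (auto intro!: cochains_closed)
  ultimately obtain k where k: "k \<in> cochains n" "codiff k = sg * hcup n G carry - h"
    using acyclic by blast
  define l where "l = hcup n G last0 - (k - pull s k)"
  have "codiff k - pull s (codiff k) = sg * hcup n G (codiff last0)"
    unfolding k pull_diff pull_sg pull_hcup pull_carry Gs(2) hcup_bilinear h(2) by (simp add: algebra_simps)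
  then have "codiff l = 0"
    using codiff_hcup[OF Gs(1) last0_cochains] Gs(3)
    by (simp add: l_def codiff_diff codiff_pull hcup_bilinear sg_def)
  moreover have "l \<in> cochains n"
    unfolding l_def using hcup_cochains[OF Gs(1) last0_cochains] k(1) by (auto intro!: cochains_closed pull_cochains)
  moreover have "norm l = G"
    by (simp add: l_def norm_diff norm_pull norm_hcup Gs norm_last0 hcup_hunit_right)
  ultimately show ?thesis by metis
qed

primrec gen :: "nat \<Rightarrow> 'x list \<Rightarrow> int" where
  "gen 0 = hunit"
| "gen (Suc i) = hcup (2 * i) (gen i) gen2"

lemma gen_cocyc_superset:
  assumes "gen2 \<in> cocyc S 2" shows "gen i \<in> cocyc S (2 * i)"
proof (induction i)
  case (Suc i) then show ?case using cocyc_hcup[OF Suc assms] by simp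
qed (simp add: cocyc_closed)

lemma gen_cocyc: "gen i \<in> cocyc {s} (2 * i)"
  by (rule gen_cocyc_superset[OF gen2_cocyc])

lemma gen_add: "hcup (2 * i) (gen i) (gen j) = gen (i + j)"
proof (induction j)
  case 0 then show ?case using cocyc_cochains[OF gen_cocyc] by (simp add: hcup_hunit_right)
next
  case (Suc j)
  then show ?case using hcup_assoc[of "2 * i" "2 * j" "gen i" "gen j" gen2] by (simp add: algebra_simps)
qed

lemma cocyc_0: "F \<in> cocyc S 0 \<Longrightarrow> \<exists>k. F = of_int k * hunit"
  by (rule acyclic_0) (auto simp: cocyc_def inv_cochains_def)

lemma even_cocyc:
  assumes "F \<in> cocyc {s} (2 * i)" shows "\<exists>k. F - of_int k * gen i \<in> cobd {s} (2 * i)"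
  using assms
proof (induction i arbitrary: F)
  case 0
  then obtain k where "F = of_int k * hunit" using cocyc_0 by auto
  then show ?case by (intro exI[of _ k]) simp
next
  case (Suc i)
  then obtain G where G: "G \<in> cocyc {s} (2 * i)" "F - hcup (2 * i) G gen2 \<in> cobd {s} (2 * Suc i)"
    using periodicity_surj[of F "2 * i"] by auto
  obtain k where k: "G - of_int k * gen i \<in> cobd {s} (2 * i)" using Suc.IH G(1) by blast
  have "hcup (2 * i) (G - of_int k * gen i) gen2 \<in> cobd {s} (2 * Suc i)"
    using cobd_hcup_cocyc[OF k gen2_cocyc] by simp
  then have "hcup (2 * i) G gen2 - of_int k * gen (Suc i) \<in> cobd {s} (2 * Suc i)"
    by (simp add: hcup_bilinear)
  then show ?case using cobd_trans[OF G(2)] by blast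
qed

text \<open>
  Periodicity leaves degree one. There \<open>F = d h\<close> with \<open>h - s h\<close> constant, and that constant has
  norm zero, hence is zero.
\<close>
lemma odd_cocyc:
  assumes "F \<in> cocyc {s} (2 * i + 1)" shows "F \<in> cobd {s} (2 * i + 1)"
  using assms
proof (induction i arbitrary: F)
  case 0
  then have F: "F \<in> cochains (Suc 0)" "codiff F = 0" "pull s F = F" by (auto simp: cocyc_def inv_cochains_singleton)
  then obtain h where h: "h \<in> cochains 0" "codiff h = F" using acyclic by blast
  have "codiff (h - pull s h) = 0" "h - pull s h \<in> cochains 0"
    using F h by (auto simp: codiff_diff codiff_pull intro: cochains_closed pull_cochains)
  then obtain k where k: "h - pull s h = of_int k * hunit" using acyclic_0 by blast
  have "of_int (int m) * (of_int k * hunit) = norm (of_int k * hunit)"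
    by (rule norm_fixed[symmetric]) (simp add: pull_scale)
  also have "\<dots> = 0" by (simp add: k[symmetric] norm_diff norm_pull)
  finally have "of_int (int m) * (of_int k * (hunit :: 'x list \<Rightarrow> int)) = 0" .
  from fun_cong[OF this, of "[undefined]"] have "int m * k = 0" by (simp add: hunit_def)
  then have "pull s h = h" using k m_pos by (simp add: of_int_0)
  then show ?case using h by (auto simp: inv_cochains_singleton)
next
  case (Suc i)
  then obtain G where G: "G \<in> cocyc {s} (2 * i + 1)" "F - hcup (2 * i + 1) G gen2 \<in> cobd {s} (2 * Suc i + 1)"
    using periodicity_surj[of F "2 * i + 1"] by auto
  have "hcup (2 * i + 1) G gen2 \<in> cobd {s} (2 * Suc i + 1)"
    using cobd_hcup_cocyc[OF Suc.IH[OF G(1)] gen2_cocyc] by simp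
  then have "(F - hcup (2 * i + 1) G gen2) + hcup (2 * i + 1) G gen2 \<in> cobd {s} (2 * Suc i + 1)"
    by (rule cobd_closed(2)[OF G(2)])
  then show ?case by (simp only: diff_add_cancel)
qed

lemma gen_order_dvd:
  assumes "i > 0" "of_int k * gen i \<in> cobd {s} (2 * i)" shows "int m dvd k"
  using assms
proof (induction i)
  case (Suc i)
  have "of_int k * gen i \<in> cocyc {s} (2 * i)" by (intro cocyc_closed gen_cocyc)
  moreover have "of_int k * gen (Suc i) \<in> cobd {s} (2 * Suc i)" by (rule Suc.prems(2))
  then have "hcup (2 * i) (of_int k * gen i) gen2 \<in> cobd {s} (2 * i + 2)"
    by (simp only: hcup_bilinear gen.simps) simp
  ultimately obtain l where l: "codiff l = 0" "l \<in> cochains (2 * i)" "of_int k * gen i = norm l"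
    using periodicity_inj by blast
  show ?case
  proof (cases i)
    case 0
    then obtain c where c: "l = of_int c * hunit" using l acyclic_0 by auto
    have "norm l = of_int (int m) * l" by (rule norm_fixed) (simp add: c pull_scale)
    then have "of_int k * hunit = of_int (int m) * (of_int c * (hunit :: 'x list \<Rightarrow> int))" using l 0 c by simp
    from fun_cong[OF this, of "[undefined]"] show ?thesis by (simp add: hunit_def)
  next
    case (Suc j)
    then obtain l' where "l' \<in> cochains (Suc (2 * j))" "codiff l' = l" using l acyclic[of l "Suc (2 * j)"] by auto
    then have "of_int k * gen i \<in> cobd {s} (2 * i)"
      using l(3) Suc norm_codiff[of l'] norm_inv by (auto simp: image_iff)
    then show ?thesis by (rule Suc.IH[rotated]) (simp add: Suc)
  qed
qed simp

lemma m_gen_cobd: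
  assumes "of_int (int m) * gen2 \<in> cobd S 2" "gen2 \<in> cocyc S 2" "i > 0"
  shows "of_int (int m) * gen i \<in> cobd S (2 * i)"
proof (cases i)
  case (Suc j)
  have "hcup (2 * j) (gen j) (of_int (int m) * gen2) \<in> cobd S (2 * j + 2)"
    by (intro cocyc_hcup_cobd gen_cocyc_superset assms)
  then show ?thesis by (simp only: Suc gen.simps hcup_bilinear) simp
qed (use assms in simp)

lemma gen_order:
  assumes "i > 0" shows "of_int k * gen i \<in> cobd {s} (2 * i) \<longleftrightarrow> int m dvd k"
proof
  assume "int m dvd k"
  then obtain c where "k = c * int m" by (metis dvd_def mult.commute)
  then have "of_int k * gen i = of_int c * (of_int (int m) * gen i)" by (simp add: mult.assoc)
  moreover have "of_int c * (of_int (int m) * gen i) \<in> cobd {s} (2 * i)"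
    by (rule cobd_closed(4)[OF m_gen_cobd[OF m_gen2_cobd gen2_cocyc assms]])
  ultimately show "of_int k * gen i \<in> cobd {s} (2 * i)" by (simp only:)
qed (rule gen_order_dvd[OF assms])

text \<open>
  A substitution that multiplies the coordinate by \<open>c\<close> modulo \<open>m\<close>, up to an invariant function,
  multiplies \<open>step\<close> by \<open>c\<close> modulo \<open>m\<close> and an invariant coboundary. Dividing the error by \<open>m\<close> gives
  an invariant cochain \<open>z\<close> whose coboundary is \<open>c\<close> times \<open>gen2\<close> minus the translate of \<open>gen2\<close>. The
  set \<open>S\<close> is allowed to be larger than \<open>{s}\<close>, since for \<open>\<int>\<^sub>b\<close> invariance under all of \<open>N\<close> is
  wanted.
\<close>
lemma pull_gen2:
  assumes crd_g: "\<And>x. [crd (g x) = c * crd x + \<gamma> x] (mod int m)"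
    and \<gamma>: "\<And>g' x. g' \<in> S \<Longrightarrow> \<gamma> (g' x) = \<gamma> x"
    and S: "step \<in> inv_cochains S 1" "pull g step \<in> inv_cochains S 1"
  shows "pull g gen2 - of_int c * gen2 \<in> cobd S 2"
proof -
  define \<gamma>0 :: "'x list \<Rightarrow> int" where "\<gamma>0 xs = (if length xs = 1 then \<gamma> (hd xs) else 0)" for xs
  define \<kappa>0 :: "'x list \<Rightarrow> int" where "\<kappa>0 xs = (if length xs = 1 then (crd (g (hd xs)) - c * crd (hd xs) - \<gamma> (hd xs)) div int m else 0)" for xs
  have dv: "int m dvd crd (g x) - c * crd x - \<gamma> x" for x
    using crd_g[of x] by (simp add: cong_iff_dvd_diff algebra_simps)
  have crd0: "pull g crd0 = of_int c * crd0 + \<gamma>0 + of_int (int m) * \<kappa>0"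
  proof
    fix xs :: "'x list"
    show "pull g crd0 xs = (of_int c * crd0 + \<gamma>0 + of_int (int m) * \<kappa>0) xs"
      using dv by (cases xs) (auto simp: pull_def crd0_def \<gamma>0_def \<kappa>0_def)
  qed
  have \<gamma>0: "\<gamma>0 \<in> inv_cochains S 0"
    using \<gamma> by (auto simp: inv_cochains_def cochains_def \<gamma>0_def pull_def fun_eq_iff length_Suc_conv)
  have \<kappa>0: "\<kappa>0 \<in> cochains 0" by (simp add: cochains_def \<kappa>0_def)
  define z where "z = codiff \<kappa>0 - pull g carry + of_int c * carry"
  have "of_int (int m) * z = pull g step - of_int c * step - codiff \<gamma>0"
    unfolding z_def step_def pull_diff pull_scale codiff_pull[symmetric] crd0 codiff_add codiff_scale
    by (simp add: algebra_simps)
  moreover have "pull g step - of_int c * step - codiff \<gamma>0 \<in> inv_cochains S 1"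
    using inv_cochains_codiff[OF \<gamma>0] by (intro inv_cochains_closed S) simp
  ultimately have mz: "of_int (int m) * z \<in> inv_cochains S 1" by simp
  have "pull g' z = z" if "g' \<in> S" for g'
  proof
    fix xs
    have "pull g' (of_int (int m) * z) xs = (of_int (int m) * z) xs"
      using mz that by (simp add: inv_cochains_def)
    then show "pull g' z xs = z xs" using m_pos by (simp add: pull_def)
  qed
  moreover have "z \<in> cochains 1"
    unfolding z_def using codiff_cochains[OF \<kappa>0] carry_cochains by (auto intro!: cochains_closed pull_cochains)
  ultimately have "z \<in> inv_cochains S 1" by (simp add: inv_cochains_def)
  moreover have "codiff (- z) = pull g gen2 - of_int c * gen2"
    by (simp add: codiff_uminus z_def codiff_add codiff_diff codiff_pull codiff_scale gen2_def)
  moreover have "- z \<in> inv_cochains S 1" if "z \<in> inv_cochains S 1"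
    using inv_cochains_closed(4)[OF that, of "-1"] by simp
  ultimately have "pull g gen2 - of_int c * gen2 \<in> codiff ` inv_cochains S 1"
    using image_eqI[of _ codiff "- z" "inv_cochains S 1"] by simp
  then show ?thesis by (simp add: numeral_2_eq_2)
qed

lemma pull_gen:
  assumes "gen2 \<in> cocyc S 2" "pull g gen2 - of_int c * gen2 \<in> cobd S 2"
  shows "pull g (gen i) - of_int (c ^ i) * gen i \<in> cobd S (2 * i)"
proof (induction i)
  case (Suc i)
  have IH: "pull g (gen i) - of_int (c ^ i) * gen i \<in> cobd S (2 * i)" by (rule Suc)
  have "hcup (2 * i) (pull g (gen i)) (pull g gen2) - hcup (2 * i) (of_int (c ^ i) * gen i) (of_int c * gen2) \<in> cobd S (2 * i + 2)"
    by (rule hcup_cong_cobd[OF _ IH _ assms(2)]) (intro cocyc_closed gen_cocyc_superset assms)+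
  then have "pull g (gen (Suc i)) - of_int c * (of_int (c ^ i) * gen (Suc i)) \<in> cobd S (2 * Suc i)"
    by (simp only: pull_hcup hcup_bilinear gen.simps) simp
  moreover have "of_int c * (of_int (c ^ i) * gen (Suc i)) = of_int (c ^ Suc i) * gen (Suc i)"
    by (simp add: mult_ac)
  ultimately show ?case by (simp only:)
qed (simp add: cobd_closed)

end

section \<open>Split metacyclic groups extended by an infinite cyclic group\<close>

lemma funpow_comp_shift:
  assumes "y \<circ> s = (s ^^ n) \<circ> y" shows "y \<circ> (s ^^ k) = (s ^^ (n * k)) \<circ> y"
proof (induction k)
  case (Suc k)
  have "y \<circ> (s ^^ Suc k) = (y \<circ> s) \<circ> (s ^^ k)" by (simp add: comp_assoc)
  also have "\<dots> = (s ^^ n) \<circ> (y \<circ> (s ^^ k))" by (simp add: assms comp_assoc)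
  also have "\<dots> = (s ^^ (n * Suc k)) \<circ> y" by (simp only: Suc mult_Suc_right funpow_add comp_assoc)
  finally show ?case .
qed simp

text \<open>
  The left translations \<open>s\<close>, \<open>y\<close> and \<open>t\<close> by the generators of \<open>\<int>\<^sub>a\<close>, \<open>\<int>\<^sub>b\<close> and \<open>\<int>\<close>. The
  coordinates of a group element are \<open>\<alpha>\<close>, \<open>\<beta>\<close> and \<open>\<tau>\<close>, and \<open>\<gamma>\<close> is what translation by \<open>t\<close> adds to
  the first one on account of the second one. The commutation rules say that \<open>s\<close> generates a
  subgroup normalized by \<open>y\<close> and \<open>t\<close>, and that \<open>t\<close> normalizes \<open>N\<close> from both sides.
\<close>
locale metacyclic_by_Z =
  A: cyclic_action s a \<alpha> + B: cyclic_action y b \<beta>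
  for s y :: "'x \<Rightarrow> 'x" and a b :: nat and \<alpha> \<beta> :: "'x \<Rightarrow> int" +
  fixes t :: "'x \<Rightarrow> 'x" and \<tau> \<gamma> :: "'x \<Rightarrow> int" and r ca cb :: int and rn :: nat
  assumes coprime_ab: "coprime a b"
    and \<beta>_s: "\<beta> (s x) = \<beta> x" and \<tau>_s: "\<tau> (s x) = \<tau> x" and \<tau>_y: "\<tau> (y x) = \<tau> x"
    and \<tau>_t: "\<tau> (t x) = \<tau> x + 1"
    and bij_t: "bij t"
    and y_s: "y \<circ> s = (s ^^ rn) \<circ> y" and rn: "coprime rn a"
    and \<alpha>_y: "[\<alpha> (y x) = r * \<alpha> x] (mod int a)"
    and t_s: "\<exists>i. t \<circ> s = (s ^^ i) \<circ> t"
    and t_y: "\<exists>i j. t \<circ> y = (s ^^ i) \<circ> (y ^^ j) \<circ> t"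
    and s_t: "\<exists>i j. s \<circ> t = t \<circ> ((s ^^ i) \<circ> (y ^^ j))"
    and y_t: "\<exists>i j. y \<circ> t = t \<circ> ((s ^^ i) \<circ> (y ^^ j))"
    and \<alpha>_t: "[\<alpha> (t x) = ca * \<alpha> x + \<gamma> x] (mod int a)"
    and \<gamma>_s: "\<gamma> (s x) = \<gamma> x"
    and \<beta>_t: "[\<beta> (t x) = cb * \<beta> x] (mod int b)"
begin

abbreviation "N \<equiv> {s, y}"
abbreviation "T \<equiv> {s, y, t}"

subsection \<open>Substitutions preserving invariance\<close>

lemma inv_N_iff: "F \<in> inv_cochains N n \<longleftrightarrow> F \<in> cochains n \<and> pull s F = F \<and> pull y F = F"
  and inv_T_iff: "F \<in> inv_cochains T n \<longleftrightarrow> F \<in> inv_cochains N n \<and> pull t F = F"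
  by (auto simp: inv_cochains_def)

lemma pull_y_inv_s: "F \<in> inv_cochains {s} n \<Longrightarrow> pull y F \<in> inv_cochains {s} n"
  by (simp add: inv_cochains_singleton pull_cochains pull_comp y_s)
     (simp add: pull_comp[symmetric] pull_funpow_fixed)

lemma pull_t_inv_s: "F \<in> inv_cochains {s} n \<Longrightarrow> pull t F \<in> inv_cochains {s} n"
  using t_s by (auto simp: inv_cochains_singleton pull_cochains pull_comp)
     (simp add: pull_comp[symmetric] pull_funpow_fixed)

lemma pull_word: "F \<in> inv_cochains N n \<Longrightarrow> pull ((s ^^ i) \<circ> (y ^^ j)) F = F"
  by (simp add: inv_N_iff pull_comp[symmetric] pull_funpow_fixed)

lemma pull_t_inv_N: 
  assumes "F \<in> inv_cochains N n" shows "pull t F \<in> inv_cochains N n"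
proof -
  have "pull s (pull t F) = pull t F"
    using pull_t_inv_s[OF inv_cochains_mono[OF assms]] by (simp add: inv_cochains_singleton)
  moreover obtain i j where "t \<circ> y = (s ^^ i) \<circ> (y ^^ j) \<circ> t" using t_y by blast
  then have "pull y (pull t F) = pull t (pull ((s ^^ i) \<circ> (y ^^ j)) F)" by (simp add: pull_comp)
  ultimately show ?thesis using assms by (simp add: pull_word[OF assms] inv_N_iff pull_cochains)
qed

text \<open>
  Needed to solve \<open>k - t k = F\<close> within the cochains invariant under \<open>N\<close>: for points with \<open>\<tau> > 0\<close>
  the solution sums over backward translates.
\<close>
lemma pull_t_inverse_inv_N:
  assumes "F \<in> inv_cochains N n" shows "pull (inv_into UNIV t) F \<in> inv_cochains N n"
proof -
  have *: "pull g (pull (inv_into UNIV t) F) = pull (inv_into UNIV t) F" if "g \<circ> t = t \<circ> w" "pull w F = F" for g w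
  proof -
    have 1: "(inv_into UNIV t) \<circ> t = id" "t \<circ> (inv_into UNIV t) = id"
      using inv_o_cancel[OF bij_is_inj[OF bij_t]] bij_is_surj[OF bij_t] surj_iff by auto
    have "(inv_into UNIV t) \<circ> g = (inv_into UNIV t) \<circ> g \<circ> (t \<circ> (inv_into UNIV t))" by (simp add: 1)
    also have "\<dots> = (inv_into UNIV t) \<circ> (g \<circ> t) \<circ> (inv_into UNIV t)" by (simp add: comp_assoc)
    also have "\<dots> = ((inv_into UNIV t) \<circ> t) \<circ> w \<circ> (inv_into UNIV t)" by (simp add: that comp_assoc)
    finally have "(inv_into UNIV t) \<circ> g = w \<circ> (inv_into UNIV t)" by (simp add: 1)
    then show ?thesis by (simp add: pull_comp) (simp add: pull_comp[symmetric] that)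
  qed
  obtain i j i' j' where "s \<circ> t = t \<circ> ((s ^^ i) \<circ> (y ^^ j))" "y \<circ> t = t \<circ> ((s ^^ i') \<circ> (y ^^ j'))"
    using s_t y_t by blast
  then show ?thesis using *[OF _ pull_word[OF assms]] assms by (simp add: inv_N_iff pull_cochains)
qed

lemma pull_t_cobd_s: "F \<in> cobd {s} n \<Longrightarrow> pull t F \<in> cobd {s} n"
  and pull_y_cobd_s: "F \<in> cobd {s} n \<Longrightarrow> pull y F \<in> cobd {s} n"
  and pull_t_cobd_N: "F \<in> cobd N n \<Longrightarrow> pull t F \<in> cobd N n"
  by (cases n; auto simp: codiff_pull[symmetric] intro!: imageI pull_t_inv_s pull_y_inv_s pull_t_inv_N)+

lemma pull_t_cocyc_N: "F \<in> cocyc N n \<Longrightarrow> pull t F \<in> cocyc N n"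
  by (simp add: cocyc_def pull_t_inv_N codiff_pull)

subsection \<open>Transfer\<close>

lemma transfer_y: assumes "h \<in> inv_cochains {s} n" shows "B.norm h \<in> inv_cochains N n"
proof -
  have "pull (y ^^ j) h \<in> inv_cochains {s} n" for j
  proof (induction j)
    case (Suc j)
    have "pull (y ^^ Suc j) h = pull y (pull (y ^^ j) h)" by (simp only: pull_comp funpow.simps funpow_swap1 o_def)
    then show ?case using pull_y_inv_s[OF Suc] by (simp only:)
  qed (use assms in simp)
  then have "pull s (B.norm h) = B.norm h"
    by (simp add: B.norm_def pull_sum inv_cochains_singleton)
  then show ?thesis using assms B.norm_cochains B.pull_s_norm by (simp add: inv_N_iff inv_cochains_singleton)
qed

text \<open>
  The transfer from \<open>\<int>\<^sub>b\<close> to \<open>N\<close>. Translation by \<open>y\<close> permutes the summands because conjugation by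
  \<open>y\<close> raises \<open>s\<close> to a power prime to its order.
\<close>
lemma transfer_s: assumes "h \<in> inv_cochains {y} n" shows "A.norm h \<in> inv_cochains N n"
proof -
  have h: "pull y h = h" "h \<in> cochains n" using assms by (auto simp: inv_cochains_singleton)
  have bij: "bij_betw (\<lambda>k. rn * k mod a) {..<a} {..<a}"
  proof -
    have "inj_on (\<lambda>k. rn * k mod a) {..<a}"
    proof (rule inj_onI)
      fix k l assume kl: "k \<in> {..<a}" "l \<in> {..<a}" "rn * k mod a = rn * l mod a"
      then have "[k = l] (mod a)" using cong_mult_lcancel_nat[OF rn] by (simp add: cong_def)
      then show "k = l" using kl by (simp add: cong_def)
    qed
    moreover have "(\<lambda>k. rn * k mod a) ` {..<a} \<subseteq> {..<a}" using A.m_pos by auto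
    ultimately show ?thesis by (simp add: bij_betw_def endo_inj_surj)
  qed
  have step: "pull y (pull (s ^^ (rn * k mod a)) h) = pull (s ^^ k) h" for k
  proof -
    have "s ^^ (rn * k mod a) = s ^^ (rn * k)"
      using funpow_mod_eq[where f = s and n = a] A.s_order by (auto simp: fun_eq_iff)
    then have "pull y (pull (s ^^ (rn * k mod a)) h) = pull (y \<circ> (s ^^ k)) h"
      by (simp add: pull_comp funpow_comp_shift[OF y_s])
    then show ?thesis by (simp add: pull_comp[symmetric] h)
  qed
  have "pull y (A.norm h) = (\<Sum>k<a. pull y (pull (s ^^ (rn * k mod a)) h))"
    unfolding A.norm_def pull_sum by (rule sum.reindex_bij_betw[OF bij, symmetric])
  then have "pull y (A.norm h) = A.norm h" by (simp add: step A.norm_def)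
  then show ?thesis using h A.norm_cochains A.pull_s_norm by (simp add: inv_N_iff)
qed

text \<open>
  On an invariant cochain the transfer is multiplication by the index.
\<close>
lemma restrict_s_zero:
  assumes "F \<in> inv_cochains N n" "F \<in> cobd {s} n" shows "of_int (int b) * F \<in> cobd N n"
proof (cases n)
  case (Suc m)
  obtain h where h: "h \<in> inv_cochains {s} m" "F = codiff h" using assms Suc by auto
  have "of_int (int b) * F = codiff (B.norm h)"
    using B.norm_fixed[of F] assms by (simp add: inv_N_iff B.norm_codiff h)
  then show ?thesis using transfer_y[OF h(1)] Suc by (simp only: cobd.simps) (rule imageI)
qed (use assms in \<open>auto simp: cobd_closed\<close>)

lemma restrict_y_zero:
  assumes "F \<in> inv_cochains N n" "F \<in> cobd {y} n" shows "of_int (int a) * F \<in> cobd N n"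
proof (cases n)
  case (Suc m)
  obtain h where h: "h \<in> inv_cochains {y} m" "F = codiff h" using assms Suc by auto
  have "of_int (int a) * F = codiff (A.norm h)"
    using A.norm_fixed[of F] assms by (simp add: inv_N_iff A.norm_codiff h)
  then show ?thesis using transfer_s[OF h(1)] Suc by (simp only: cobd.simps) (rule imageI)
qed (use assms in \<open>auto simp: cobd_closed\<close>)

text \<open>
  Both indices \<open>a\<close> and \<open>b\<close> kill the class, and they are coprime.
\<close>
lemma cobd_N_if:
  assumes "F \<in> inv_cochains N n" "F \<in> cobd {s} n" "F \<in> cobd {y} n" shows "F \<in> cobd N n"
proof -
  obtain u v where uv: "u * int a + v * int b = 1"
    using coprime_ab bezout_int[of "int a" "int b"] by auto
  have "F = of_int (u * int a + v * int b) * F" by (simp add: uv)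
  also have "\<dots> = of_int u * (of_int (int a) * F) + of_int v * (of_int (int b) * F)"
    by (simp add: algebra_simps)
  finally show ?thesis
    using restrict_s_zero[OF assms(1,2)] restrict_y_zero[OF assms(1,3)] by (metis cobd_closed(2,4))
qed

lemma odd_cocyc_N: "F \<in> cocyc N (2 * i + 1) \<Longrightarrow> F \<in> cobd N (2 * i + 1)"
  by (intro cobd_N_if A.odd_cocyc B.odd_cocyc) (auto intro: cocyc_inv cocyc_mono)

subsection \<open>The generators under substitution\<close>

lemma B_crd0_s: "pull s B.crd0 = B.crd0"
  by (auto simp: pull_def B.crd0_def fun_eq_iff length_Suc_conv \<beta>_s)

lemma B_carry_s: "pull s B.carry = B.carry"
proof
  fix xs
  have "pull s B.carry xs = codiff (pull s B.crd0) xs div int b"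
    by (simp add: codiff_pull) (simp add: pull_def B.carry_def)
  then show "pull s B.carry xs = B.carry xs" by (simp add: B_crd0_s B.carry_def)
qed

lemma B_step_N: "B.step \<in> inv_cochains N 1"
proof -
  have "pull s B.step = B.step"
    unfolding B.step_def pull_diff codiff_pull[symmetric] pull_scale B_carry_s B_crd0_s ..
  then show ?thesis by (simp add: inv_N_iff B.step_cochains[simplified] B.pull_step)
qed

text \<open>
  The coordinate \<open>\<beta>\<close> factors through the quotient \<open>\<int>\<^sub>b\<close> of \<open>N\<close>, so the generator for \<open>\<int>\<^sub>b\<close> is
  inflated to \<open>N\<close> without further work.
\<close>
lemma B_gen2_N: "B.gen2 \<in> cocyc N 2"
proof -
  have "pull s B.gen2 = B.gen2" unfolding B.gen2_def codiff_pull[symmetric] B_carry_s ..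
  then show ?thesis using B.gen2_cocyc by (auto simp: cocyc_def inv_cochains_def)
qed

lemma B_gen_N: "B.gen i \<in> cocyc N (2 * i)"
  by (rule B.gen_cocyc_superset[OF B_gen2_N])

lemma b_B_gen_N: "i > 0 \<Longrightarrow> of_int (int b) * B.gen i \<in> cobd N (2 * i)"
proof (rule B.m_gen_cobd[OF _ B_gen2_N])
  have "codiff B.step \<in> cobd N (Suc 1)"
    unfolding cobd.simps by (rule imageI) (rule B_step_N)
  from cobd_uminus[OF this] show "of_int (int b) * B.gen2 \<in> cobd N 2"
    by (simp add: B.codiff_step numeral_2_eq_2 del: cobd.simps)
qed

lemma pull_t_B_gen: "pull t (B.gen i) - of_int (cb ^ i) * B.gen i \<in> cobd N (2 * i)"
proof (rule B.pull_gen[OF B_gen2_N])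
  show "pull t B.gen2 - of_int cb * B.gen2 \<in> cobd N 2"
    by (rule B.pull_gen2[where \<gamma> = "\<lambda>_. 0"]) (use \<beta>_t B_step_N pull_t_inv_N in auto)
qed

lemma A_step_s: "A.step \<in> inv_cochains {s} 1"
  using A.step_cochains A.pull_step by (simp add: inv_cochains_singleton)

lemma pull_y_A_gen: "pull y (A.gen i) - of_int (r ^ i) * A.gen i \<in> cobd {s} (2 * i)"
proof (rule A.pull_gen[OF A.gen2_cocyc])
  show "pull y A.gen2 - of_int r * A.gen2 \<in> cobd {s} 2"
    by (rule A.pull_gen2[where \<gamma> = "\<lambda>_. 0"]) (use \<alpha>_y A_step_s pull_y_inv_s in auto)
qed

lemma pull_t_A_gen: "pull t (A.gen i) - of_int (ca ^ i) * A.gen i \<in> cobd {s} (2 * i)"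
proof (rule A.pull_gen[OF A.gen2_cocyc])
  show "pull t A.gen2 - of_int ca * A.gen2 \<in> cobd {s} 2"
    by (rule A.pull_gen2[where \<gamma> = \<gamma>]) (use \<alpha>_t \<gamma>_s A_step_s pull_t_inv_s in auto)
qed

end

context metacyclic_by_Z
begin

subsection \<open>Coordinates of even classes\<close>

text \<open>
  The restrictions of \<open>F\<close> to \<open>\<int>\<^sub>a\<close> and \<open>\<int>\<^sub>b\<close> are \<open>u\<close> and \<open>v\<close> times the standard generators. In
  positive degrees \<open>u\<close> and \<open>v\<close> are determined modulo \<open>a\<close> and \<open>b\<close>. A relation is more convenient
  than a function to \<open>\<int>/a \<times> \<int>/b\<close>, as integer coordinates can be multiplied and divided freely.
\<close>
definition coords :: "nat \<Rightarrow> ('x list \<Rightarrow> int) \<Rightarrow> int \<Rightarrow> int \<Rightarrow> bool"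
  where "coords i F u v \<longleftrightarrow>
    F - of_int u * A.gen i \<in> cobd {s} (2 * i) \<and> F - of_int v * B.gen i \<in> cobd {y} (2 * i)"

lemma coords_exist: "F \<in> cocyc N (2 * i) \<Longrightarrow> \<exists>u v. coords i F u v"
  unfolding coords_def using A.even_cocyc[of F i] B.even_cocyc[of F i] cocyc_mono[of F N "2 * i"] by auto

lemma coords_lin:
  assumes "coords i F u v" "coords i F' u' v'"
  shows "coords i (of_int k * F + of_int l * F') (k * u + l * u') (k * v + l * v')"
proof -
  have "of_int k * F + of_int l * F' - of_int (k * u + l * u') * g
      = of_int k * (F - of_int u * g) + of_int l * (F' - of_int u' * g)" for u u' and g :: "'x list \<Rightarrow> int"
    by (simp add: algebra_simps)
  then show ?thesis using assms by (simp only: coords_def) (auto intro!: cobd_closed)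
qed

lemma coords_add: "coords i F u v \<Longrightarrow> coords i F' u' v' \<Longrightarrow> coords i (F + F') (u + u') (v + v')"
  using coords_lin[of i F u v F' u' v' 1 1] by simp

lemma coords_diff: "coords i F u v \<Longrightarrow> coords i F' u' v' \<Longrightarrow> coords i (F - F') (u - u') (v - v')"
  using coords_lin[of i F u v F' u' v' 1 "-1"] by simp

lemma coords_cong:
  assumes "coords i F u v" "i > 0" "int a dvd u - u'" "int b dvd v - v'"
  shows "coords i F u' v'"
proof -
  have 1: "F - of_int u' * g = (F - of_int u * g) + of_int (u - u') * g" for u u' and g :: "'x list \<Rightarrow> int"
    by (simp add: algebra_simps)
  have "of_int (u - u') * A.gen i \<in> cobd {s} (2 * i)" "of_int (v - v') * B.gen i \<in> cobd {y} (2 * i)"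
    using assms A.gen_order B.gen_order by blast+
  then show ?thesis using assms(1) unfolding coords_def
    using 1[of u' "A.gen i" u] 1[of v' "B.gen i" v] by (metis cobd_closed(2))
qed

lemma coords_unique:
  assumes "coords i F u v" "coords i F' u' v'" "F - F' \<in> cobd N (2 * i)" "i > 0"
  shows "int a dvd u - u'" "int b dvd v - v'"
proof -
  have 1: "of_int (u - u') * g = (F - F') - ((F - of_int u * g) - (F' - of_int u' * g))" for u u' and g :: "'x list \<Rightarrow> int"
    by (simp add: algebra_simps)
  have "of_int (u - u') * A.gen i \<in> cobd {s} (2 * i)"
    unfolding 1 by (rule cobd_closed(3)[OF cobd_mono[OF assms(3)] cobd_closed(3)])
      (use assms in \<open>auto simp: coords_def\<close>)
  then show "int a dvd u - u'" using A.gen_order assms by blast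
  have "of_int (v - v') * B.gen i \<in> cobd {y} (2 * i)"
    unfolding 1 by (rule cobd_closed(3)[OF cobd_mono[OF assms(3)] cobd_closed(3)])
      (use assms in \<open>auto simp: coords_def\<close>)
  then show "int b dvd v - v'" using B.gen_order assms by blast
qed

lemma cobd_N_iff_coords:
  assumes "F \<in> cocyc N (2 * i)" "coords i F u v" "i > 0"
  shows "F \<in> cobd N (2 * i) \<longleftrightarrow> int a dvd u \<and> int b dvd v"
proof
  have 0: "coords i 0 0 0" by (simp add: coords_def cobd_closed)
  assume "F \<in> cobd N (2 * i)"
  then have "F - 0 \<in> cobd N (2 * i)" by simp
  from coords_unique[OF assms(2) 0 this assms(3)] show "int a dvd u \<and> int b dvd v" by simp
next
  assume "int a dvd u \<and> int b dvd v"
  then have "coords i F 0 0" using coords_cong[OF assms(2,3)] by simp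
  then show "F \<in> cobd N (2 * i)" using assms(1) by (intro cobd_N_if) (auto simp: coords_def cocyc_inv)
qed

lemma coords_cobd: "F' - F \<in> cobd N (2 * i) \<Longrightarrow> coords i F u v \<Longrightarrow> coords i F' u v"
  unfolding coords_def by (blast intro: cobd_trans cobd_mono)

lemma coords_hcup:
  assumes "coords i F u v" "coords j F' u' v'"
  shows "coords (i + j) (hcup (2 * i) F F') (u * u') (v * v')"
proof -
  have "hcup (2 * i) F F' - hcup (2 * i) (of_int u * A.gen i) (of_int u' * A.gen j) \<in> cobd {s} (2 * i + 2 * j)"
    by (intro hcup_cong_cobd cocyc_closed A.gen_cocyc) (use assms in \<open>auto simp: coords_def\<close>)
  moreover have "hcup (2 * i) F F' - hcup (2 * i) (of_int v * B.gen i) (of_int v' * B.gen j) \<in> cobd {y} (2 * i + 2 * j)"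
    by (intro hcup_cong_cobd cocyc_closed B.gen_cocyc) (use assms in \<open>auto simp: coords_def\<close>)
  ultimately show ?thesis
    by (simp only: hcup_bilinear A.gen_add B.gen_add) (simp only: coords_def of_int_mult mult_ac distrib_left distrib_right)
qed

text \<open>
  For the first coordinate, translation by \<open>t\<close> acts on \<open>\<int>\<^sub>a\<close> cohomology. It does not act on \<open>\<int>\<^sub>b\<close>
  cohomology, because \<open>\<int>\<^sub>b\<close> is not normalized by \<open>t\<close>. Therefore the second coordinate is first
  multiplied by \<open>a\<close>: then the relation with the generator holds already over \<open>N\<close>, where \<open>t\<close> does
  act, and \<open>a\<close> can be cancelled modulo \<open>b\<close>.
\<close>
lemma coords_pull_t:
  assumes F: "F \<in> cocyc N (2 * i)" and c: "coords i F u v" and i: "i > 0"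
  shows "coords i (pull t F) (ca ^ i * u) (cb ^ i * v)"
proof -
  have split: "pull t F - of_int (k * w) * g = pull t (F - of_int w * g) + of_int w * (pull t g - of_int k * g)"
    for w k and g :: "'x list \<Rightarrow> int"
    unfolding pull_diff pull_scale by (simp add: algebra_simps)
  have s: "pull t F - of_int (ca ^ i * u) * A.gen i \<in> cobd {s} (2 * i)"
    unfolding split by (rule cobd_closed(2)[OF pull_t_cobd_s cobd_closed(4)[OF pull_t_A_gen]])
      (use c in \<open>simp add: coords_def\<close>)
  obtain u' w where w: "coords i (pull t F) u' w" using coords_exist[OF pull_t_cocyc_N[OF F]] by blast
  \<comment> \<open>The factor \<open>a\<close> is the index of \<open>\<int>\<^sub>b\<close> in \<open>N\<close>: it turns a relation over \<open>\<int>\<^sub>b\<close> into one over \<open>N\<close>.\<close>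
  have "of_int (int a) * (F - of_int v * B.gen i) \<in> cobd N (2 * i)"
    by (intro restrict_y_zero cocyc_inv cocyc_closed F B_gen_N) (use c in \<open>simp add: coords_def\<close>)
  then have "pull t (of_int (int a) * (F - of_int v * B.gen i))
      + of_int (int a) * (of_int v * (pull t (B.gen i) - of_int (cb ^ i) * B.gen i)) \<in> cobd N (2 * i)"
    by (rule cobd_closed(2)[OF pull_t_cobd_N cobd_closed(4)[OF cobd_closed(4)[OF pull_t_B_gen]]])
  then have "of_int (int a) * (pull t F - of_int (cb ^ i * v) * B.gen i) \<in> cobd N (2 * i)"
    unfolding split distrib_left pull_scale .
  then have "of_int (int a) * (pull t F - of_int (cb ^ i * v) * B.gen i) \<in> cobd {y} (2 * i)"
    by (rule cobd_mono) simp
  moreover have "of_int (int a) * (pull t F - of_int w * B.gen i) \<in> cobd {y} (2 * i)"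
    by (rule cobd_closed(4)) (use w in \<open>simp add: coords_def\<close>)
  ultimately have "of_int (int a) * (pull t F - of_int (cb ^ i * v) * B.gen i) - of_int (int a) * (pull t F - of_int w * B.gen i) \<in> cobd {y} (2 * i)"
    by (rule cobd_closed(3))
  moreover have "of_int (int a) * (pull t F - of_int (cb ^ i * v) * B.gen i) - of_int (int a) * (pull t F - of_int w * B.gen i)
     = of_int (int a * (w - cb ^ i * v)) * B.gen i" by (simp add: algebra_simps)
  ultimately have "int b dvd int a * (w - cb ^ i * v)" using B.gen_order[OF i] by metis
  then have "int b dvd w - cb ^ i * v"
    using coprime_ab by (simp add: coprime_commute coprime_dvd_mult_right_iff)
  moreover have "int a dvd u' - ca ^ i * u"
    using A.gen_order[OF i, of "u' - ca ^ i * u"] cobd_closed(3)[OF s, of "pull t F - of_int u' * A.gen i"] w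
    by (simp add: coords_def algebra_simps)
  ultimately show ?thesis using coords_cong[OF w i] by blast
qed

text \<open>
  A class of \<open>N\<close> is fixed by \<open>y\<close>, which multiplies the first coordinate by \<open>r\<^sup>i\<close>.
\<close>
lemma coords_y_constraint:
  assumes F: "F \<in> cocyc N (2 * i)" and c: "coords i F u v" and i: "i > 0"
  shows "int a dvd (r ^ i - 1) * u"
proof -
  have y: "pull y F = F" using F by (simp add: cocyc_def inv_N_iff)
  have Fu: "F - of_int u * A.gen i \<in> cobd {s} (2 * i)" using c by (simp add: coords_def)
  have "pull y (F - of_int u * A.gen i) + of_int u * (pull y (A.gen i) - of_int (r ^ i) * A.gen i) \<in> cobd {s} (2 * i)"
    by (intro cobd_closed pull_y_cobd_s pull_y_A_gen Fu)
  from cobd_closed(3)[OF Fu this]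
  have "of_int ((r ^ i - 1) * u) * A.gen i \<in> cobd {s} (2 * i)"
    by (simp add: pull_diff pull_scale y algebra_simps)
  then show ?thesis using A.gen_order[OF i] by blast
qed

text \<open>
  The first coordinate vanishes because \<open>b\<close> kills the inflated class and is a unit modulo \<open>a\<close>.
\<close>
lemma coords_B_gen: assumes "i > 0" shows "coords i (B.gen i) 0 1"
proof -
  obtain u v where c: "coords i (B.gen i) u v" using coords_exist[OF B_gen_N] by blast
  have "coords i (of_int (int b) * B.gen i) (int b * u) (int b * v)"
    using coords_lin[OF c c, of "int b" 0] by simp
  then have "int a dvd int b * u"
    using cobd_N_iff_coords[OF cocyc_closed(4)[OF B_gen_N] _ assms] b_B_gen_N[OF assms] by blast
  then have "int a dvd u" using coprime_ab by (simp add: coprime_dvd_mult_right_iff)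
  then have "coords i (B.gen i) 0 v" using coords_cong[OF c assms] by simp
  then show ?thesis by (simp add: coords_def cobd_closed)
qed

text \<open>
  The transfer of \<open>u x\<^sub>a\<^sup>i\<close> restricts to \<open>b u x\<^sub>a\<^sup>i\<close>, as each of the \<open>b\<close> translates of \<open>u x\<^sub>a\<^sup>i\<close>
  is cohomologous to it by the assumption on \<open>u\<close>. This is corrected by an inverse \<open>w\<close> of \<open>b\<close>
  modulo \<open>a\<close>. The transfer is killed by \<open>a\<close>, so its restriction to \<open>\<int>\<^sub>b\<close> is zero.
\<close>
lemma coords_transfer:
  assumes i: "i > 0" and u: "int a dvd (r ^ i - 1) * u"
  shows "\<exists>F\<in>cocyc N (2 * i). coords i F u 0"
proof -
  obtain w where w: "[int b * w = 1] (mod int a)"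
    using coprime_ab cong_solve_coprime_int[of "int b" "int a"] by (auto simp: coprime_commute)
  define g where "g = of_int (w * u) * A.gen i"
  have g: "g \<in> cocyc {s} (2 * i)" unfolding g_def by (intro cocyc_closed A.gen_cocyc)
  have F: "B.norm g \<in> cocyc N (2 * i)"
    using g by (simp add: cocyc_def transfer_y B.norm_codiff[symmetric]) (simp add: B.norm_def)
  have step: "pull y g - g \<in> cobd {s} (2 * i)"
  proof -
    have "int a dvd w * ((r ^ i - 1) * u)" using u by (rule dvd_mult)
    then have "of_int (w * u) * (pull y (A.gen i) - of_int (r ^ i) * A.gen i) + of_int (w * ((r ^ i - 1) * u)) * A.gen i \<in> cobd {s} (2 * i)"
      by (intro cobd_closed(2)[OF cobd_closed(4)[OF pull_y_A_gen]]) (simp only: A.gen_order[OF i])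
    moreover have "pull y g - g = of_int (w * u) * (pull y (A.gen i) - of_int (r ^ i) * A.gen i) + of_int (w * ((r ^ i - 1) * u)) * A.gen i"
      unfolding g_def pull_scale by (simp add: algebra_simps)
    ultimately show ?thesis by (simp only:)
  qed
  have steps: "pull (y ^^ j) g - g \<in> cobd {s} (2 * i)" for j
  proof (induction j)
    case 0 then show ?case by (simp add: cobd_closed)
  next
    case (Suc j)
    have "pull (y ^^ j) g - g \<in> cobd {s} (2 * i)" by (rule Suc)
    then have "pull y (pull (y ^^ j) g - g) + (pull y g - g) \<in> cobd {s} (2 * i)"
      by (rule cobd_closed(2)[OF pull_y_cobd_s step])
    moreover have "pull (y ^^ Suc j) g = pull y (pull (y ^^ j) g)"
      by (simp only: pull_comp funpow_Suc_right)
    then have "pull y (pull (y ^^ j) g - g) + (pull y g - g) = pull (y ^^ Suc j) g - g"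
      by (simp only: pull_diff) simp
    ultimately have "pull (y ^^ Suc j) g - g \<in> cobd {s} (2 * i)" by (simp only:)
    then show ?case .
  qed
  have "B.norm g - of_int (int b) * g = (\<Sum>j<b. pull (y ^^ j) g - g)"
    by (simp add: B.norm_def sum_subtractf)
  also have "\<dots> \<in> cobd {s} (2 * i)"
    using steps by (induction b) (auto simp: cobd_closed)
  finally have "B.norm g - of_int (int b * (w * u)) * A.gen i \<in> cobd {s} (2 * i)"
    by (simp add: g_def mult.assoc)
  moreover obtain u' v where c: "coords i (B.norm g) u' v" using coords_exist[OF F] by blast
  ultimately have c1: "coords i (B.norm g) (int b * (w * u)) v" by (simp add: coords_def)
  have "int a dvd (int b * w - 1) * u" using w by (simp add: cong_iff_dvd_diff)
  then have c2: "coords i (B.norm g) u v"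
    by (intro coords_cong[OF c1 i]) (simp_all add: algebra_simps)
  have "of_int (int a) * g \<in> cobd {s} (2 * i)"
  proof -
    have "of_int (int a * (w * u)) * A.gen i \<in> cobd {s} (2 * i)" by (simp only: A.gen_order[OF i] dvd_triv_left)
    then show ?thesis by (simp add: g_def mult.assoc)
  qed
  then obtain h where h: "h \<in> inv_cochains {s} (2 * i - 1)" "of_int (int a) * g = codiff h"
    using i by (cases "2 * i") auto
  have "of_int (int a) * B.norm g = codiff (B.norm h)"
    using B.norm_scale[of "int a" g] unfolding h(2) B.norm_codiff by (rule sym)
  moreover have "codiff (B.norm h) \<in> cobd N (2 * i)"
    using transfer_y[OF h(1)] i by (cases "2 * i") auto
  ultimately have "of_int (int a) * B.norm g \<in> cobd N (2 * i)" by simp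
  moreover have "coords i (of_int (int a) * B.norm g) (int a * u) (int a * v)"
    using coords_lin[OF c2 c2, of "int a" 0] by simp
  ultimately have "int b dvd int a * v"
    using cobd_N_iff_coords[OF cocyc_closed(4)[OF F] _ i] by blast
  then have "int b dvd v" using coprime_ab by (simp add: coprime_dvd_mult_right_iff coprime_commute)
  then have "coords i (B.norm g) u 0" using coords_cong[OF c2 i] by simp
  then show ?thesis using F by blast
qed

lemma coords_realize:
  assumes i: "i > 0" and u: "int a dvd (r ^ i - 1) * u"
  shows "\<exists>F\<in>cocyc N (2 * i). coords i F u v"
proof -
  obtain F where F: "F \<in> cocyc N (2 * i)" "coords i F u 0" using coords_transfer[OF assms] by blast
  have "coords i (F + of_int v * B.gen i) u v"
    using coords_lin[OF F(2) coords_B_gen[OF i], of 1 v] by simp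
  moreover have "F + of_int v * B.gen i \<in> cocyc N (2 * i)" by (intro cocyc_closed F B_gen_N)
  ultimately show ?thesis by blast
qed

subsection \<open>The Wang sequence\<close>

text \<open>
  The translates of the slice \<open>\<tau> = 0\<close> by powers of \<open>t\<close> cover \<open>X\<close> disjointly. Choosing \<open>k = 0\<close> on
  tuples whose first point lies in the slice determines \<open>k\<close> along each orbit by summation.
\<close>
lemma inv_N_subtract_t_surj:
  assumes F: "F \<in> inv_cochains N n" shows "\<exists>k\<in>inv_cochains N n. k - pull t k = F"
proof -
  define t' where "t' = inv_into UNIV t"
  have t't: "t' \<circ> t = id" unfolding t'_def using inv_o_cancel[OF bij_is_inj[OF bij_t]] .
  define k where "k xs = (if xs = [] then 0
      else if \<tau> (hd xs) \<ge> 0 then - (\<Sum>i<nat (\<tau> (hd xs)). F (map (t' ^^ Suc i) xs))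
      else (\<Sum>i<nat (- \<tau> (hd xs)). F (map (t ^^ i) xs)))" for xs
  have pos: "pull (t' ^^ i) F \<in> inv_cochains N n" for i
  proof (induction i)
    case (Suc i)
    have "pull (t' ^^ Suc i) F = pull t' (pull (t' ^^ i) F)" by (simp only: pull_comp funpow_Suc_right funpow.simps(2) funpow_swap1) (simp add: fun_eq_iff pull_def funpow_swap1)?
    then show ?case using pull_t_inverse_inv_N[OF Suc] by (simp only: t'_def)
  qed (use F in simp)
  have neg: "pull (t ^^ i) F \<in> inv_cochains N n" for i
  proof (induction i)
    case (Suc i)
    have "pull (t ^^ Suc i) F = pull t (pull (t ^^ i) F)" by (simp only: pull_comp funpow_Suc_right funpow.simps(2) funpow_swap1) (simp add: fun_eq_iff pull_def funpow_swap1)?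
    then show ?case using pull_t_inv_N[OF Suc] by (simp only:)
  qed (use F in simp)
  have inv: "pull g k = k" if g: "g \<in> N" for g
  proof
    fix xs
    have "pull g (pull (t' ^^ i) F) = pull (t' ^^ i) F" "pull g (pull (t ^^ i) F) = pull (t ^^ i) F" for i
      using pos[of i] neg[of i] g by (auto simp: inv_cochains_def)
    then have "F (map (t' ^^ i) (map g xs)) = F (map (t' ^^ i) xs)" "F (map (t ^^ i) (map g xs)) = F (map (t ^^ i) xs)" for i
      unfolding pull_def by meson+
    moreover have "\<tau> (g x) = \<tau> x" for x using g \<tau>_s \<tau>_y by auto
    ultimately show "pull g k xs = k xs" by (cases xs) (simp_all only: pull_def k_def list.map list.sel list.simps)
  qed
  have "k \<in> cochains n" using F by (auto simp: inv_cochains_def cochains_def k_def)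
  moreover have "k xs - k (map t xs) = F xs" for xs
  proof (cases xs)
    case Nil then show ?thesis using F by (simp add: k_def inv_cochains_def cochains_def)
  next
    case (Cons x ys)
    have m: "map (t' ^^ Suc i) (map t xs) = map (t' ^^ i) xs" for i
    proof -
      have "t' ((t' ^^ i) (t z)) = (t' ^^ i) z" for z
        using t't by (metis comp_apply funpow_swap1 id_apply)
      then show ?thesis by simp
    qed
    have m': "map (t ^^ i) (map t xs) = map (t ^^ Suc i) xs" for i
      by (simp add: funpow_Suc_right del: funpow.simps)
    show ?thesis
    proof (cases "\<tau> x \<ge> 0")
      case True
      have "k (map t xs) = - (\<Sum>i<Suc (nat (\<tau> x)). F (map (t' ^^ Suc i) (map t xs)))"
        using True Cons by (simp add: k_def \<tau>_t nat_add_distrib del: funpow.simps)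
      also have "\<dots> = - (F xs + (\<Sum>i<nat (\<tau> x). F (map (t' ^^ Suc i) xs)))"
        unfolding m by (subst sum.lessThan_Suc_shift) simp
      finally show ?thesis using True Cons by (simp add: k_def)
    next
      case False
      then have e: "nat (- \<tau> x) = Suc (nat (- \<tau> x - 1))" by simp
      have "k xs = (\<Sum>i<Suc (nat (- \<tau> x - 1)). F (map (t ^^ i) xs))"
        using False Cons by (simp only: k_def list.sel e) simp
      also have "\<dots> = F xs + (\<Sum>i<nat (- \<tau> x - 1). F (map (t ^^ i) (map t xs)))"
        unfolding m' by (subst sum.lessThan_Suc_shift) simp
      also have "(\<Sum>i<nat (- \<tau> x - 1). F (map (t ^^ i) (map t xs))) = k (map t xs)"
        using False Cons by (cases "\<tau> x = -1") (auto simp: k_def \<tau>_t)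
      finally show ?thesis by simp
    qed
  qed
  ultimately show ?thesis using inv by (intro bexI[of _ k]) (auto simp: inv_cochains_def pull_def)
qed

text \<open>
  If \<open>h - t h\<close> bounds over \<open>N\<close>, then \<open>h\<close> can be changed by a coboundary so as to become invariant
  under \<open>t\<close>; this does not change \<open>d h\<close>.
\<close>
lemma descend:
  assumes f: "f = codiff h" and h: "h \<in> inv_cochains N n" and d: "h - pull t h \<in> cobd N n"
  shows "f \<in> cobd T (Suc n)"
proof (cases n)
  case 0
  then show ?thesis using assms by (auto simp: inv_T_iff)
next
  case (Suc m)
  obtain k where k: "k \<in> inv_cochains N m" "h - pull t h = codiff k" using d Suc by auto
  obtain k' where k': "k' \<in> inv_cochains N m" "k' - pull t k' = k" using inv_N_subtract_t_surj[OF k(1)] by blast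
  have "h - pull t h = codiff k' - pull t (codiff k')"
    by (simp add: k(2) k'(2)[symmetric] codiff_diff codiff_pull)
  then have "pull t (h - codiff k') = h - codiff k'" by (simp add: pull_diff algebra_simps)
  then have "h - codiff k' \<in> inv_cochains T n"
    using h inv_cochains_codiff[OF k'(1)] Suc by (auto simp: inv_T_iff intro: inv_cochains_closed)
  moreover have "f = codiff (h - codiff k')" by (simp add: f codiff_diff)
  ultimately show ?thesis by simp
qed

text \<open>
  Restriction to \<open>N\<close> is injective in even degrees, since the obstruction lies in odd cohomology of
  \<open>N\<close>.
\<close>
lemma even_cobd_T:
  assumes F: "F \<in> cocyc T (2 * i)" "F \<in> cobd N (2 * i)" and i: "i > 0"
  shows "F \<in> cobd T (2 * i)"
proof -
  obtain j where j: "i = Suc j" using i by (cases i) auto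
  obtain h where h: "h \<in> inv_cochains N (2 * j + 1)" "F = codiff h" using F(2) j by auto
  have "pull t F = F" using F(1) by (simp add: cocyc_def inv_T_iff)
  then have "codiff (h - pull t h) = 0" by (simp add: h codiff_diff codiff_pull)
  moreover have "h - pull t h \<in> inv_cochains N (2 * j + 1)" by (intro inv_cochains_closed h pull_t_inv_N)
  ultimately have "h - pull t h \<in> cobd N (2 * j + 1)" by (intro odd_cocyc_N) (simp add: cocyc_def)
  from descend[OF h(2,1) this] show ?thesis by (simp add: j)
qed

text \<open>
  If \<open>F - t F = d h\<close> and \<open>h = k - t k\<close>, then subtracting \<open>d k\<close> from \<open>F\<close> makes it invariant under
  \<open>t\<close>.
\<close>
lemma even_lift:
  assumes F: "F \<in> cocyc N (2 * i)" "F - pull t F \<in> cobd N (2 * i)" and i: "i > 0"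
  shows "\<exists>F'\<in>cocyc T (2 * i). F' - F \<in> cobd N (2 * i)"
proof -
  obtain m where m: "2 * i = Suc m" using i by (cases "2 * i") auto
  obtain h where h: "h \<in> inv_cochains N m" "F - pull t F = codiff h" using F(2) m by auto
  obtain k where k: "k \<in> inv_cochains N m" "k - pull t k = h" using inv_N_subtract_t_surj[OF h(1)] by blast
  have k1: "codiff k \<in> cobd N (2 * i)" using k m by simp
  have "F - pull t F = codiff k - pull t (codiff k)"
    by (simp add: h(2) k(2)[symmetric] codiff_diff codiff_pull)
  then have "pull t (F - codiff k) = F - codiff k" by (simp add: pull_diff algebra_simps)
  moreover have "F - codiff k \<in> cocyc N (2 * i)" by (intro cocyc_closed F cobd_cocyc k1)
  ultimately have "F - codiff k \<in> cocyc T (2 * i)" by (simp add: cocyc_def inv_T_iff)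
  moreover have "(F - codiff k) - F \<in> cobd N (2 * i)" using cobd_uminus[OF k1] by simp
  ultimately show ?thesis by blast
qed

subsection \<open>Even classes of the whole group\<close>

lemma cocyc_T_N: "F \<in> cocyc T n \<Longrightarrow> F \<in> cocyc N n"
  by (rule cocyc_mono) auto

lemma cobd_T_N: "F \<in> cobd T n \<Longrightarrow> F \<in> cobd N n"
  by (rule cobd_mono) auto

lemma even_cobd_iff:
  assumes "F \<in> cocyc T (2 * i)" "coords i F u v" "i > 0"
  shows "F \<in> cobd T (2 * i) \<longleftrightarrow> int a dvd u \<and> int b dvd v"
  using even_cobd_T[OF assms(1) _ assms(3)] cobd_T_N cobd_N_iff_coords[OF cocyc_T_N[OF assms(1)] assms(2,3)] by blast

lemma even_constraints:
  assumes "F \<in> cocyc T (2 * i)" "coords i F u v" "i > 0"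
  shows "int a dvd (r ^ i - 1) * u" "int a dvd (ca ^ i - 1) * u" "int b dvd (cb ^ i - 1) * v"
proof -
  show "int a dvd (r ^ i - 1) * u" by (rule coords_y_constraint[OF cocyc_T_N[OF assms(1)] assms(2,3)])
  have "pull t F = F" using assms(1) by (simp add: cocyc_def inv_T_iff)
  then have "coords i F (ca ^ i * u) (cb ^ i * v)"
    using coords_pull_t[OF cocyc_T_N[OF assms(1)] assms(2,3)] by simp
  from coords_unique[OF this assms(2) _ assms(3)]
  show "int a dvd (ca ^ i - 1) * u" "int b dvd (cb ^ i - 1) * v"
    by (simp_all add: cobd_closed algebra_simps)
qed

lemma even_realize:
  assumes i: "i > 0" and "int a dvd (r ^ i - 1) * u" "int a dvd (ca ^ i - 1) * u" "int b dvd (cb ^ i - 1) * v"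
  shows "\<exists>F\<in>cocyc T (2 * i). coords i F u v"
proof -
  obtain F where F: "F \<in> cocyc N (2 * i)" "coords i F u v" using coords_realize[OF assms(1,2)] by blast
  have "coords i (F - pull t F) (u - ca ^ i * u) (v - cb ^ i * v)"
    by (intro coords_diff F coords_pull_t i)
  then have "coords i (F - pull t F) 0 0"
    using assms by (elim coords_cong[OF _ i]) (simp_all add: algebra_simps dvd_diff_commute)
  moreover have "F - pull t F \<in> cocyc N (2 * i)" by (intro cocyc_closed F pull_t_cocyc_N)
  ultimately have "F - pull t F \<in> cobd N (2 * i)" using cobd_N_iff_coords[OF _ _ i] by blast
  then obtain F' where "F' \<in> cocyc T (2 * i)" "F' - F \<in> cobd N (2 * i)" using even_lift[OF F(1) _ i] by blast
  then show ?thesis using coords_cobd F(2) by blast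
qed

subsection \<open>Odd classes of the whole group\<close>

text \<open>
  An odd cocycle of the whole group is a coboundary \<open>d h\<close> over \<open>N\<close>. It is the image of the class
  of \<open>h - t h\<close> under the connecting map of the Wang sequence, and receives the coordinates of that
  class.
\<close>
definition ocoords :: "nat \<Rightarrow> ('x list \<Rightarrow> int) \<Rightarrow> int \<Rightarrow> int \<Rightarrow> bool"
  where "ocoords i f u v \<longleftrightarrow> (\<exists>h\<in>inv_cochains N (2 * i). f = codiff h \<and> h - pull t h \<in> cocyc N (2 * i) \<and> coords i (h - pull t h) u v)"

lemma ocoords_exist:
  assumes f: "f \<in> cocyc T (2 * i + 1)" shows "\<exists>u v. ocoords i f u v"
proof -
  have "f \<in> cobd N (2 * i + 1)" using f by (intro odd_cocyc_N cocyc_T_N)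
  then obtain h where h: "h \<in> inv_cochains N (2 * i)" "f = codiff h" by auto
  have "pull t f = f" using f by (simp add: cocyc_def inv_T_iff)
  then have "codiff (h - pull t h) = 0" by (simp add: h codiff_diff codiff_pull)
  moreover have "h - pull t h \<in> inv_cochains N (2 * i)" by (intro inv_cochains_closed h pull_t_inv_N)
  ultimately have "h - pull t h \<in> cocyc N (2 * i)" by (simp add: cocyc_def)
  then show ?thesis unfolding ocoords_def using h coords_exist by blast
qed

lemma ocoords_cocyc: "ocoords i f u v \<Longrightarrow> f \<in> cocyc T (2 * i + 1)"
proof -
  assume "ocoords i f u v"
  then obtain h where h: "h \<in> inv_cochains N (2 * i)" "f = codiff h" "h - pull t h \<in> cocyc N (2 * i)"
    by (auto simp: ocoords_def)
  have "codiff h - pull t (codiff h) = 0"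
    using h(3) by (simp add: cocyc_def codiff_diff codiff_pull)
  then show ?thesis using inv_cochains_codiff[OF h(1)] by (simp add: cocyc_def h(2) inv_T_iff)
qed

lemma ocoords_lin:
  assumes "ocoords i f u v" "ocoords i f' u' v'"
  shows "ocoords i (of_int k * f + of_int l * f') (k * u + l * u') (k * v + l * v')"
proof -
  obtain h h' where h: "h \<in> inv_cochains N (2 * i)" "f = codiff h" "h - pull t h \<in> cocyc N (2 * i)" "coords i (h - pull t h) u v"
    and h': "h' \<in> inv_cochains N (2 * i)" "f' = codiff h'" "h' - pull t h' \<in> cocyc N (2 * i)" "coords i (h' - pull t h') u' v'"
    using assms by (auto simp: ocoords_def)
  define g where "g = of_int k * h + of_int l * h'"
  have "g - pull t g = of_int k * (h - pull t h) + of_int l * (h' - pull t h')"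
    unfolding g_def pull_add pull_scale by (simp add: algebra_simps)
  moreover have "g \<in> inv_cochains N (2 * i)" unfolding g_def by (intro inv_cochains_closed h h')
  moreover have "of_int k * (h - pull t h) + of_int l * (h' - pull t h') \<in> cocyc N (2 * i)"
    by (intro cocyc_closed(2) cocyc_closed(4) h h')
  ultimately show ?thesis unfolding ocoords_def
    by (intro bexI[of _ g]) (simp_all add: coords_lin h h' g_def codiff_add codiff_scale)
qed

lemma ocoords_diff: "ocoords i f u v \<Longrightarrow> ocoords i f' u' v' \<Longrightarrow> ocoords i (f - f') (u - u') (v - v')"
  using ocoords_lin[of i f u v f' u' v' 1 "-1"] by simp

lemma ocoords_constraint: "ocoords i f u v \<Longrightarrow> i > 0 \<Longrightarrow> int a dvd (r ^ i - 1) * u"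
  using coords_y_constraint by (auto simp: ocoords_def)

lemma ocoords_realize_0: 
  assumes "F \<in> cocyc N (2 * i)" "coords i F u v" shows "\<exists>f. ocoords i f u v"
proof -
  obtain h where "h \<in> inv_cochains N (2 * i)" "h - pull t h = F"
    using inv_N_subtract_t_surj[OF cocyc_inv[OF assms(1)]] by blast
  then show ?thesis unfolding ocoords_def using assms by metis
qed

lemma ocoords_realize: "i > 0 \<Longrightarrow> int a dvd (r ^ i - 1) * u \<Longrightarrow> \<exists>f. ocoords i f u v"
  using coords_realize ocoords_realize_0 by blast

text \<open>
  The kernel of the connecting map is the image of \<open>1 - t\<close>, which acts on coordinates by \<open>(1 -
  c\<^sub>a\<^sup>i, 1 - c\<^sub>b\<^sup>i)\<close>.
\<close>
lemma odd_cobd_iff: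
  assumes f: "ocoords i f u v" and i: "i > 0"
  shows "f \<in> cobd T (2 * i + 1) \<longleftrightarrow>
    (\<exists>u' v'. int a dvd (r ^ i - 1) * u' \<and> int a dvd u - (ca ^ i - 1) * u' \<and> int b dvd v - (cb ^ i - 1) * v')"
proof -
  obtain h where h: "h \<in> inv_cochains N (2 * i)" "f = codiff h" "h - pull t h \<in> cocyc N (2 * i)" "coords i (h - pull t h) u v"
    using f by (auto simp: ocoords_def)
  show ?thesis
  proof
    assume "f \<in> cobd T (2 * i + 1)"
    then obtain m where m: "m \<in> inv_cochains T (2 * i)" "f = codiff m" by auto
    have z: "m - h \<in> cocyc N (2 * i)"
      using m h by (auto simp: cocyc_def codiff_diff inv_T_iff intro: inv_cochains_closed)
    obtain u' v' where c: "coords i (m - h) u' v'" using coords_exist[OF z] by blast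
    have "coords i (pull t (m - h) - (m - h)) (ca ^ i * u' - u') (cb ^ i * v' - v')"
      by (intro coords_diff c coords_pull_t z i)
    moreover have "pull t (m - h) - (m - h) = h - pull t h"
      using m by (simp add: pull_diff inv_T_iff)
    ultimately have "coords i (h - pull t h) (ca ^ i * u' - u') (cb ^ i * v' - v')" by simp
    from coords_unique[OF h(4) this _ i]
    have "int a dvd u - (ca ^ i - 1) * u'" "int b dvd v - (cb ^ i - 1) * v'"
      by (simp_all add: cobd_closed left_diff_distrib)
    then show "\<exists>u' v'. int a dvd (r ^ i - 1) * u' \<and> int a dvd u - (ca ^ i - 1) * u' \<and> int b dvd v - (cb ^ i - 1) * v'"
      using coords_y_constraint[OF z c i] by blast
  next
    assume "\<exists>u' v'. int a dvd (r ^ i - 1) * u' \<and> int a dvd u - (ca ^ i - 1) * u' \<and> int b dvd v - (cb ^ i - 1) * v'"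
    then obtain u' v' where uv: "int a dvd (r ^ i - 1) * u'" "int a dvd u - (ca ^ i - 1) * u'" "int b dvd v - (cb ^ i - 1) * v'"
      by blast
    obtain z where z: "z \<in> cocyc N (2 * i)" "coords i z u' v'" using coords_realize[OF i uv(1)] by blast
    have "coords i (h - pull t h - (pull t z - z)) (u - (ca ^ i * u' - u')) (v - (cb ^ i * v' - v'))"
      by (intro coords_diff h z coords_pull_t i)
    then have "coords i (h - pull t h - (pull t z - z)) 0 0"
      using uv by (elim coords_cong[OF _ i]) (simp_all add: left_diff_distrib)
    moreover have "h - pull t h - (pull t z - z) \<in> cocyc N (2 * i)"
      by (intro cocyc_closed(3) h z pull_t_cocyc_N)
    ultimately have "h - pull t h - (pull t z - z) \<in> cobd N (2 * i)" using cobd_N_iff_coords[OF _ _ i] by blast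
    then have "(h + z) - pull t (h + z) \<in> cobd N (2 * i)" by (simp add: pull_add algebra_simps)
    moreover have "f = codiff (h + z)" using z h by (simp add: codiff_add cocyc_def)
    moreover have "h + z \<in> inv_cochains N (2 * i)" by (intro inv_cochains_closed h cocyc_inv z)
    ultimately show "f \<in> cobd T (2 * i + 1)" using descend by simp
  qed
qed

lemma ocoords_hcup:
  assumes E: "E \<in> cocyc T (2 * i)" "coords i E u v" and f: "ocoords j f u' v'"
  shows "ocoords (i + j) (hcup (2 * i) E f) (u * u') (v * v')"
proof -
  obtain h where h: "h \<in> inv_cochains N (2 * j)" "f = codiff h" "h - pull t h \<in> cocyc N (2 * j)" "coords j (h - pull t h) u' v'"
    using f by (auto simp: ocoords_def)
  have e: "pull t E = E" "codiff E = 0" using E by (auto simp: cocyc_def inv_T_iff)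
  have "hcup (2 * i) E f = codiff (hcup (2 * i) E h)"
    using codiff_hcup[OF cocyc_cochains[OF E(1)] inv_cochains_cochains[OF h(1)]] by (simp add: e h(2) hcup_bilinear)
  moreover have d: "hcup (2 * i) E h - pull t (hcup (2 * i) E h) = hcup (2 * i) E (h - pull t h)"
    by (simp add: pull_hcup e hcup_bilinear)
  moreover have "hcup (2 * i) E h \<in> inv_cochains N (2 * i + 2 * j)"
    by (intro inv_cochains_hcup cocyc_inv[OF cocyc_T_N] E h)
  moreover have "hcup (2 * i) E (h - pull t h) \<in> cocyc N (2 * i + 2 * j)"
    by (intro cocyc_hcup cocyc_T_N E h)
  moreover have "coords (i + j) (hcup (2 * i) E (h - pull t h)) (u * u') (v * v')"
    by (intro coords_hcup E h)
  ultimately show ?thesis unfolding ocoords_def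
    by (intro bexI[of _ "hcup (2 * i) E h"]) (simp_all add: distrib_left)
qed

text \<open>
  Over \<open>N\<close> the first factor is a coboundary, so the product is one too; it has even degree, where
  restriction to \<open>N\<close> is injective.
\<close>
lemma odd_hcup_odd:
  assumes f: "ocoords i f u v" and g: "ocoords j g u' v'"
  shows "hcup (2 * i + 1) f g \<in> cobd T (2 * (i + j) + 2)"
proof -
  have T: "hcup (2 * i + 1) f g \<in> cocyc T (2 * (i + j + 1))"
    using cocyc_hcup[OF ocoords_cocyc[OF f] ocoords_cocyc[OF g]] by (simp add: algebra_simps)
  obtain h where h: "h \<in> inv_cochains N (2 * i)" "f = codiff h" using f by (auto simp: ocoords_def)
  have "f \<in> cobd N (2 * i + 1)" using h by simp
  from cobd_hcup_cocyc[OF this cocyc_T_N[OF ocoords_cocyc[OF g]]]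
  have "hcup (2 * i + 1) f g \<in> cobd N (2 * (i + j + 1))" by (simp add: algebra_simps)
  from even_cobd_T[OF T this] show ?thesis by simp
qed

text \<open>
  The sign of \<open>\<tau>\<close> is chosen such that \<open>h - t h\<close> is \<open>1\<close> and not \<open>-1\<close>.
\<close>
definition eta :: "'x list \<Rightarrow> int"
  where "eta = codiff (\<lambda>xs. if length xs = 1 then - \<tau> (hd xs) else 0)"

lemma ocoords_eta: "ocoords 0 eta 1 1"
proof -
  define h :: "'x list \<Rightarrow> int" where "h xs = (if length xs = 1 then - \<tau> (hd xs) else 0)" for xs
  have "pull g h = h" if "g \<in> N" for g
    using that \<tau>_s \<tau>_y by (auto simp: pull_def h_def fun_eq_iff length_Suc_conv)
  then have h: "h \<in> inv_cochains N 0" by (simp add: inv_cochains_def cochains_def h_def)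
  have "h - pull t h = hunit"
    by (auto simp: pull_def h_def hunit_def fun_eq_iff length_Suc_conv \<tau>_t)
  then show ?thesis unfolding ocoords_def using h
    by (intro bexI[of _ h]) (auto simp: eta_def h_def[abs_def] coords_def cocyc_closed)
qed

lemma eta_cocyc: "eta \<in> cocyc T 1"
  using ocoords_cocyc[OF ocoords_eta] by simp

lemma deg1:
  assumes "f \<in> cocyc T 1" shows "\<exists>k. f - of_int k * eta \<in> cobd T 1"
proof -
  have "\<exists>u v. ocoords 0 f u v" using assms by (intro ocoords_exist) simp
  then obtain h where h: "h \<in> inv_cochains N 0" "f = codiff h" "h - pull t h \<in> cocyc N 0"
    by (auto simp: ocoords_def)
  obtain k where k: "h - pull t h = of_int k * hunit" using A.cocyc_0[OF h(3)] by blast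
  obtain e where e: "e \<in> inv_cochains N 0" "eta = codiff e" "e - pull t e = hunit"
    using ocoords_eta by (auto simp: ocoords_def coords_def)
  have "(h - of_int k * e) - pull t (h - of_int k * e) = 0"
  proof -
    have "(h - of_int k * e) - pull t (h - of_int k * e) = (h - pull t h) - of_int k * (e - pull t e)"
      unfolding pull_diff pull_scale by (simp add: right_diff_distrib)
    then show ?thesis by (simp add: e k)
  qed
  then have "f - of_int k * eta \<in> cobd T (Suc 0)"
    by (intro descend[of _ "h - of_int k * e"])
       (use h e in \<open>auto simp: codiff_diff codiff_scale intro: inv_cochains_closed\<close>)
  then show ?thesis by auto
qed

lemma deg1_order:
  assumes "of_int k * eta \<in> cobd T 1" shows "k = 0"
proof -
  obtain m where m: "m \<in> inv_cochains T 0" "of_int k * eta = codiff m" using assms by auto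
  obtain e where e: "e \<in> inv_cochains N 0" "eta = codiff e" "e - pull t e = hunit"
    using ocoords_eta by (auto simp: ocoords_def coords_def)
  have "codiff (of_int k * e - m) = 0" "of_int k * e - m \<in> cochains 0"
    using m e by (auto simp: codiff_diff codiff_scale inv_cochains_def intro: cochains_closed)
  then obtain l where l: "of_int k * e - m = of_int l * hunit" using acyclic_0 by blast
  have "of_int k * hunit = (of_int k * e - m) - pull t (of_int k * e - m)"
    using m unfolding pull_diff pull_scale e(3)[symmetric] by (simp add: inv_T_iff right_diff_distrib)
  also have "\<dots> = 0" by (simp add: l pull_scale)
  finally have "of_int k * (hunit :: 'x list \<Rightarrow> int) = 0" .
  from fun_cong[OF this, of "[undefined]"] show ?thesis by (simp add: hunit_def)
qed

end

section \<open>The bar complex in homogeneous form\<close>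

lemma codiff_eq_sum:
  "codiff F xs = (\<Sum>i<length xs. (-1) ^ i * F (take i xs @ drop (Suc i) xs))"
proof (induction xs arbitrary: F)
  case (Cons x xs)
  show ?case
    by (simp add: Cons sum.lessThan_Suc_shift sum_negf[symmetric] del: sum.lessThan_Suc)
qed simp

text \<open>
  The bijection \<open>e\<close> transports left translation to a type all of whose elements are points of \<open>X\<close>,
  which spares the homogeneous cochains any reference to a carrier.
\<close>
locale bar_model = group G for G :: "('g, 'm) monoid_scheme" (structure) +
  fixes e :: "'x \<Rightarrow> 'g"
  assumes e: "bij_betw e UNIV (carrier G)"
begin

definition pt :: "'g \<Rightarrow> 'x"
  where "pt = inv_into UNIV e"

definition lact :: "'g \<Rightarrow> 'x \<Rightarrow> 'x"
  where "lact g x = pt (g \<otimes> e x)"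

abbreviation "L \<equiv> lact ` carrier G"

text \<open>
  The partial products \<open>g, g h\<^sub>1, g h\<^sub>1 h\<^sub>2, \<dots>\<close>; with \<open>diffs\<close> as inverse they translate between
  bar notation and homogeneous notation.
\<close>
primrec prods :: "'g \<Rightarrow> 'g list \<Rightarrow> 'g list" where
  "prods g [] = [g]"
| "prods g (h # hs) = g # prods (g \<otimes> h) hs"

definition diffs :: "'g list \<Rightarrow> 'g list"
  where "diffs xs = map2 (\<lambda>x y. inv x \<otimes> y) xs (tl xs)"

definition bar :: "nat \<Rightarrow> ('x list \<Rightarrow> int) \<Rightarrow> 'g list \<Rightarrow> int"
  where "bar n F = (\<lambda>gs \<in> tuples G n. F (map pt (prods \<one> gs)))"

definition unbar :: "nat \<Rightarrow> ('g list \<Rightarrow> int) \<Rightarrow> 'x list \<Rightarrow> int"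
  where "unbar n f xs = (if length xs = Suc n then f (diffs (map e xs)) else 0)"

lemma e_carrier [simp]: "e x \<in> carrier G"
  using e by (auto simp: bij_betw_def)

lemma pt_e [simp]: "pt (e x) = x"
  using e by (simp add: pt_def bij_betw_def)

lemma e_pt [simp]: "g \<in> carrier G \<Longrightarrow> e (pt g) = g"
  unfolding pt_def using e by (metis bij_betw_inv_into_right)

lemma e_lact [simp]: "g \<in> carrier G \<Longrightarrow> e (lact g x) = g \<otimes> e x"
  by (simp add: lact_def)

lemma length_prods [simp]: "length (prods g hs) = Suc (length hs)"
  by (induction hs arbitrary: g) auto

lemma prods_carrier: "g \<in> carrier G \<Longrightarrow> set hs \<subseteq> carrier G \<Longrightarrow> set (prods g hs) \<subseteq> carrier G"
  by (induction hs arbitrary: g) auto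

lemma prods_mult: "k \<in> carrier G \<Longrightarrow> g \<in> carrier G \<Longrightarrow> set hs \<subseteq> carrier G \<Longrightarrow>
    prods (k \<otimes> g) hs = map ((\<otimes>) k) (prods g hs)"
  by (induction hs arbitrary: g) (auto simp: m_assoc)

lemma diffs_Cons: "diffs (x # y # zs) = (inv x \<otimes> y) # diffs (y # zs)"
  by (simp add: diffs_def)

lemma prods_eq_Cons: "\<exists>zs. prods g hs = g # zs"
  by (cases hs) auto

lemma diffs_prods: "g \<in> carrier G \<Longrightarrow> set hs \<subseteq> carrier G \<Longrightarrow> diffs (prods g hs) = hs"
proof (induction hs arbitrary: g)
  case (Cons h hs)
  obtain zs where "prods (g \<otimes> h) hs = (g \<otimes> h) # zs" using prods_eq_Cons by blast
  then show ?case using Cons.IH[of "g \<otimes> h"] Cons.prems by (simp add: diffs_Cons m_assoc[symmetric])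
qed (simp add: diffs_def)

lemma prods_diffs: "x \<in> carrier G \<Longrightarrow> set xs \<subseteq> carrier G \<Longrightarrow> prods x (diffs (x # xs)) = x # xs"
proof (induction xs arbitrary: x)
  case (Cons y ys) then show ?case by (simp add: diffs_Cons m_assoc[symmetric])
qed (simp add: diffs_def)

lemma diffs_tuple: "set xs \<subseteq> carrier G \<Longrightarrow> length xs = Suc n \<Longrightarrow> diffs xs \<in> tuples G n"
proof -
  assume xs: "set xs \<subseteq> carrier G" "length xs = Suc n"
  have "set (diffs xs) \<subseteq> carrier G"
    using xs(1) by (induction xs rule: induct_list012) (simp_all add: diffs_Cons, simp_all add: diffs_def)
  then show "diffs xs \<in> tuples G n" using xs(2) by (simp add: tuples_def) (simp add: diffs_def)
qed

lemma diffs_map_mult: "k \<in> carrier G \<Longrightarrow> set xs \<subseteq> carrier G \<Longrightarrow> diffs (map ((\<otimes>) k) xs) = diffs xs"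
proof (induction xs rule: induct_list012)
  case (3 x y zs)
  have "inv (k \<otimes> x) \<otimes> (k \<otimes> y) = inv x \<otimes> y"
    using 3 by (simp add: inv_mult_group m_assoc) (simp add: m_assoc[symmetric])
  then show ?case using 3 by (simp add: diffs_Cons)
qed (simp_all add: diffs_def)

text \<open>
  Changing the starting point is a left translation, invisible to an invariant cochain.
\<close>
lemma inv_L_prods:
  assumes F: "F \<in> inv_cochains L n" and g: "g \<in> carrier G" "set hs \<subseteq> carrier G"
  shows "F (map pt (prods g hs)) = F (map pt (prods \<one> hs))"
proof -
  have "map pt (prods g hs) = map pt (map ((\<otimes>) g) (prods \<one> hs))"
    using prods_mult[of g \<one> hs] g by simp
  also have "\<dots> = map (lact g) (map pt (prods \<one> hs))"
    using prods_carrier[of \<one> hs] g by (auto simp: lact_def)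
  also have "F \<dots> = pull (lact g) F (map pt (prods \<one> hs))" by (simp only: pull_def)
  finally show ?thesis using F g by (simp add: inv_cochains_def)
qed

lemma tuples_carrier: "gs \<in> tuples G n \<Longrightarrow> set gs \<subseteq> carrier G" and
  tuples_length: "gs \<in> tuples G n \<Longrightarrow> length gs = n"
  by (auto simp: tuples_def)

lemma cochain_group_simps:
  "carrier (cochain_group G n) = (\<Pi>\<^sub>E gs\<in>tuples G n. UNIV)"
  "f \<otimes>\<^bsub>cochain_group G n\<^esub> f' = (\<lambda>gs\<in>tuples G n. f gs + f' gs)"
  "\<one>\<^bsub>cochain_group G n\<^esub> = (\<lambda>gs\<in>tuples G n. 0)"
  by (simp_all add: cochain_group_def)

lemma comm_group_cochain: "comm_group (cochain_group G n)"
proof -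
  have "group (cochain_group G n)" by (simp add: cochain_group_def)
  then show ?thesis by (rule group.group_comm_groupI) (simp add: cochain_group_simps add.commute)
qed

lemma bar_unbar: "f \<in> carrier (cochain_group G n) \<Longrightarrow> bar n (unbar n f) = f"
proof
  fix gs assume f: "f \<in> carrier (cochain_group G n)"
  show "bar n (unbar n f) gs = f gs"
  proof (cases "gs \<in> tuples G n")
    case True
    then have "map (e \<circ> pt) (prods \<one> gs) = prods \<one> gs"
      using prods_carrier[of \<one> gs] by (intro map_idI) (auto simp: tuples_def)
    then show ?thesis using True by (simp add: bar_def unbar_def tuples_length diffs_prods tuples_carrier)
  next
    case False
    then show ?thesis using f by (auto simp: bar_def cochain_group_simps)
  qed
qed

lemma unbar_bar:
  assumes F: "F \<in> inv_cochains L n" shows "unbar n (bar n F) = F"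
proof
  fix xs
  show "unbar n (bar n F) xs = F xs"
  proof (cases "length xs = Suc n")
    case True
    then obtain x ys where xs: "xs = x # ys" by (cases xs) auto
    have d: "diffs (map e xs) \<in> tuples G n" using True by (intro diffs_tuple) auto
    then have "unbar n (bar n F) xs = F (map pt (prods \<one> (diffs (map e xs))))"
      using True by (simp add: unbar_def bar_def)
    also have "\<dots> = F (map pt (prods (e x) (diffs (map e xs))))"
      using inv_L_prods[OF F e_carrier tuples_carrier[OF d]] by (rule sym)
    also have "prods (e x) (diffs (map e xs)) = map e xs"
      using prods_diffs[of "e x" "map e ys"] xs by (simp add: image_subset_iff)
    finally show ?thesis by (simp add: comp_def)
  next
    case False then show ?thesis using F by (auto simp: unbar_def inv_cochains_def cochains_def)
  qed
qed

lemma unbar_inv: "unbar n f \<in> inv_cochains L n"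
proof -
  have "pull (lact g) (unbar n f) = unbar n f" if g: "g \<in> carrier G" for g
  proof
    fix xs
    have m: "map e (map (lact g) xs) = map ((\<otimes>) g) (map e xs)" using g by simp
    have "set (map e xs) \<subseteq> carrier G" by auto
    note d = diffs_map_mult[OF g this]
    show "pull (lact g) (unbar n f) xs = unbar n f xs"
      unfolding pull_def unbar_def m d by simp
  qed
  then show ?thesis by (auto simp: inv_cochains_def cochains_def unbar_def)
qed

lemma bar_carrier: "bar n F \<in> carrier (cochain_group G n)"
  by (simp add: bar_def cochain_group_simps)

lemma bar_inj: "F \<in> inv_cochains L n \<Longrightarrow> F' \<in> inv_cochains L n \<Longrightarrow> bar n F = bar n F' \<longleftrightarrow> F = F'"
  by (metis unbar_bar)

lemma bar_add: "bar n (F + F') = bar n F \<otimes>\<^bsub>cochain_group G n\<^esub> bar n F'"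
  by (auto simp: bar_def cochain_group_simps fun_eq_iff)

lemma bar_0: "bar n 0 = \<one>\<^bsub>cochain_group G n\<^esub>"
  by (auto simp: bar_def cochain_group_simps fun_eq_iff)

subsection \<open>Differential and cup product\<close>

lemma take_prods: "take (Suc p) (prods g hs) = prods g (take p hs)"
proof (induction hs arbitrary: p g)
  case (Cons h hs)
  then show ?case by (cases p) simp_all
qed simp

lemma drop_prods: "p \<le> length hs \<Longrightarrow> g \<in> carrier G \<Longrightarrow> set hs \<subseteq> carrier G \<Longrightarrow>
   \<exists>k\<in>carrier G. drop p (prods g hs) = prods k (drop p hs)"
proof (induction p arbitrary: g hs)
  case (Suc p)
  then obtain h hs' where "hs = h # hs'" by (cases hs) auto
  then show ?case using Suc.IH[of hs' "g \<otimes> h"] Suc.prems by simp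
qed auto

lemma delete_prods: "Suc i < length hs \<Longrightarrow> g \<in> carrier G \<Longrightarrow> set hs \<subseteq> carrier G \<Longrightarrow>
   take (Suc i) (prods g hs) @ drop (Suc (Suc i)) (prods g hs)
   = prods g (take i hs @ (hs ! i \<otimes> hs ! Suc i) # drop (i + 2) hs)"
proof (induction i arbitrary: g hs)
  case 0
  then obtain h k hs' where "hs = h # k # hs'" by (cases hs; cases "tl hs") auto
  then show ?case using 0 by (simp add: m_assoc)
next
  case (Suc i)
  then obtain h hs' where "hs = h # hs'" by (cases hs) auto
  then show ?case using Suc.IH[of hs' "g \<otimes> h"] Suc.prems by simp
qed

text \<open>
  Deleting an inner partial product multiplies two neighbours, deleting the last one drops the
  last entry, and deleting the first one changes the starting point.
\<close>
lemma coboundary_bar: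
  assumes F: "F \<in> inv_cochains L n"
  shows "coboundary_map G n (bar n F) = bar (Suc n) (codiff F)"
proof
  fix gs
  show "coboundary_map G n (bar n F) gs = bar (Suc n) (codiff F) gs"
  proof (cases "gs \<in> tuples G (Suc n)")
    case True
    then have gs: "set gs \<subseteq> carrier G" "length gs = Suc n" by (auto simp: tuples_def)
    then obtain g gs' where gs': "gs = g # gs'" by (cases gs) auto
    define P where "P = prods \<one> gs"
    have P: "length P = Suc (Suc n)" using gs by (simp add: P_def)
    have t1: "tl gs \<in> tuples G n" using gs by (simp add: tuples_def gs')
    have t2: "butlast gs \<in> tuples G n" using gs by (auto simp: tuples_def dest: in_set_butlastD)
    have t3: "take i gs @ (gs ! i \<otimes> gs ! Suc i) # drop (i + 2) gs \<in> tuples G n" if "i < n" for i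
    proof -
      have "gs ! i \<in> carrier G" "gs ! Suc i \<in> carrier G" using gs that by (auto simp: subset_eq)
      then show ?thesis using gs that by (auto simp: tuples_def dest: in_set_takeD in_set_dropD)
    qed
    have "bar (Suc n) (codiff F) gs = codiff F (map pt P)" using True by (simp add: bar_def P_def)
    also have "\<dots> = (\<Sum>i<Suc (Suc n). (-1) ^ i * F (map pt (take i P @ drop (Suc i) P)))"
      by (simp only: codiff_eq_sum length_map P take_map drop_map map_append)
    also have "\<dots> = F (map pt (drop 1 P)) + (\<Sum>i<n. (-1) ^ Suc i * F (map pt (take (Suc i) P @ drop (Suc (Suc i)) P)))
        + (-1) ^ Suc n * F (map pt (take (Suc n) P))"
    proof -
      have split: "(\<Sum>i<Suc (Suc n). f i) = f 0 + (\<Sum>i<n. f (Suc i)) + f (Suc n)" for f :: "nat \<Rightarrow> int"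
        by (subst sum.lessThan_Suc_shift) simp
      have "drop (Suc (Suc n)) P = []" using P by simp
      then show ?thesis
        by (simp only: split take_0 append_Nil append_Nil2 power_0 mult_1_left One_nat_def)
    qed
    also have "F (map pt (drop 1 P)) = bar n F (tl gs)"
      using t1 gs inv_L_prods[OF F, of g gs'] by (simp add: bar_def P_def gs')
    also have "F (map pt (take (Suc n) P)) = bar n F (butlast gs)"
      using t2 gs by (simp add: bar_def P_def take_prods butlast_conv_take)
    also have "(\<Sum>i<n. (-1) ^ Suc i * F (map pt (take (Suc i) P @ drop (Suc (Suc i)) P)))
       = (\<Sum>i<n. (-1) ^ Suc i * bar n F (take i gs @ (gs ! i \<otimes> gs ! Suc i) # drop (i + 2) gs))"
    proof (rule sum.cong[OF refl])
      fix i assume "i \<in> {..<n}"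
      then show "(-1) ^ Suc i * F (map pt (take (Suc i) P @ drop (Suc (Suc i)) P))
         = (-1) ^ Suc i * bar n F (take i gs @ (gs ! i \<otimes> gs ! Suc i) # drop (i + 2) gs)"
        using t3[of i] gs by (simp only: bar_def P_def delete_prods[of i gs \<one>] restrict_apply' one_closed lessThan_iff Suc_less_eq gs(2))
    qed
    finally show ?thesis using True by (simp add: coboundary_map_def)
  next
    case False then show ?thesis by (simp add: coboundary_map_def bar_def)
  qed
qed

lemma cup_bar:
  assumes F': "F' \<in> inv_cochains L q"
  shows "cup_cochain G p q (bar p F) (bar q F') = bar (p + q) (hcup p F F')"
proof
  fix gs
  show "cup_cochain G p q (bar p F) (bar q F') gs = bar (p + q) (hcup p F F') gs"
  proof (cases "gs \<in> tuples G (p + q)")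
    case True
    then have gs: "set gs \<subseteq> carrier G" "length gs = p + q" by (auto simp: tuples_def)
    have t: "take p gs \<in> tuples G p" "drop p gs \<in> tuples G q"
      using gs by (auto simp: tuples_def dest: in_set_takeD in_set_dropD)
    obtain k where k: "k \<in> carrier G" "drop p (prods \<one> gs) = prods k (drop p gs)"
      using drop_prods[of p gs \<one>] gs by auto
    have "F' (map pt (drop p (prods \<one> gs))) = F' (map pt (prods \<one> (drop p gs)))"
      using inv_L_prods[OF F' k(1), of "drop p gs"] t k(2) by (simp add: tuples_def)
    then show ?thesis using True t
      by (simp add: cup_cochain_def bar_def hcup_def take_map drop_map take_prods)
  next
    case False then show ?thesis by (simp add: cup_cochain_def bar_def)
  qed
qed

subsection \<open>Cohomology classes\<close>

lemma cocycles_eq: "cocycles G n = bar n ` cocyc L n"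
proof -
  have "f \<in> cocycles G n \<longleftrightarrow> f \<in> bar n ` cocyc L n" for f
  proof
    assume f: "f \<in> cocycles G n"
    then have fc: "f \<in> carrier (cochain_group G n)" "coboundary_map G n f = \<one>\<^bsub>cochain_group G (Suc n)\<^esub>"
      by (auto simp: cocycles_def kernel_def)
    have "bar (Suc n) (codiff (unbar n f)) = bar (Suc n) 0"
      using coboundary_bar[OF unbar_inv, of n f] fc by (simp only: bar_unbar bar_0)
    then have "codiff (unbar n f) = 0"
      using bar_inj[OF inv_cochains_codiff[OF unbar_inv] inv_cochains_closed(1)] by blast
    then have "unbar n f \<in> cocyc L n" by (simp add: cocyc_def unbar_inv)
    then show "f \<in> bar n ` cocyc L n" using bar_unbar[OF fc(1)] by (metis image_eqI)
  next
    assume "f \<in> bar n ` cocyc L n"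
    then obtain F where F: "F \<in> cocyc L n" "f = bar n F" by blast
    then have "coboundary_map G n f = \<one>\<^bsub>cochain_group G (Suc n)\<^esub>"
      using coboundary_bar[of F n] by (simp add: cocyc_def bar_0)
    then show "f \<in> cocycles G n" using F bar_carrier by (auto simp: cocycles_def kernel_def)
  qed
  then show ?thesis by blast
qed

lemma coboundaries_eq: "coboundaries G n = bar n ` cobd L n"
proof (cases n)
  case 0 then show ?thesis by (simp add: bar_0 del: zero_fun_def[symmetric])
next
  case (Suc m)
  have "carrier (cochain_group G m) = bar m ` inv_cochains L m"
    using bar_unbar unbar_inv bar_carrier by (metis (no_types, lifting) image_eqI image_subsetI subsetI subset_antisym)
  then show ?thesis using Suc coboundary_bar by (auto simp: image_image)
qed

definition cls :: "nat \<Rightarrow> ('x list \<Rightarrow> int) \<Rightarrow> ('g list \<Rightarrow> int) set"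
  where "cls n F = coboundaries G n #>\<^bsub>cochain_group G n\<^esub> bar n F"

lemma cls_eq: 
  assumes F: "F \<in> cocyc L n"
  shows "cls n F = bar n ` {F'. F' - F \<in> cobd L n}"
proof -
  have "cls n F = (\<lambda>b. bar n (b + F)) ` cobd L n"
    by (auto simp: cls_def r_coset_def coboundaries_eq bar_add)
  also have "\<dots> = bar n ` ((\<lambda>b. b + F) ` cobd L n)" by (simp only: image_image)
  also have "(\<lambda>b. b + F) ` cobd L n = {F'. F' - F \<in> cobd L n}"
    by (auto simp: image_iff) (metis diff_add_cancel)
  finally show ?thesis .
qed

lemma cls_eq_iff:
  assumes F: "F \<in> cocyc L n" "F' \<in> cocyc L n"
  shows "cls n F = cls n F' \<longleftrightarrow> F - F' \<in> cobd L n"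
proof
  assume "cls n F = cls n F'"
  moreover have "bar n F \<in> cls n F" using cls_eq[OF F(1)] by (simp add: cobd_closed)
  ultimately obtain K where K: "K - F' \<in> cobd L n" "bar n F = bar n K" using cls_eq[OF F(2)] by auto
  have "K \<in> cocyc L n" using cocyc_closed(2)[OF cobd_cocyc[OF K(1)] F(2)] by simp
  then have "F = K" using bar_inj[OF cocyc_inv cocyc_inv] F K by metis
  then show "F - F' \<in> cobd L n" using K by simp
next
  assume d: "F - F' \<in> cobd L n"
  have "K - F \<in> cobd L n \<longleftrightarrow> K - F' \<in> cobd L n" for K
    using cobd_trans[OF _ d] cobd_trans[OF _ cobd_minus_commute[OF d]] by blast
  then show "cls n F = cls n F'" by (simp only: cls_eq[OF F(1)] cls_eq[OF F(2)])
qed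

lemma
  shows cohomology_carrier: "carrier (cohomology G n) = cls n ` cocyc L n"
    and cohomology_one: "\<one>\<^bsub>cohomology G n\<^esub> = cls n 0"
    and cohomology_mult: "F \<in> cocyc L n \<Longrightarrow> F' \<in> cocyc L n \<Longrightarrow> cls n F \<otimes>\<^bsub>cohomology G n\<^esub> cls n F' = cls n (F + F')"
    and cohomology_group: "comm_group (cohomology G n)"
proof -
  interpret C: comm_group "cochain_group G n" by (rule comm_group_cochain)
  have inv: "inv\<^bsub>cochain_group G n\<^esub> (bar n F) = bar n (- F)" for F
    by (rule C.inv_equality) (simp_all add: bar_add[symmetric] bar_0 bar_carrier)
  have neg: "- F \<in> cocyc L n" if "F \<in> cocyc L n" for F
    using cocyc_closed(4)[OF that, of "-1"] by simp
  have sub: "subgroup (cocycles G n) (cochain_group G n)"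
    unfolding cocycles_eq
    by (rule C.subgroupI) (auto simp: bar_carrier inv bar_add[symmetric] neg cocyc_closed intro!: imageI, auto intro: cocyc_closed)
  define K where "K = (cochain_group G n)\<lparr>carrier := cocycles G n\<rparr>"
  interpret K: comm_group K
    unfolding K_def using subgroup.subset[OF sub]
    by (intro group.group_comm_groupI C.subgroup_imp_group sub) (auto intro: C.m_comm)
  have Ksimps: "carrier K = cocycles G n" "x \<otimes>\<^bsub>K\<^esub> y = x \<otimes>\<^bsub>cochain_group G n\<^esub> y" "\<one>\<^bsub>K\<^esub> = \<one>\<^bsub>cochain_group G n\<^esub>" for x y
    by (simp_all add: K_def)
  have subB: "subgroup (coboundaries G n) (cochain_group G n)"
    unfolding coboundaries_eq
    by (rule C.subgroupI) (auto simp: bar_carrier inv bar_add[symmetric] cobd_uminus cobd_closed intro!: imageI, auto intro: cobd_closed)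
  have "coboundaries G n \<subseteq> cocycles G n" by (auto simp: coboundaries_eq cocycles_eq cobd_cocyc)
  then have subK: "subgroup (coboundaries G n) K"
    unfolding K_def by (rule C.subgroup_incl[OF subB sub])
  then have nK: "normal (coboundaries G n) K" by (rule K.subgroup_imp_normal)
  interpret nK: normal "coboundaries G n" K by (rule nK)
  have H: "cohomology G n = K Mod coboundaries G n" by (simp add: cohomology_def K_def)
  have cl: "coboundaries G n #>\<^bsub>K\<^esub> bar n F = cls n F" for F
    by (simp add: r_coset_def cls_def Ksimps)
  show "carrier (cohomology G n) = cls n ` cocyc L n"
    unfolding H FactGroup_def RCOSETS_def by (auto simp: Ksimps cocycles_eq cl)
  show "\<one>\<^bsub>cohomology G n\<^esub> = cls n 0"
    by (simp add: H FactGroup_def cls_def bar_0 C.coset_mult_one subB subgroup.subset del: zero_fun_def[symmetric])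
  show "cls n F \<otimes>\<^bsub>cohomology G n\<^esub> cls n F' = cls n (F + F')" if "F \<in> cocyc L n" "F' \<in> cocyc L n"
    using nK.rcos_sum[of "bar n F" "bar n F'"] that
    by (simp add: H FactGroup_def cl Ksimps cocycles_eq bar_add[symmetric])
  show "comm_group (cohomology G n)" unfolding H by (rule K.abelian_FactGroup[OF subK])
qed

lemma cls_carrier: "F \<in> cocyc L n \<Longrightarrow> cls n F \<in> carrier (cohomology G n)"
  by (simp add: cohomology_carrier)

lemma cls_eq_one_iff: "F \<in> cocyc L n \<Longrightarrow> cls n F = \<one>\<^bsub>cohomology G n\<^esub> \<longleftrightarrow> F \<in> cobd L n"
  using cls_eq_iff[of F n 0] by (simp add: cohomology_one cocyc_closed)

lemma cls_int_pow:
  assumes F: "F \<in> cocyc L n"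
  shows "cls n F [^]\<^bsub>cohomology G n\<^esub> (k::int) = cls n (of_int k * F)"
proof -
  interpret H: comm_group "cohomology G n" by (rule cohomology_group)
  define h where "h k = cls n (of_int k * F)" for k :: int
  have "h \<in> hom integer_group (cohomology G n)"
    using F by (auto simp: hom_def h_def cohomology_mult cocyc_closed cls_carrier distrib_right)
  then interpret h: group_hom integer_group "cohomology G n" h
    by (intro group_hom.intro group_hom_axioms.intro group_integer_group H.is_group)
  have "h (1 [^]\<^bsub>integer_group\<^esub> k) = h 1 [^]\<^bsub>cohomology G n\<^esub> k"
    by (rule h.hom_int_pow) (simp only: carrier_integer_group UNIV_I)
  then show ?thesis
    by (simp only: group_int_pow_integer_group mult_1_right h_def of_int_1 mult_1_left)
qed

lemma cup_cls:
  assumes F: "F \<in> cocyc L p" and F': "F' \<in> cocyc L q"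
  shows "cup G p q (cls p F) (cls q F') = cls (p + q) (hcup p F F')"
proof -
  have "coboundaries G (p + q) #>\<^bsub>cochain_group G (p + q)\<^esub> cup_cochain G p q f f' = cls (p + q) (hcup p F F')"
    if ff: "f \<in> cls p F" "f' \<in> cls q F'" for f f'
  proof -
    obtain E where E1: "f = bar p E" "E - F \<in> cobd L p" using ff(1) unfolding cls_eq[OF F] by blast
    obtain E' where E2: "f' = bar q E'" "E' - F' \<in> cobd L q" using ff(2) unfolding cls_eq[OF F'] by blast
    note E = E1 E2
    have c: "E \<in> cocyc L p" "E' \<in> cocyc L q"
      using cocyc_closed(2)[OF cobd_cocyc[OF E(2)] F] cocyc_closed(2)[OF cobd_cocyc[OF E(4)] F'] by simp_all
    have "hcup p E E' - hcup p F F' \<in> cobd L (p + q)"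
      by (rule hcup_cong_cobd[OF F E(2) F' E(4)])
    then have "cls (p + q) (hcup p E E') = cls (p + q) (hcup p F F')"
      using cls_eq_iff[OF cocyc_hcup[OF c] cocyc_hcup[OF F F']] by simp
    then show ?thesis unfolding E cup_bar[OF cocyc_inv[OF c(2)]] by (simp add: cls_def)
  qed
  then have "cup G p q (cls p F) (cls q F') = (\<Union>f\<in>cls p F. \<Union>f'\<in>cls q F'. cls (p + q) (hcup p F F'))"
    unfolding cup_def by (intro SUP_cong refl)
  moreover have "bar p F \<in> cls p F" "bar q F' \<in> cls q F'"
    unfolding cls_eq[OF F] cls_eq[OF F'] by (simp_all add: cobd_closed)
  then have "cls p F \<noteq> {}" "cls q F' \<noteq> {}" by auto
  ultimately show ?thesis by simp
qed

end

section \<open>Abelian groups with two independent generators\<close>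

text \<open>
  Says that \<open>H\<close> is the direct sum of \<open>\<langle>x\<rangle>\<close> of order \<open>A\<close> and \<open>\<langle>y\<rangle>\<close> of order \<open>B\<close>.
\<close>
definition basis2 :: "('g, 'm) monoid_scheme \<Rightarrow> 'g \<Rightarrow> 'g \<Rightarrow> nat \<Rightarrow> nat \<Rightarrow> bool"
  where "basis2 H x y A B \<longleftrightarrow> comm_group H \<and> x \<in> carrier H \<and> y \<in> carrier H \<and>
    (\<forall>z\<in>carrier H. \<exists>(k::int) (l::int). z = x [^]\<^bsub>H\<^esub> k \<otimes>\<^bsub>H\<^esub> y [^]\<^bsub>H\<^esub> l) \<and>
    (\<forall>(k::int) (l::int). x [^]\<^bsub>H\<^esub> k \<otimes>\<^bsub>H\<^esub> y [^]\<^bsub>H\<^esub> l = \<one>\<^bsub>H\<^esub> \<longleftrightarrow> int A dvd k \<and> int B dvd l)"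

lemma (in group) cyclic_subgroup_iso:
  assumes x: "x \<in> carrier G" and ord: "\<And>k::int. x [^] k = \<one> \<longleftrightarrow> int A dvd k" and A: "A > 0"
  shows "subgroup_generated G {x} \<cong> integer_mod_group A"
proof -
  have eq: "x [^] (k::int) = x [^] (l::int) \<longleftrightarrow> int A dvd k - l" for k l
    using ord[of "k - l"] x int_pow_diff[OF x, of k l]
    by (metis int_pow_closed inv_closed inv_equality inv_inv r_inv)
  have "(\<lambda>k::int. x [^] k) \<in> iso (integer_mod_group A) (subgroup_generated G {x})"
  proof (rule isoI)
    have m: "x [^] ((k + l) mod int A) = x [^] k \<otimes> x [^] l" for k l :: int
      using eq[of "(k + l) mod int A" "k + l"] int_pow_mult[OF x, of k l]
      by (simp add: mod_eq_dvd_iff[symmetric])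
    show "(\<lambda>k::int. x [^] k) \<in> hom (integer_mod_group A) (subgroup_generated G {x})"
      by (rule homI) (auto simp: carrier_subgroup_generated_by_singleton[OF x] m)
    have "inj_on (\<lambda>k::int. x [^] k) {0..<int A}"
    proof (rule inj_onI)
      fix k l assume "k \<in> {0..<int A}" "l \<in> {0..<int A}" "x [^] k = x [^] l"
      then show "k = l" using eq[of k l] by (simp add: mod_eq_dvd_iff[symmetric])
    qed
    moreover have "(\<lambda>k::int. x [^] k) ` {0..<int A} = range (\<lambda>k::int. x [^] k)"
    proof -
      have "x [^] k = x [^] (k mod int A)" for k :: int
        using eq[of k "k mod int A"] by (simp add: mod_eq_dvd_iff[symmetric])
      then have "x [^] k \<in> (\<lambda>k::int. x [^] k) ` {0..<int A}" for k :: int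
        using A by (metis atLeastLessThan_iff image_eqI of_nat_0_less_iff pos_mod_bound pos_mod_sign)
      then show ?thesis by auto
    qed
    ultimately show "bij_betw (\<lambda>k::int. x [^] k) (carrier (integer_mod_group A)) (carrier (subgroup_generated G {x}))"
      using A by (simp add: bij_betw_def carrier_integer_mod_group carrier_subgroup_generated_by_singleton[OF x])
  qed
  then have "integer_mod_group A \<cong> subgroup_generated G {x}" by (rule is_isoI)
  then show ?thesis by (rule group.iso_sym[OF group_integer_mod_group])
qed

locale basis2_group =
  fixes H :: "('g, 'm) monoid_scheme" (structure) and x y A B
  assumes basis: "basis2 H x y A B" and A: "A > 0" and B: "B > 0"
begin

sublocale comm_group H using basis by (simp add: basis2_def)

lemma gens [simp]: "x \<in> carrier H" "y \<in> carrier H" using basis by (auto simp: basis2_def)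

abbreviation w :: "int \<Rightarrow> int \<Rightarrow> 'g" where "w k l \<equiv> x [^] k \<otimes> y [^] l"

lemma w_surj: "z \<in> carrier H \<Longrightarrow> \<exists>k l. z = w k l"
  and w_one: "w k l = \<one> \<longleftrightarrow> int A dvd k \<and> int B dvd l"
  using basis by (auto simp: basis2_def)

lemma w_add: "w (k + k') (l + l') = w k l \<otimes> w k' l'"
  by (simp add: int_pow_mult m_ac)

lemma w_eq: "w k l = w k' l' \<longleftrightarrow> int A dvd k - k' \<and> int B dvd l - l'"
proof -
  have "w k l = w (k - k') (l - l') \<otimes> w k' l'" using w_add[of "k - k'" k' "l - l'" l'] by simp
  moreover have "w (k - k') (l - l') \<otimes> w k' l' = w k' l' \<longleftrightarrow> w (k - k') (l - l') = \<one>"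
    by (rule r_cancel_one) simp_all
  ultimately show ?thesis by (simp only: w_one)
qed

lemma iso_product: "H \<cong> integer_mod_group A \<times>\<times> integer_mod_group B"
proof -
  let ?P = "integer_mod_group A \<times>\<times> integer_mod_group B"
  let ?f = "\<lambda>(k, l). w k l"
  have m: "w ((k + k') mod int A) ((l + l') mod int B) = w k l \<otimes> w k' l'" for k l k' l'
    unfolding w_add[symmetric] w_eq by (simp add: mod_eq_dvd_iff[symmetric])
  have "?f \<in> iso ?P H"
  proof (rule isoI)
    show "?f \<in> hom ?P H" by (rule homI) (auto simp: m)
    have "inj_on ?f (carrier ?P)"
      using A B by (auto simp: inj_on_def carrier_integer_mod_group w_eq mod_eq_dvd_iff[symmetric])
    moreover have "?f ` carrier ?P = carrier H"
    proof
      show "carrier H \<subseteq> ?f ` carrier ?P"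
      proof
        fix z assume "z \<in> carrier H"
        then obtain k l where "z = w k l" using w_surj by blast
        also have "\<dots> = ?f (k mod int A, l mod int B)" by (simp add: w_eq mod_eq_dvd_iff[symmetric])
        finally show "z \<in> ?f ` carrier ?P" using A B by (auto simp: carrier_integer_mod_group)
      qed
    qed auto
    ultimately show "bij_betw ?f (carrier ?P) (carrier H)" by (simp add: bij_betw_def)
  qed
  then have "?P \<cong> H" by (rule is_isoI)
  then show ?thesis by (rule group.iso_sym[OF DirProd_group[OF group_integer_mod_group group_integer_mod_group]])
qed

lemma generate_basis: "generate H {x, y} = carrier H"
proof
  show "generate H {x, y} \<subseteq> carrier H" by (rule generate_incl) simp
  have sub: "subgroup (generate H {x, y}) H" by (rule generate_is_subgroup) simp
  show "carrier H \<subseteq> generate H {x, y}"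
  proof
    fix z assume "z \<in> carrier H"
    then obtain k l where z: "z = w k l" using w_surj by blast
    have "x \<in> generate H {x, y}" "y \<in> generate H {x, y}" by (auto intro: generate.incl)
    then show "z \<in> generate H {x, y}"
      unfolding z by (intro subgroup.m_closed[OF sub] subgroup_int_pow_closed[OF sub])
  qed
qed

lemma cyclic_x: "subgroup_generated H {x} \<cong> integer_mod_group A"
  using cyclic_subgroup_iso[OF gens(1) _ A] w_one[of _ 0] by simp

lemma cyclic_y: "subgroup_generated H {y} \<cong> integer_mod_group B"
  using cyclic_subgroup_iso[OF gens(2) _ B] w_one[of 0] by simp

end

lemma basis2_hom_iso:
  assumes H: "basis2_group H x y A B" and H': "basis2_group H' x' y' A B"
    and f: "f \<in> hom H H'" "f x = x'" "f y = y'"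
  shows "f \<in> iso H H'"
proof -
  interpret H: basis2_group H x y A B by (rule H)
  interpret H': basis2_group H' x' y' A B by (rule H')
  interpret f: group_hom H H' f
    by (intro group_hom.intro group_hom_axioms.intro H.is_group H'.is_group f)
  have fw: "f (H.w k l) = H'.w k l" for k l
    by (simp add: f.hom_int_pow f)
  show ?thesis
  proof (rule isoI[OF f(1)])
    have "inj_on f (carrier H)"
    proof (rule inj_onI)
      fix u v assume uv: "u \<in> carrier H" "v \<in> carrier H" "f u = f v"
      obtain k l where u: "u = H.w k l" using H.w_surj[OF uv(1)] by blast
      obtain k' l' where v: "v = H.w k' l'" using H.w_surj[OF uv(2)] by blast
      have "H'.w k l = H'.w k' l'" using uv(3) unfolding u v fw .
      then show "u = v" unfolding u v H.w_eq H'.w_eq .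
    qed
    moreover have "carrier H' \<subseteq> f ` carrier H"
    proof
      fix z assume "z \<in> carrier H'"
      then obtain k l where "z = H'.w k l" using H'.w_surj by blast
      then have "z = f (H.w k l)" by (simp only: fw)
      then show "z \<in> f ` carrier H"
        by (rule image_eqI) (intro H.m_closed H.int_pow_closed H.gens)
    qed
    moreover have "f ` carrier H \<subseteq> carrier H'" by auto
    ultimately show "bij_betw f (carrier H) (carrier H')" by (simp add: bij_betw_def subset_antisym)
  qed
qed

lemma infinite_cyclic:
  assumes H: "group H" and x: "x \<in> carrier H"
    and surj: "\<And>z. z \<in> carrier H \<Longrightarrow> \<exists>k::int. z = x [^]\<^bsub>H\<^esub> k"
    and inj: "\<And>k::int. x [^]\<^bsub>H\<^esub> k = \<one>\<^bsub>H\<^esub> \<Longrightarrow> k = 0"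
  shows "H \<cong> integer_group" "generate H {x} = carrier H"
proof -
  interpret group H by (rule H)
  have c: "carrier H = range (\<lambda>k::int. x [^]\<^bsub>H\<^esub> k)" using surj x by auto
  have "inj (\<lambda>k::int. x [^]\<^bsub>H\<^esub> k)"
  proof (rule injI)
    fix k l :: int assume "x [^]\<^bsub>H\<^esub> k = x [^]\<^bsub>H\<^esub> l"
    then have "x [^]\<^bsub>H\<^esub> (k - l) = \<one>\<^bsub>H\<^esub>" using x by (simp add: int_pow_diff)
    then show "k = l" using inj[of "k - l"] by simp
  qed
  then have "(\<lambda>k::int. x [^]\<^bsub>H\<^esub> k) \<in> iso integer_group H"
    using hom_integer_group_pow[OF x] c by (intro isoI) (auto simp: bij_betw_def)
  then show "H \<cong> integer_group" by (rule group.iso_sym[OF group_integer_group is_isoI])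
  have sub: "subgroup (generate H {x}) H" using x by (intro generate_is_subgroup) simp
  have "x \<in> generate H {x}" by (auto intro: generate.incl)
  then show "generate H {x} = carrier H"
    using subgroup_int_pow_closed[OF sub] generate_incl[of "{x}"] x by (auto simp: c)
qed

section \<open>Semidirect products\<close>

lemma auto_closed: "f \<in> auto M \<Longrightarrow> u \<in> carrier M \<Longrightarrow> f u \<in> carrier M"
  and auto_mult: "f \<in> auto M \<Longrightarrow> u \<in> carrier M \<Longrightarrow> u' \<in> carrier M \<Longrightarrow> f (u \<otimes>\<^bsub>M\<^esub> u') = f u \<otimes>\<^bsub>M\<^esub> f u'"
  and auto_bij: "f \<in> auto M \<Longrightarrow> bij_betw f (carrier M) (carrier M)"
  by (auto simp: auto_def hom_def Bij_def)

locale semidirect = M: group M + K: group K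
  for M :: "('a, 'm) monoid_scheme" and K :: "('b, 'n) monoid_scheme" +
  fixes act :: "'b \<Rightarrow> 'a \<Rightarrow> 'a"
  assumes act: "act \<in> hom K (AutoGroup M)"
begin

abbreviation "P \<equiv> semidirect_product M K act"

lemma act_auto: "v \<in> carrier K \<Longrightarrow> act v \<in> auto M"
  using hom_in_carrier[OF act] by (simp add: AutoGroup_def)

lemma act_closed: "v \<in> carrier K \<Longrightarrow> u \<in> carrier M \<Longrightarrow> act v u \<in> carrier M"
  by (rule auto_closed[OF act_auto])

lemma act_hom: "v \<in> carrier K \<Longrightarrow> u \<in> carrier M \<Longrightarrow> u' \<in> carrier M \<Longrightarrow> act v (u \<otimes>\<^bsub>M\<^esub> u') = act v u \<otimes>\<^bsub>M\<^esub> act v u'"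
  by (rule auto_mult[OF act_auto])

lemma act_one_right: "v \<in> carrier K \<Longrightarrow> act v \<one>\<^bsub>M\<^esub> = \<one>\<^bsub>M\<^esub>"
  using act_auto[of v] hom_one[of "act v" M M] by (simp add: auto_def M.is_group)

lemma act_mult: "v \<in> carrier K \<Longrightarrow> v' \<in> carrier K \<Longrightarrow> u \<in> carrier M \<Longrightarrow> act (v \<otimes>\<^bsub>K\<^esub> v') u = act v (act v' u)"
  using hom_mult[OF act, of v v'] act_auto[of v] act_auto[of v']
  by (simp add: AutoGroup_def BijGroup_def auto_def compose_def)

lemma act_one: "u \<in> carrier M \<Longrightarrow> act \<one>\<^bsub>K\<^esub> u = u"
  using hom_one[OF act K.is_group M.AutoGroup] by (simp add: AutoGroup_def BijGroup_def)

lemma P_simps [simp]: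
  "carrier P = carrier M \<times> carrier K"
  "(u, v) \<otimes>\<^bsub>P\<^esub> (u', v') = (u \<otimes>\<^bsub>M\<^esub> act v u', v \<otimes>\<^bsub>K\<^esub> v')"
  "\<one>\<^bsub>P\<^esub> = (\<one>\<^bsub>M\<^esub>, \<one>\<^bsub>K\<^esub>)"
  by (simp_all add: semidirect_product_def)

lemma group_P: "group P"
proof (rule groupI)
  fix z assume "z \<in> carrier P"
  then obtain u v where z: "z = (u, v)" "u \<in> carrier M" "v \<in> carrier K" by auto
  have "(act (inv\<^bsub>K\<^esub> v) (inv\<^bsub>M\<^esub> u), inv\<^bsub>K\<^esub> v) \<otimes>\<^bsub>P\<^esub> z = \<one>\<^bsub>P\<^esub>"
    using z by (simp add: act_hom[symmetric] act_one_right)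
  moreover have "(act (inv\<^bsub>K\<^esub> v) (inv\<^bsub>M\<^esub> u), inv\<^bsub>K\<^esub> v) \<in> carrier P"
    using z by (simp add: act_closed)
  ultimately show "\<exists>z'\<in>carrier P. z' \<otimes>\<^bsub>P\<^esub> z = \<one>\<^bsub>P\<^esub>" by blast
qed (auto simp: act_closed act_one act_hom act_mult M.m_assoc K.m_assoc)

end

section \<open>Orders in the unit group of the integers modulo m\<close>

text \<open>
  An element without finite order would have order zero by convention; Euler's theorem provides an
  exponent.
\<close>
lemma ord_ZMod:
  fixes m x :: int
  assumes m: "m > 0" and x: "coprime x m"
  defines "k \<equiv> group.ord (units_of (ZFact m)) (ZMod m x)"
  shows "k > 0" "[x ^ k = 1] (mod m)"
proof -
  interpret I: ideal "Idl\<^bsub>\<Z>\<^esub> {m}" \<Z> by (rule int.genideal_ideal) simp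
  interpret R: cring "ZFact m" by (rule ZFact_is_cring)
  interpret U: group "units_of (ZFact m)" by (rule R.units_group)
  have mult: "ZMod m u \<otimes>\<^bsub>ZFact m\<^esub> ZMod m v = ZMod m (u * v)" for u v
    using I.rcoset_mult_add[of u v] by (simp add: ZFact_def FactRing_def ZMod_def)
  have one: "\<one>\<^bsub>ZFact m\<^esub> = ZMod m 1" by (simp add: ZFact_def FactRing_def ZMod_def)
  have car: "ZMod m u \<in> carrier (ZFact m)" for u
    by (auto simp: ZFact_def FactRing_def ZMod_def A_RCOSETS_def')
  \<comment> \<open>An inverse modulo \<open>m\<close> shows that \<open>x\<close> represents a unit.\<close>
  obtain x' where "[x * x' = 1] (mod m)" using cong_solve_coprime_int[OF x] by blast
  then have inv: "ZMod m (x * x') = ZMod m 1" by (simp add: ZMod_eq_mod cong_def)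
  then have "ZMod m x \<in> Units (ZFact m)"
    unfolding Units_def using car mult one by (auto simp: mult.commute intro!: bexI[of _ "ZMod m x'"])
  then have xc: "ZMod m x \<in> carrier (units_of (ZFact m))" by (simp add: units_of_def)
  have pow: "ZMod m x [^]\<^bsub>units_of (ZFact m)\<^esub> n = ZMod m (x ^ n)" for n :: nat
    by (induction n) (simp_all add: units_of_def one mult mult.commute nat_pow_def)
  have pow_one: "ZMod m x [^]\<^bsub>units_of (ZFact m)\<^esub> n = \<one>\<^bsub>units_of (ZFact m)\<^esub> \<longleftrightarrow> [x ^ n = 1] (mod m)" for n :: nat
    unfolding pow by (simp add: units_of_def one ZMod_eq_mod cong_def)
  show "[x ^ k = 1] (mod m)" using U.pow_ord_eq_1[OF xc] pow_one by (simp add: k_def)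
  define u where "u = nat (x mod m)"
  have u: "int u = x mod m" using m by (simp add: u_def)
  then have "coprime (int u) (int (nat m))" using x m by (simp add: coprime_mod_left_iff)
  then have "coprime u (nat m)" by (simp only: coprime_int_iff)
  then have "[u ^ totient (nat m) = 1] (mod (nat m))" by (rule euler_theorem)
  then have "[int u ^ totient (nat m) = 1] (mod m)" using m by (simp add: cong_int_iff[symmetric])
  then have "[x ^ totient (nat m) = 1] (mod m)" by (simp add: u cong_def power_mod)
  then have "k dvd totient (nat m)" using U.pow_eq_id[OF xc] pow_one by (simp add: k_def)
  then show "k > 0" using m by (metis dvd_0_left_iff gr0I totient_0_iff nat_eq_iff2 not_less_iff_gr_or_eq zero_less_nat_eq)
qed

section \<open>The group as a group of substitutions\<close>

locale metacyclic_data =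
  fixes a b :: nat and r c ca cb :: int
    and \<alpha> :: "int \<Rightarrow> int \<Rightarrow> int" and \<theta> :: "int \<Rightarrow> int \<times> int \<Rightarrow> int \<times> int"
  assumes a_pos: "a > 0" and b_pos: "b > 0" and coprime_ab: "coprime a b"
    and r_b: "[r ^ b = 1] (mod int a)"
    and \<alpha>_hom: "\<alpha> \<in> hom (integer_mod_group b) (AutoGroup (integer_mod_group a))"
    and \<alpha>_gen: "\<alpha> (1 mod int b) (1 mod int a) = r mod int a"
    and \<theta>_hom: "\<theta> \<in> hom integer_group
          (AutoGroup (semidirect_product (integer_mod_group a) (integer_mod_group b) \<alpha>))"
    and \<theta>_a: "\<theta> 1 (1 mod int a, 0) = (ca mod int a, 0)"
    and \<theta>_b: "\<theta> 1 (0, 1 mod int b) = (c mod int a, cb mod int b)"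
begin

sublocale N: semidirect "integer_mod_group a" "integer_mod_group b" \<alpha>
  by (intro semidirect.intro semidirect_axioms.intro group_integer_mod_group \<alpha>_hom)

sublocale G: semidirect N.P integer_group \<theta>
  by (intro semidirect.intro semidirect_axioms.intro group_integer_group N.group_P \<theta>_hom)

abbreviation "GG \<equiv> G.P"

lemma carrier_GG: "g \<in> carrier GG \<longleftrightarrow> (\<exists>u v k. g = ((u, v), k) \<and> 0 \<le> u \<and> u < int a \<and> 0 \<le> v \<and> v < int b)"
  using a_pos b_pos by (cases g; cases "fst g") (auto simp: carrier_integer_mod_group)

lemma in_a: "0 \<le> x mod int a" "x mod int a < int a" and in_b: "0 \<le> x mod int b" "x mod int b < int b"
  using a_pos b_pos by auto

lemma N_mem: "(u, v) \<in> carrier N.P \<longleftrightarrow> 0 \<le> u \<and> u < int a \<and> 0 \<le> v \<and> v < int b"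
  using a_pos b_pos by (simp add: carrier_integer_mod_group)

lemma a_mem: "u \<in> carrier (integer_mod_group a) \<longleftrightarrow> 0 \<le> u \<and> u < int a"
  and b_mem: "v \<in> carrier (integer_mod_group b) \<longleftrightarrow> 0 \<le> v \<and> v < int b"
  using a_pos b_pos by (simp_all add: carrier_integer_mod_group)

lemma \<alpha>_0: "0 \<le> u \<Longrightarrow> u < int a \<Longrightarrow> \<alpha> 0 u = u"
  using N.act_one[of u] by (simp add: a_mem)

lemma \<alpha>_zero_right: "0 \<le> v \<Longrightarrow> v < int b \<Longrightarrow> \<alpha> v 0 = 0"
  using N.act_one_right[of v] by (simp add: b_mem)

lemma \<alpha>_1: "0 \<le> u \<Longrightarrow> u < int a \<Longrightarrow> \<alpha> (1 mod int b) u = r * u mod int a"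
proof -
  have "\<alpha> (1 mod int b) (int n mod int a) = r * int n mod int a" for n
  proof (induction n)
    case 0 then show ?case using \<alpha>_zero_right[of "1 mod int b"] in_b[of 1] by simp
  next
    case (Suc n)
    have "int (Suc n) mod int a = 1 mod int a \<otimes>\<^bsub>integer_mod_group a\<^esub> (int n mod int a)"
      by (simp add: mod_add_eq)
    also have "\<alpha> (1 mod int b) \<dots> = \<alpha> (1 mod int b) (1 mod int a) \<otimes>\<^bsub>integer_mod_group a\<^esub> \<alpha> (1 mod int b) (int n mod int a)"
      by (rule N.act_hom) (simp_all add: a_mem b_mem in_a in_b)
    finally show ?case by (simp add: \<alpha>_gen Suc mod_simps algebra_simps)
  qed
  from this[of "nat u"] show "0 \<le> u \<Longrightarrow> u < int a \<Longrightarrow> ?thesis" by simp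
qed

lemma \<theta>_0: "z \<in> carrier N.P \<Longrightarrow> \<theta> 0 z = z"
  using G.act_one[of z] by simp

lemma \<theta>_1_a: "0 \<le> u \<Longrightarrow> u < int a \<Longrightarrow> \<theta> 1 (u, 0) = (ca * u mod int a, 0)"
proof -
  have "\<theta> 1 (int n mod int a, 0) = (ca * int n mod int a, 0)" for n
  proof (induction n)
    case 0 then show ?case using G.act_one_right[of 1] by simp
  next
    case (Suc n)
    have "(int (Suc n) mod int a, 0) = (1 mod int a, 0) \<otimes>\<^bsub>N.P\<^esub> (int n mod int a, 0)"
      by (simp add: mod_add_eq \<alpha>_0 in_a)
    also have "\<theta> 1 \<dots> = \<theta> 1 (1 mod int a, 0) \<otimes>\<^bsub>N.P\<^esub> \<theta> 1 (int n mod int a, 0)"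
      by (rule G.act_hom) (simp_all only: N_mem in_a in_b carrier_integer_group UNIV_I, use b_pos in simp_all)
    finally show ?case by (simp add: \<theta>_a Suc \<alpha>_0 in_a mod_simps algebra_simps)
  qed
  from this[of "nat u"] show "0 \<le> u \<Longrightarrow> u < int a \<Longrightarrow> ?thesis" by simp
qed

lemma \<theta>_1_b: "0 \<le> v \<Longrightarrow> v < int b \<Longrightarrow> snd (\<theta> 1 (0, v)) = cb * v mod int b"
proof -
  have "snd (\<theta> 1 (0, int n mod int b)) = cb * int n mod int b" for n
  proof (induction n)
    case 0 then show ?case using G.act_one_right[of 1] by simp
  next
    case (Suc n)
    have "(0, int (Suc n) mod int b) = (0, 1 mod int b) \<otimes>\<^bsub>N.P\<^esub> (0, int n mod int b)"
      by (simp add: mod_add_eq \<alpha>_zero_right in_b)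
    also have "\<theta> 1 \<dots> = \<theta> 1 (0, 1 mod int b) \<otimes>\<^bsub>N.P\<^esub> \<theta> 1 (0, int n mod int b)"
      by (rule G.act_hom) (simp_all only: N_mem in_a in_b carrier_integer_group UNIV_I, use a_pos in simp_all)
    finally show ?case
      by (cases "\<theta> 1 (0, int n mod int b)") (use Suc in \<open>simp add: \<theta>_b mod_simps algebra_simps\<close>)
  qed
  from this[of "nat v"] show "0 \<le> v \<Longrightarrow> v < int b \<Longrightarrow> ?thesis" by simp
qed

text \<open>
  The \<open>\<int>\<^sub>a\<close> component of \<open>\<theta>(1)\<close> on \<open>\<int>\<^sub>b\<close>. Being a function of the \<open>\<int>\<^sub>b\<close> coordinate, it is
  invariant under \<open>\<int>\<^sub>a\<close>, and so drops out of the action of \<open>t\<close> on cohomology classes of \<open>\<int>\<^sub>a\<close>.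
\<close>
definition twist :: "int \<Rightarrow> int" where "twist v = fst (\<theta> 1 (0, v))"

lemma \<theta>_1:
  assumes "0 \<le> u" "u < int a" "0 \<le> v" "v < int b"
  shows "\<theta> 1 (u, v) = ((ca * u + twist v) mod int a, cb * v mod int b)"
proof -
  have "(0, v) \<in> carrier N.P" using assms a_pos by (simp only: N_mem) simp
  then have "\<theta> 1 (0, v) \<in> carrier N.P" by (intro G.act_closed) simp_all
  then obtain w w' where w: "\<theta> 1 (0, v) = (w, w')" "0 \<le> w" "w < int a" by (cases "\<theta> 1 (0, v)") (auto simp: N_mem simp del: N.P_simps)
  have "(u, v) = (u, 0) \<otimes>\<^bsub>N.P\<^esub> (0, v)" using assms a_pos by (simp add: \<alpha>_0)
  also have "\<theta> 1 \<dots> = \<theta> 1 (u, 0) \<otimes>\<^bsub>N.P\<^esub> \<theta> 1 (0, v)"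
    by (rule G.act_hom) (use assms a_pos b_pos in \<open>simp_all only: N_mem carrier_integer_group UNIV_I\<close>, simp_all)
  finally show ?thesis
    using \<theta>_1_b[OF assms(3,4)] assms w by (simp add: \<theta>_1_a \<alpha>_0 twist_def mod_simps)
qed

lemma coprime_r: "coprime r (int a)"
proof -
  have "[r * r ^ (b - 1) = 1] (mod int a)" using r_b b_pos by (simp flip: power_Suc)
  then show ?thesis using coprime_iff_invertible_int by blast
qed

text \<open>
  Surjectivity of \<open>\<theta>(1)\<close> inverts \<open>c\<^sub>b\<close> on the quotient \<open>\<int>\<^sub>b\<close>. Then a preimage of \<open>1\<^sub>a\<close> has to lie
  in \<open>\<int>\<^sub>a\<close>, which inverts \<open>c\<^sub>a\<close>.
\<close>
lemma coprime_cb: "coprime cb (int b)" and coprime_ca: "coprime ca (int a)"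
proof -
  have surj: "\<exists>u v. 0 \<le> u \<and> u < int a \<and> 0 \<le> v \<and> v < int b \<and> \<theta> 1 (u, v) = z" if "z \<in> carrier N.P" for z
  proof -
    have "bij_betw (\<theta> 1) (carrier N.P) (carrier N.P)" by (intro auto_bij G.act_auto) simp
    then have "z \<in> \<theta> 1 ` carrier N.P" using that bij_betw_imp_surj_on by blast
    then obtain z' where "z' \<in> carrier N.P" "\<theta> 1 z' = z" by blast
    then show ?thesis by (cases z') (auto simp: N_mem simp del: N.P_simps)
  qed
  have "(0, 1 mod int b) \<in> carrier N.P" "(1 mod int a, 0) \<in> carrier N.P"
    using a_pos b_pos in_a in_b by (simp_all only: N_mem) simp_all
  note surj[OF this(1)] surj[OF this(2)]
  then obtain u v u' v' where v: "0 \<le> u" "u < int a" "0 \<le> v" "v < int b" "\<theta> 1 (u, v) = (0, 1 mod int b)"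
    and u': "0 \<le> u'" "u' < int a" "0 \<le> v'" "v' < int b" "\<theta> 1 (u', v') = (1 mod int a, 0)"
    by blast
  have "[cb * v = 1] (mod int b)" using \<theta>_1[OF v(1-4)] v(5) by (simp add: cong_def)
  then show cb: "coprime cb (int b)" using coprime_iff_invertible_int by blast
  have "int b dvd cb * v'" using \<theta>_1[OF u'(1-4)] u'(5) by (simp add: dvd_eq_mod_eq_0)
  then have "int b dvd v'" using cb by (simp add: coprime_dvd_mult_right_iff coprime_commute)
  then have "v' = 0" using u' zdvd_not_zless[of v' "int b"] by (cases "v' = 0") auto
  then have "[ca * u' = 1] (mod int a)" using \<theta>_1_a[OF u'(1,2)] u'(5) by (simp add: cong_def)
  then show "coprime ca (int a)" using coprime_iff_invertible_int by blast
qed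

subsection \<open>Enumerating the group\<close>

definition enum :: "nat \<Rightarrow> (int \<times> int) \<times> int"
  where "enum = from_nat_into (carrier GG)"

sublocale bar_model GG enum
proof (intro bar_model.intro G.group_P bar_model_axioms.intro)
  have "inj (\<lambda>k::int. ((0::int, 0::int), k))" by (auto simp: inj_def)
  then have "infinite (range (\<lambda>k::int. ((0::int, 0::int), k)))" using finite_imageD infinite_UNIV_int by blast
  moreover have "range (\<lambda>k::int. ((0::int, 0::int), k)) \<subseteq> carrier GG" using a_pos b_pos by (auto simp: carrier_GG)
  ultimately have "infinite (carrier GG)" using finite_subset by blast
  then show "bij_betw enum UNIV (carrier GG)"
    unfolding enum_def by (intro bij_betw_from_nat_into) auto
qed

lemma enum_cases:
  obtains u v k where "enum x = ((u, v), k)" "0 \<le> u" "u < int a" "0 \<le> v" "v < int b"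
  using e_carrier[of x] unfolding carrier_GG by blast

lemma lact_comp: "g \<in> carrier GG \<Longrightarrow> h \<in> carrier GG \<Longrightarrow> lact g \<circ> lact h = lact (g \<otimes>\<^bsub>GG\<^esub> h)"
  using e_carrier m_assoc unfolding lact_def by (auto simp: fun_eq_iff simp del: G.P_simps)

lemma lact_one: "lact \<one>\<^bsub>GG\<^esub> = id"
  using e_carrier unfolding lact_def by (auto simp: fun_eq_iff simp del: G.P_simps)

abbreviation "elt u v k \<equiv> ((u, v), k)"

definition left_s :: "nat \<Rightarrow> nat" where "left_s = lact (elt (1 mod int a) 0 0)"
definition left_y :: "nat \<Rightarrow> nat" where "left_y = lact (elt 0 (1 mod int b) 0)"
definition left_t :: "nat \<Rightarrow> nat" where "left_t = lact (elt 0 0 1)"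

lemma mem [simp]: "elt (u mod int a) (v mod int b) k \<in> carrier GG"
    "elt 0 (v mod int b) k \<in> carrier GG" "elt (u mod int a) 0 k \<in> carrier GG" "elt 0 0 k \<in> carrier GG"
  unfolding carrier_GG using a_pos b_pos by auto

lemma one_GG: "\<one>\<^bsub>GG\<^esub> = elt 0 0 0" by simp

lemma s_mult: "0 \<le> u \<Longrightarrow> u < int a \<Longrightarrow> 0 \<le> v \<Longrightarrow> v < int b \<Longrightarrow>
    elt (n mod int a) 0 0 \<otimes>\<^bsub>GG\<^esub> elt u v k = elt ((n + u) mod int a) v k"
  by (simp add: \<theta>_0 N_mem[simplified] \<alpha>_0 mod_simps a_mem b_mem)

lemma y_mult: "0 \<le> u \<Longrightarrow> u < int a \<Longrightarrow> 0 \<le> v \<Longrightarrow> v < int b \<Longrightarrow>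
    elt 0 (1 mod int b) 0 \<otimes>\<^bsub>GG\<^esub> elt u v k = elt (r * u mod int a) ((1 + v) mod int b) k"
  by (simp add: \<theta>_0 \<alpha>_1 mod_simps a_mem b_mem)

lemma y_mult_0: "0 \<le> v \<Longrightarrow> v < int b \<Longrightarrow>
    elt 0 (n mod int b) 0 \<otimes>\<^bsub>GG\<^esub> elt 0 v k = elt 0 ((n + v) mod int b) k"
  using a_pos by (simp add: \<theta>_0 \<alpha>_zero_right in_b mod_simps a_mem b_mem)

lemma t_mult: "0 \<le> u \<Longrightarrow> u < int a \<Longrightarrow> 0 \<le> v \<Longrightarrow> v < int b \<Longrightarrow>
    elt 0 0 1 \<otimes>\<^bsub>GG\<^esub> elt u v k = elt ((ca * u + twist v) mod int a) (cb * v mod int b) (k + 1)"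
  by (simp add: \<theta>_1 \<alpha>_0 in_a)

lemma word_mult_t: "0 \<le> u \<Longrightarrow> u < int a \<Longrightarrow> 0 \<le> v \<Longrightarrow> v < int b \<Longrightarrow>
    elt u v 0 \<otimes>\<^bsub>GG\<^esub> elt 0 0 k = elt u v k"
  using a_pos b_pos by (simp add: \<theta>_0 \<alpha>_zero_right a_mem b_mem)

lemma s_pow: "left_s ^^ n = lact (elt (int n mod int a) 0 0)"
proof (induction n)
  case 0 then show ?case using lact_one unfolding one_GG by simp
next
  case (Suc n)
  then show ?case using a_pos b_pos in_a by (simp add: left_s_def lact_comp s_mult mod_simps del: G.P_simps)
qed

lemma y_pow: "left_y ^^ n = lact (elt 0 (int n mod int b) 0)"
proof (induction n)
  case 0 then show ?case using lact_one unfolding one_GG by simp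
next
  case (Suc n)
  then show ?case using b_pos in_b by (simp add: left_y_def lact_comp y_mult_0 mod_simps del: G.P_simps)
qed

lemma t_pow: "left_t ^^ n = lact (elt 0 0 (int n))"
proof (induction n)
  case 0 then show ?case using lact_one unfolding one_GG by simp
next
  case (Suc n)
  have "\<theta> 1 (0, 0) = (0, 0)" using G.act_one_right[of 1] by simp
  then have "elt 0 0 1 \<otimes>\<^bsub>GG\<^esub> elt 0 0 (int n) = elt 0 0 (int (Suc n))"
    using a_pos by (simp add: \<alpha>_0)
  then show ?case using Suc by (simp add: left_t_def lact_comp del: G.P_simps)
qed

lemma word: "0 \<le> u \<Longrightarrow> u < int a \<Longrightarrow> 0 \<le> v \<Longrightarrow> v < int b \<Longrightarrow> (left_s ^^ nat u) \<circ> (left_y ^^ nat v) = lact (elt u v 0)"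
proof -
  assume uv: "0 \<le> u" "u < int a" "0 \<le> v" "v < int b"
  have "(left_s ^^ nat u) \<circ> (left_y ^^ nat v) = lact (elt (u mod int a) 0 0 \<otimes>\<^bsub>GG\<^esub> elt 0 (v mod int b) 0)"
  proof -
    have "elt u 0 0 \<in> carrier GG" "elt 0 v 0 \<in> carrier GG" unfolding carrier_GG using uv by auto
    then show ?thesis unfolding s_pow y_pow using uv by (simp add: lact_comp del: G.P_simps)
  qed
  also have "elt (u mod int a) 0 0 \<otimes>\<^bsub>GG\<^esub> elt 0 (v mod int b) 0 = elt u v 0"
    using uv a_pos by (subst s_mult) simp_all
  finally show ?thesis .
qed

definition a_of :: "nat \<Rightarrow> int" where "a_of x = fst (fst (enum x))"
definition b_of :: "nat \<Rightarrow> int" where "b_of x = snd (fst (enum x))"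
definition t_of :: "nat \<Rightarrow> int" where "t_of x = snd (enum x)"

lemma coord_s: "a_of (left_s x) = (a_of x + 1) mod int a" "b_of (left_s x) = b_of x" "t_of (left_s x) = t_of x"
  by (cases x rule: enum_cases; simp add: a_of_def b_of_def t_of_def left_s_def s_mult add.commute del: G.P_simps)+

lemma coord_y: "a_of (left_y x) = r * a_of x mod int a" "b_of (left_y x) = (b_of x + 1) mod int b" "t_of (left_y x) = t_of x"
  by (cases x rule: enum_cases; simp add: a_of_def b_of_def t_of_def left_y_def y_mult add.commute del: G.P_simps)+

lemma coord_t: "a_of (left_t x) = (ca * a_of x + twist (b_of x)) mod int a" "b_of (left_t x) = cb * b_of x mod int b" "t_of (left_t x) = t_of x + 1"
  by (cases x rule: enum_cases; simp add: a_of_def b_of_def t_of_def left_t_def t_mult del: G.P_simps)+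

lemma coord_bounds: "0 \<le> a_of x" "a_of x < int a" "0 \<le> b_of x" "b_of x < int b"
  by (cases x rule: enum_cases; simp add: a_of_def b_of_def)+

lemma t_past_word: 
  assumes "0 \<le> u" "u < int a" "0 \<le> v" "v < int b"
  shows "left_t \<circ> lact (elt u v 0) = lact (elt ((ca * u + twist v) mod int a) (cb * v mod int b) 0) \<circ> left_t"
proof -
  have m: "elt u v 0 \<in> carrier GG" unfolding carrier_GG using assms by auto
  show ?thesis unfolding left_t_def
    using assms m by (subst (1 2) lact_comp) (simp_all add: t_mult word_mult_t in_a in_b del: G.P_simps)
qed

text \<open>
  The automorphism \<open>\<theta>(-1)\<close> turns the word into the one that appears to the right of \<open>t\<close>.
\<close>
lemma word_past_t:
  assumes "0 \<le> u" "u < int a" "0 \<le> v" "v < int b"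
  shows "\<exists>i j. lact (elt u v 0) \<circ> left_t = left_t \<circ> ((left_s ^^ i) \<circ> (left_y ^^ j))"
proof -
  have m: "(u, v) \<in> carrier N.P" unfolding N_mem using assms by blast
  have "\<theta> (-1) (u, v) \<in> carrier N.P" by (intro G.act_closed m) simp
  then obtain u' v' where w: "\<theta> (-1) (u, v) = (u', v')" "0 \<le> u'" "u' < int a" "0 \<le> v'" "v' < int b"
    by (cases "\<theta> (-1) (u, v)") (auto simp: N_mem simp del: N.P_simps)
  have "\<theta> 1 (\<theta> (-1) (u, v)) = \<theta> (1 \<otimes>\<^bsub>integer_group\<^esub> (-1)) (u, v)"
    by (rule G.act_mult[symmetric]) (simp_all add: m del: N.P_simps)
  then have "\<theta> 1 (u', v') = (u, v)" using w \<theta>_0[OF m] by simp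
  then have "elt 0 0 1 \<otimes>\<^bsub>GG\<^esub> elt u' v' 0 = elt u v 1" using t_mult[OF w(2-5), of 0] \<theta>_1[OF w(2-5)] by simp
  moreover have "elt u v 0 \<otimes>\<^bsub>GG\<^esub> elt 0 0 1 = elt u v 1" by (rule word_mult_t[OF assms])
  moreover have "elt u v 0 \<in> carrier GG" "elt u' v' 0 \<in> carrier GG"
    unfolding carrier_GG using assms w by auto
  ultimately have "lact (elt u v 0) \<circ> left_t = left_t \<circ> lact (elt u' v' 0)"
    unfolding left_t_def by (simp add: lact_comp del: G.P_simps)
  then show ?thesis using word[OF w(2-5)] by metis
qed

sublocale metacyclic_by_Z left_s left_y a b a_of b_of left_t t_of "\<lambda>x. twist (b_of x)" r ca cb "nat (r mod int a)"
proof unfold_locales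
  show "0 < a" "0 < b" "coprime a b" by (fact a_pos b_pos coprime_ab)+
  show "left_s ^^ a = id" "left_y ^^ b = id" by (simp_all add: s_pow y_pow lact_one[unfolded one_GG])
  show "0 \<le> a_of x" "a_of x < int a" "0 \<le> b_of x" "b_of x < int b" for x by (rule coord_bounds)+
  show "a_of (left_s x) = (a_of x + 1) mod int a" "b_of (left_y x) = (b_of x + 1) mod int b" "b_of (left_s x) = b_of x"
    "t_of (left_s x) = t_of x" "t_of (left_y x) = t_of x" "t_of (left_t x) = t_of x + 1" "twist (b_of (left_s x)) = twist (b_of x)" for x
    by (simp_all add: coord_s coord_y coord_t)
  show "[a_of (left_y x) = r * a_of x] (mod int a)" "[a_of (left_t x) = ca * a_of x + twist (b_of x)] (mod int a)"
    "[b_of (left_t x) = cb * b_of x] (mod int b)" for x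
    by (simp_all add: coord_s coord_y coord_t cong_def)
  have "lact g \<circ> lact (inv\<^bsub>GG\<^esub> g) = id" "lact (inv\<^bsub>GG\<^esub> g) \<circ> lact g = id" if "g \<in> carrier GG" for g
    using that by (simp_all add: lact_comp lact_one del: G.P_simps)
  then show "bij left_t" unfolding left_t_def by (metis mem(4) o_bij)
  have "elt 0 (1 mod int b) 0 \<otimes>\<^bsub>GG\<^esub> elt (1 mod int a) 0 0 = elt (r mod int a) 0 0 \<otimes>\<^bsub>GG\<^esub> elt 0 (1 mod int b) 0"
    using a_pos b_pos in_a in_b by (subst y_mult, simp, simp, simp, simp, subst s_mult) (simp_all add: mod_simps)
  then show "left_y \<circ> left_s = (left_s ^^ nat (r mod int a)) \<circ> left_y"
    using a_pos unfolding s_pow unfolding left_s_def left_y_def by (simp add: lact_comp del: G.P_simps)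
  have "coprime (int (nat (r mod int a))) (int a)"
    using coprime_r a_pos by (simp add: coprime_mod_left_iff)
  then show "coprime (nat (r mod int a)) a" by (simp only: coprime_int_iff)
  have tw0: "twist 0 = 0" using G.act_one_right[of 1] by (simp add: twist_def)
  have "left_t \<circ> left_s = lact (elt (ca * (1 mod int a) mod int a) 0 0) \<circ> left_t"
    unfolding left_s_def using t_past_word[of "1 mod int a" 0] b_pos in_a by (simp add: tw0)
  also have "lact (elt (ca * (1 mod int a) mod int a) 0 0) = left_s ^^ nat (ca * (1 mod int a) mod int a)"
    unfolding s_pow using a_pos by simp
  finally show "\<exists>i. left_t \<circ> left_s = (left_s ^^ i) \<circ> left_t" by blast
  have "left_t \<circ> left_y = lact (elt (twist (1 mod int b) mod int a) (cb * (1 mod int b) mod int b) 0) \<circ> left_t"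
    unfolding left_y_def using t_past_word[of 0 "1 mod int b"] a_pos in_b by simp
  also have "lact (elt (twist (1 mod int b) mod int a) (cb * (1 mod int b) mod int b) 0)
     = (left_s ^^ nat (twist (1 mod int b) mod int a)) \<circ> (left_y ^^ nat (cb * (1 mod int b) mod int b))"
    by (rule word[symmetric]) (rule in_a in_b)+
  finally show "\<exists>i j. left_t \<circ> left_y = (left_s ^^ i) \<circ> (left_y ^^ j) \<circ> left_t" by blast
  show "\<exists>i j. left_s \<circ> left_t = left_t \<circ> ((left_s ^^ i) \<circ> (left_y ^^ j))"
    unfolding left_s_def[THEN arg_cong, of "\<lambda>f. f \<circ> left_t"] by (rule word_past_t) (use b_pos in_a in simp_all)
  show "\<exists>i j. left_y \<circ> left_t = left_t \<circ> ((left_s ^^ i) \<circ> (left_y ^^ j))"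
    unfolding left_y_def[THEN arg_cong, of "\<lambda>f. f \<circ> left_t"] by (rule word_past_t) (use a_pos in_b in simp_all)
qed

text \<open>
  Every group element is a word in the generators of \<open>\<int>\<^sub>a\<close> and \<open>\<int>\<^sub>b\<close> times a power of \<open>t\<close>,
  possibly negative.
\<close>
lemma inv_L_eq_inv_T: "inv_cochains L n = inv_cochains {left_s, left_y, left_t} n"
proof
  have "{left_s, left_y, left_t} \<subseteq> L" unfolding left_s_def left_y_def left_t_def by (auto simp del: G.P_simps)
  then show "inv_cochains L n \<subseteq> inv_cochains {left_s, left_y, left_t} n" by (auto intro: inv_cochains_mono)
  show "inv_cochains {left_s, left_y, left_t} n \<subseteq> inv_cochains L n"
  proof
    fix F assume F: "F \<in> inv_cochains {left_s, left_y, left_t} n"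
    then have st: "pull left_s F = F" "pull left_y F = F" "pull left_t F = F" by (auto simp: inv_cochains_def)
    have mult: "pull (lact (g \<otimes>\<^bsub>GG\<^esub> h)) F = F"
      if "g \<in> carrier GG" "h \<in> carrier GG" "pull (lact g) F = F" "pull (lact h) F = F" for g h
      using that by (simp add: lact_comp[symmetric] pull_comp[symmetric] del: G.P_simps)
    have t: "pull (lact (elt 0 0 k)) F = F" for k
    proof (cases "k \<ge> 0")
      case True
      then show ?thesis using pull_funpow_fixed[OF st(3), of "nat k"] by (simp add: t_pow)
    next
      case False
      then have 1: "pull (lact (elt 0 0 (- k))) F = F"
        using pull_funpow_fixed[OF st(3), of "nat (- k)"] by (simp add: t_pow)
      have "\<theta> (- k) (0, 0) = (0, 0)" using G.act_one_right[of "- k"] by simp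
      then have "elt 0 0 (- k) \<otimes>\<^bsub>GG\<^esub> elt 0 0 k = \<one>\<^bsub>GG\<^esub>" using a_pos by (simp add: \<alpha>_0)
      then have "pull (lact (elt 0 0 k)) (pull (lact (elt 0 0 (- k))) F) = F"
        by (simp add: pull_comp lact_comp lact_one del: G.P_simps)
      then show ?thesis by (simp add: 1)
    qed
    have "pull (lact g) F = F" if g: "g \<in> carrier GG" for g
    proof -
      obtain u v k where u: "g = elt u v k" "0 \<le> u" "u < int a" "0 \<le> v" "v < int b"
        using g unfolding carrier_GG by blast
      have "pull (lact (elt u v 0)) F = F"
        unfolding word[OF u(2-5), symmetric] using st by (simp add: pull_comp[symmetric] pull_funpow_fixed)
      moreover have "elt u v 0 \<in> carrier GG" unfolding carrier_GG using u by auto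
      ultimately have "pull (lact (elt u v 0 \<otimes>\<^bsub>GG\<^esub> elt 0 0 k)) F = F" using t[of k] by (intro mult) auto
      then show ?thesis using word_mult_t[OF u(2-5)] u(1) by simp
    qed
    then show "F \<in> inv_cochains L n" using F by (auto simp: inv_cochains_def)
  qed
qed

lemma cocyc_L_eq: "cocyc L n = cocyc {left_s, left_y, left_t} n"
  by (simp only: cocyc_def inv_L_eq_inv_T)

lemma cobd_L_eq: "cobd L n = cobd {left_s, left_y, left_t} n"
  by (cases n) (simp_all only: cobd.simps inv_L_eq_inv_T)

end

section \<open>Arithmetic of the coefficients\<close>

lemma dvd_mult_iff_div_gcd:
  fixes m g u :: int assumes "m > 0"
  shows "m dvd g * u \<longleftrightarrow> m div gcd g m dvd u"
proof -
  define e where "e = gcd g m"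
  have e: "e > 0" using assms by (simp add: e_def)
  define m' g' where "m' = m div e" "g' = g div e"
  have mg: "m = e * m'" "g = e * g'" by (simp_all add: m'_g'_def e_def)
  have "coprime g' m'" unfolding m'_g'_def e_def using assms by (intro div_gcd_coprime) simp
  then have "coprime m' g'" by (simp only: coprime_commute)
  have "m dvd g * u \<longleftrightarrow> m' dvd g' * u" using e unfolding mg by (simp add: mult.assoc)
  also have "\<dots> \<longleftrightarrow> m' dvd u" using \<open>coprime m' g'\<close> by (rule coprime_dvd_mult_right_iff)
  finally show ?thesis by (simp add: m'_g'_def e_def)
qed

text \<open>
  For \<open>g = r\<^sup>i - 1\<close> and \<open>h = c\<^sub>a\<^sup>i - 1\<close> the two conditions on the left describe the coordinates
  fixed by both generators, and the right side is stated with the modulus \<open>A\<^sub>i\<close>.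
\<close>
lemma dvd_both_mult_iff:
  fixes m g h u :: int assumes "m > 0"
  shows "m dvd g * u \<and> m dvd h * u \<longleftrightarrow> m div gcd h (gcd g m) dvd u"
proof -
  have "m dvd g * u \<and> m dvd h * u \<longleftrightarrow> m dvd gcd (h * u) (g * u)" by auto
  also have "gcd (h * u) (g * u) = gcd h g * \<bar>u\<bar>"
    by (simp add: gcd_mult_right abs_mult mult.commute gcd.commute)
  also have "m dvd gcd h g * \<bar>u\<bar> \<longleftrightarrow> m div gcd (gcd h g) m dvd \<bar>u\<bar>"
    by (rule dvd_mult_iff_div_gcd[OF assms])
  finally show ?thesis by (simp add: gcd.assoc)
qed

lemma dvd_diff_mult_iff:
  fixes m g k :: int
  shows "(\<exists>u. m dvd k - g * u) \<longleftrightarrow> gcd g m dvd k"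
proof
  assume "\<exists>u. m dvd k - g * u"
  then obtain u where "m dvd k - g * u" by blast
  then have "gcd g m dvd k - g * u" using dvd_trans gcd_dvd2 by blast
  then have "gcd g m dvd (k - g * u) + g * u" by (intro dvd_add) auto
  then show "gcd g m dvd k" by simp
next
  assume "gcd g m dvd k"
  then obtain q where q: "k = gcd g m * q" by blast
  obtain x z where xz: "x * g + z * m = gcd g m" using bezout_int by blast
  have "k - g * (x * q) = m * (z * q)" unfolding q xz[symmetric] by (simp add: algebra_simps)
  then show "\<exists>u. m dvd k - g * u" by (metis dvd_triv_left)
qed

text \<open>
  Each coefficient in a product formula arises in this way: the product of the coordinates of two
  generators, expressed as a multiple of the coordinate of a third.
\<close>
lemma div_mult_div:
  fixes m A A' A'' :: int
  assumes "m > 0" "A dvd m" "A' dvd m" "A'' dvd m" "A * A' dvd m * A''"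
  shows "(m div A) * (m div A') = (m * A'' div (A * A')) * (m div A'')"
proof -
  obtain x where x: "m = A * x" using assms by blast
  obtain x' where x': "m = A' * x'" using assms by blast
  obtain x'' where x'': "m = A'' * x''" using assms by blast
  obtain k where k: "m * A'' = A * A' * k" using assms(5) by blast
  have nz: "A \<noteq> 0" "A' \<noteq> 0" "A'' \<noteq> 0" using assms(1) x x' x'' by auto
  have "A * A' * (x * x') = (A * x) * (A' * x')" by (simp add: algebra_simps)
  also have "\<dots> = m * (A'' * x'')" by (simp add: x[symmetric] x'[symmetric] x''[symmetric])
  also have "\<dots> = A * A' * (k * x'')" using k by (simp add: mult.assoc[symmetric])
  finally have "x * x' = k * x''" using nz by simp
  moreover have "m div A = x" using x nz by (metis nonzero_mult_div_cancel_left)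
  moreover have "m div A' = x'" using x' nz by (metis nonzero_mult_div_cancel_left)
  moreover have "m div A'' = x''" using x'' nz by (metis nonzero_mult_div_cancel_left)
  moreover have "m * A'' div (A * A') = k" using k nz by simp
  ultimately show ?thesis by simp
qed

text \<open>
  Because \<open>A A'\<close> is the product of the least common multiple, which divides \<open>m\<close>, and the greatest
  common divisor.
\<close>
lemma mult_dvd_mult_gcd:
  fixes m A A' A'' :: int
  assumes "A dvd m" "A' dvd m" "gcd A A' dvd A''"
  shows "A * A' dvd m * A''"
proof -
  have "A * A' dvd lcm A A' * gcd A A'"
    using prod_gcd_lcm_int[of A A'] by (metis abs_dvd_iff abs_mult dvd_refl mult.commute)
  then show ?thesis using mult_dvd_mono[OF lcm_least[OF assms(1,2)] assms(3)] dvd_trans by blast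
qed

lemma dvd_power_diff_one:
  fixes x e :: int
  assumes "e dvd x ^ i - 1" "e dvd x ^ j - 1" shows "e dvd x ^ (i + j) - 1"
proof -
  have *: "x ^ (i + j) - 1 = (x ^ i - 1) * x ^ j + (x ^ j - 1)" by (simp add: power_add algebra_simps)
  show ?thesis unfolding * by (intro dvd_add dvd_mult2 assms)
qed

lemma gcd_power_shift:
  fixes x m :: int
  assumes "m dvd x ^ p - 1" shows "gcd (x ^ (j + p) - 1) m = gcd (x ^ j - 1) m"
proof -
  have "x ^ (j + p) - 1 = (x ^ j - 1) + x ^ j * (x ^ p - 1)" by (simp add: power_add algebra_simps)
  moreover obtain q where "x ^ p - 1 = m * q" using assms by blast
  ultimately have "x ^ (j + p) - 1 = (x ^ j * q) * m + (x ^ j - 1)" by simp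
  then show ?thesis by (metis gcd.commute gcd_add_mult)
qed

section \<open>The cohomology ring\<close>

context metacyclic_data
begin

abbreviation "TT \<equiv> {left_s, left_y, left_t}"

definition \<delta> :: "nat \<Rightarrow> int" where "\<delta> j = gcd (r ^ j - 1) (int a)"
definition AA :: "nat \<Rightarrow> int" where "AA j = gcd (ca ^ j - 1) (\<delta> j)"
definition BB :: "nat \<Rightarrow> int" where "BB j = gcd (cb ^ j - 1) (int b)"

lemma coefs_pos: "\<delta> j > 0" "AA j > 0" "BB j > 0"
  using a_pos b_pos by (simp_all add: \<delta>_def AA_def BB_def)

lemma coefs_dvd: "\<delta> j dvd int a" "AA j dvd \<delta> j" "AA j dvd int a" "BB j dvd int b"
proof -
  show "\<delta> j dvd int a" unfolding \<delta>_def by (rule gcd_dvd2)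
  show "BB j dvd int b" unfolding BB_def by (rule gcd_dvd2)
  show "AA j dvd \<delta> j" unfolding AA_def by (rule gcd_dvd2)
  note \<open>\<delta> j dvd int a\<close> \<open>AA j dvd \<delta> j\<close>
  from dvd_trans[OF this(2,1)] show "AA j dvd int a" .
qed

lemma \<delta>_iff: "int a dvd (r ^ j - 1) * u \<longleftrightarrow> int a div \<delta> j dvd u"
  unfolding \<delta>_def using a_pos by (intro dvd_mult_iff_div_gcd) simp

lemma AA_iff: "int a dvd (r ^ j - 1) * u \<and> int a dvd (ca ^ j - 1) * u \<longleftrightarrow> int a div AA j dvd u"
  unfolding AA_def \<delta>_def using a_pos by (intro dvd_both_mult_iff) simp

lemma BB_iff: "int b dvd (cb ^ j - 1) * v \<longleftrightarrow> int b div BB j dvd v"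
  unfolding BB_def using b_pos by (intro dvd_mult_iff_div_gcd) simp

lemma div_mult_dvd_iff: "n > 0 \<Longrightarrow> e dvd n \<Longrightarrow> n dvd (n div e) * k \<longleftrightarrow> e dvd k" for n e k :: int
  by (elim dvdE) (auto simp: mult.commute)

lemma gcd_\<delta>: "gcd (\<delta> i) (\<delta> j) dvd \<delta> (i + j)"
  unfolding \<delta>_def by (intro gcd_greatest dvd_power_diff_one) (auto intro: dvd_trans[OF gcd_dvd1] dvd_trans[OF gcd_dvd2])

lemma gcd_AA_\<delta>: "gcd (AA i) (\<delta> j) dvd \<delta> (i + j)"
  using gcd_\<delta>[of i j] coefs_dvd(2)[of i] by (meson dvd_trans gcd_dvd1 gcd_dvd2 gcd_greatest)

lemma gcd_AA: "gcd (AA i) (AA j) dvd AA (i + j)"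
proof -
  have "gcd (AA i) (AA j) dvd ca ^ i - 1" "gcd (AA i) (AA j) dvd ca ^ j - 1"
    unfolding AA_def by (auto intro: dvd_trans[OF gcd_dvd1] dvd_trans[OF gcd_dvd2])
  moreover have "gcd (AA i) (AA j) dvd \<delta> (i + j)"
    using gcd_AA_\<delta>[of i j] coefs_dvd(2)[of j] by (meson dvd_trans gcd_dvd1 gcd_dvd2 gcd_greatest)
  ultimately show ?thesis unfolding AA_def[of "i + j"] by (intro gcd_greatest dvd_power_diff_one)
qed

lemma gcd_BB: "gcd (BB i) (BB j) dvd BB (i + j)"
  unfolding BB_def by (intro gcd_greatest dvd_power_diff_one) (auto intro: dvd_trans[OF gcd_dvd1] dvd_trans[OF gcd_dvd2])

lemma coef_\<phi>a\<phi>a: "(int a div AA i) * (int a div AA j) = (int a * AA (i + j) div (AA i * AA j)) * (int a div AA (i + j))"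
  using a_pos coefs_dvd by (intro div_mult_div mult_dvd_mult_gcd gcd_AA) auto

lemma coef_\<phi>b\<phi>b: "(int b div BB i) * (int b div BB j) = (int b * BB (i + j) div (BB i * BB j)) * (int b div BB (i + j))"
  using b_pos coefs_dvd by (intro div_mult_div mult_dvd_mult_gcd gcd_BB) auto

lemma coef_\<phi>a\<psi>a: "(int a div AA i) * (int a div \<delta> j) = (int a * \<delta> (i + j) div (\<delta> j * AA i)) * (int a div \<delta> (i + j))"
  using a_pos coefs_dvd by (subst mult.commute[of "\<delta> j"]) (intro div_mult_div mult_dvd_mult_gcd gcd_AA_\<delta>, auto)

lemma coef_\<phi>a\<eta>: "int a div AA i = (\<delta> i div AA i) * (int a div \<delta> i)"
proof -
  have "(\<delta> i div AA i) * AA i = \<delta> i" "(int a div \<delta> i) * \<delta> i = int a" using coefs_dvd by simp_all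
  then have "int a = AA i * ((\<delta> i div AA i) * (int a div \<delta> i))" by (metis mult.assoc mult.commute)
  then show ?thesis using coefs_pos(2)[of i] by (metis less_irrefl nonzero_mult_div_cancel_left)
qed

subsection \<open>The generators\<close>

definition phi_a :: "nat \<Rightarrow> nat list \<Rightarrow> int"
  where "phi_a i = (SOME F. F \<in> cocyc TT (2 * i) \<and> coords i F (int a div AA i) 0)"
definition phi_b :: "nat \<Rightarrow> nat list \<Rightarrow> int"
  where "phi_b i = (SOME F. F \<in> cocyc TT (2 * i) \<and> coords i F 0 (int b div BB i))"
definition psi_a :: "nat \<Rightarrow> nat list \<Rightarrow> int"
  where "psi_a i = (SOME f. ocoords i f (int a div \<delta> i) 0)"
definition psi_b :: "nat \<Rightarrow> nat list \<Rightarrow> int"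
  where "psi_b i = (SOME f. ocoords i f 0 1)"

lemma phi_a: assumes "i > 0" shows "phi_a i \<in> cocyc TT (2 * i)" "coords i (phi_a i) (int a div AA i) 0"
proof -
  have "\<exists>F. F \<in> cocyc TT (2 * i) \<and> coords i F (int a div AA i) 0"
    using even_realize[OF assms, of "int a div AA i" 0] AA_iff[of i "int a div AA i"] by auto
  from someI_ex[OF this] show "phi_a i \<in> cocyc TT (2 * i)" "coords i (phi_a i) (int a div AA i) 0"
    unfolding phi_a_def by blast+
qed

lemma phi_b: assumes "i > 0" shows "phi_b i \<in> cocyc TT (2 * i)" "coords i (phi_b i) 0 (int b div BB i)"
proof -
  have "\<exists>F. F \<in> cocyc TT (2 * i) \<and> coords i F 0 (int b div BB i)"
    using even_realize[OF assms, of 0 "int b div BB i"] BB_iff[of i "int b div BB i"] by auto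
  from someI_ex[OF this] show "phi_b i \<in> cocyc TT (2 * i)" "coords i (phi_b i) 0 (int b div BB i)"
    unfolding phi_b_def by blast+
qed

lemma psi_a: assumes "i > 0" shows "ocoords i (psi_a i) (int a div \<delta> i) 0"
proof -
  have "\<exists>f. ocoords i f (int a div \<delta> i) 0" by (rule ocoords_realize[OF assms]) (simp add: \<delta>_iff)
  from someI_ex[OF this] show ?thesis unfolding psi_a_def .
qed

lemma psi_b: assumes "i > 0" shows "ocoords i (psi_b i) 0 1"
proof -
  have "\<exists>f. ocoords i f 0 1" by (rule ocoords_realize[OF assms]) simp
  from someI_ex[OF this] show ?thesis unfolding psi_b_def .
qed

abbreviation "H \<equiv> cohomology GG"

lemma cls_even_eq:
  assumes "F \<in> cocyc TT (2 * i)" "F' \<in> cocyc TT (2 * i)" "i > 0"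
    "coords i F u v" "coords i F' u' v'" "int a dvd u - u'" "int b dvd v - v'"
  shows "cls (2 * i) F = cls (2 * i) F'"
proof -
  have "F - F' \<in> cocyc TT (2 * i)" by (intro cocyc_closed assms)
  moreover have "coords i (F - F') (u - u') (v - v')" by (intro coords_diff assms)
  ultimately have "F - F' \<in> cobd TT (2 * i)" using even_cobd_iff assms by blast
  then show ?thesis using cls_eq_iff assms(1,2) by (simp only: cocyc_L_eq cobd_L_eq)
qed

lemma odd_zero: "ocoords i f 0 0 \<Longrightarrow> i > 0 \<Longrightarrow> f \<in> cobd TT (2 * i + 1)"
  using odd_cobd_iff[of i f 0 0] by (metis diff_0_right dvd_0_right mult_zero_right)

lemma cls_odd_eq:
  assumes "ocoords i f u v" "ocoords i f' u v" "i > 0"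
  shows "cls (2 * i + 1) f = cls (2 * i + 1) f'"
proof -
  have "ocoords i (f - f') 0 0" using ocoords_diff[OF assms(1,2)] by simp
  then have "f - f' \<in> cobd TT (2 * i + 1)" using odd_zero assms(3) by blast
  then show ?thesis
    using cls_eq_iff ocoords_cocyc[OF assms(1)] ocoords_cocyc[OF assms(2)] by (simp only: cocyc_L_eq cobd_L_eq)
qed

lemma cls_pow: "F \<in> cocyc TT n \<Longrightarrow> cls n F [^]\<^bsub>H n\<^esub> (k::int) = cls n (of_int k * F)"
  using cls_int_pow by (simp only: cocyc_L_eq)

lemma cls_mult: "F \<in> cocyc TT n \<Longrightarrow> F' \<in> cocyc TT n \<Longrightarrow> cls n F \<otimes>\<^bsub>H n\<^esub> cls n F' = cls n (F + F')"
  using cohomology_mult by (simp only: cocyc_L_eq)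

lemma cls_mem: "F \<in> cocyc TT n \<Longrightarrow> cls n F \<in> carrier (H n)"
  using cls_carrier by (simp only: cocyc_L_eq)

lemma cls_cases: "z \<in> carrier (H n) \<Longrightarrow> \<exists>F\<in>cocyc TT n. z = cls n F"
  using cohomology_carrier[of n] unfolding cocyc_L_eq by blast

lemma cls_one_iff: "F \<in> cocyc TT n \<Longrightarrow> cls n F = \<one>\<^bsub>H n\<^esub> \<longleftrightarrow> F \<in> cobd TT n"
  using cls_eq_one_iff by (simp only: cocyc_L_eq cobd_L_eq)

lemma cls_cup: "F \<in> cocyc TT p \<Longrightarrow> F' \<in> cocyc TT q \<Longrightarrow> cup GG p q (cls p F) (cls q F') = cls (p + q) (hcup p F F')"
  using cup_cls by (simp only: cocyc_L_eq)

lemma basis_even: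
  assumes i: "i > 0"
  shows "basis2_group (H (2 * i)) (cls (2 * i) (phi_a i)) (cls (2 * i) (phi_b i)) (nat (AA i)) (nat (BB i))"
proof (unfold_locales, unfold basis2_def, intro conjI ballI allI)
  let ?H = "H (2 * i)" and ?x = "cls (2 * i) (phi_a i)" and ?y = "cls (2 * i) (phi_b i)"
  have comb: "?x [^]\<^bsub>?H\<^esub> k \<otimes>\<^bsub>?H\<^esub> ?y [^]\<^bsub>?H\<^esub> l
      = cls (2 * i) (of_int k * phi_a i + of_int l * phi_b i)" for k l :: int
    by (simp only: cls_pow phi_a[OF i] phi_b[OF i] cls_mult cocyc_closed)
  have cc: "of_int k * phi_a i + of_int l * phi_b i \<in> cocyc TT (2 * i)" for k l :: int
    by (intro cocyc_closed phi_a phi_b i)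
  have co: "coords i (of_int k * phi_a i + of_int l * phi_b i) (k * (int a div AA i)) (l * (int b div BB i))" for k l :: int
    using coords_lin[OF phi_a(2)[OF i] phi_b(2)[OF i], of k l] by simp
  show "comm_group (?H)" by (rule cohomology_group)
  show "?x \<in> carrier (?H)" "?y \<in> carrier (?H)"
    by (intro cls_mem phi_a phi_b i)+
  show "\<exists>(k::int) (l::int). z = ?x [^]\<^bsub>?H\<^esub> k \<otimes>\<^bsub>?H\<^esub> ?y [^]\<^bsub>?H\<^esub> l"
    if z: "z \<in> carrier (?H)" for z
  proof -
    obtain F where F: "F \<in> cocyc TT (2 * i)" "z = cls (2 * i) F" using cls_cases[OF z] by blast
    obtain u v where uv: "coords i F u v" using coords_exist[OF cocyc_T_N[OF F(1)]] by blast
    note even_constraints[OF F(1) uv i]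
    then have "int a div AA i dvd u" "int b div BB i dvd v" using AA_iff BB_iff by blast+
    then obtain k l where kl: "u = k * (int a div AA i)" "v = l * (int b div BB i)" by (metis dvdE mult.commute)
    have "z = cls (2 * i) (of_int k * phi_a i + of_int l * phi_b i)"
      unfolding F(2) by (rule cls_even_eq[OF F(1) cc i uv co]) (simp_all add: kl)
    then show ?thesis unfolding comb by blast
  qed
  show "(?x [^]\<^bsub>?H\<^esub> k \<otimes>\<^bsub>?H\<^esub> ?y [^]\<^bsub>?H\<^esub> l = \<one>\<^bsub>?H\<^esub>)
     = (int (nat (AA i)) dvd k \<and> int (nat (BB i)) dvd l)" for k l :: int
    unfolding comb cls_one_iff[OF cc] even_cobd_iff[OF cc co i]
    using div_mult_dvd_iff[of "int a" "AA i" k] div_mult_dvd_iff[of "int b" "BB i" l] a_pos b_pos coefs_dvd coefs_pos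
    by (simp add: mult.commute less_imp_le)
  show "nat (AA i) > 0" "nat (BB i) > 0" using coefs_pos by simp_all
qed

text \<open>
  The orders come from \<open>odd_cobd_iff\<close>: the multiples \<open>k\<close> of \<open>a/\<delta>\<^sub>i\<close> which bound are those in the
  ideal generated by \<open>c\<^sub>a\<^sup>i - 1\<close> and \<open>\<delta>\<^sub>i\<close>, that is, the multiples of \<open>A\<^sub>i\<close>.
\<close>
lemma basis_odd:
  assumes i: "i > 0"
  shows "basis2_group (H (2 * i + 1)) (cls (2 * i + 1) (psi_a i)) (cls (2 * i + 1) (psi_b i)) (nat (AA i)) (nat (BB i))"
proof (unfold_locales, unfold basis2_def, intro conjI ballI allI)
  let ?H = "H (2 * i + 1)" and ?x = "cls (2 * i + 1) (psi_a i)" and ?y = "cls (2 * i + 1) (psi_b i)"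
  note ca = ocoords_cocyc[OF psi_a[OF i]] and cb = ocoords_cocyc[OF psi_b[OF i]]
  have comb: "?x [^]\<^bsub>?H\<^esub> k \<otimes>\<^bsub>?H\<^esub> ?y [^]\<^bsub>?H\<^esub> l
      = cls (2 * i + 1) (of_int k * psi_a i + of_int l * psi_b i)" for k l :: int
    by (simp only: cls_pow ca cb cls_mult cocyc_closed)
  have co: "ocoords i (of_int k * psi_a i + of_int l * psi_b i) (k * (int a div \<delta> i)) l" for k l :: int
    using ocoords_lin[OF psi_a[OF i] psi_b[OF i], of k l] by simp
  show "comm_group (?H)" by (rule cohomology_group)
  show "?x \<in> carrier (?H)" "?y \<in> carrier (?H)"
    by (intro cls_mem ca cb)+
  show "\<exists>(k::int) (l::int). z = ?x [^]\<^bsub>?H\<^esub> k \<otimes>\<^bsub>?H\<^esub> ?y [^]\<^bsub>?H\<^esub> l"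
    if z: "z \<in> carrier (?H)" for z
  proof -
    obtain f where f: "f \<in> cocyc TT (2 * i + 1)" "z = cls (2 * i + 1) f" using cls_cases[OF z] by blast
    obtain u v where uv: "ocoords i f u v" using ocoords_exist[OF f(1)] by blast
    have "int a div \<delta> i dvd u" using ocoords_constraint[OF uv i] \<delta>_iff by blast
    then obtain k where k: "u = k * (int a div \<delta> i)" by (metis dvdE mult.commute)
    have "z = cls (2 * i + 1) (of_int k * psi_a i + of_int v * psi_b i)"
      unfolding f(2) by (rule cls_odd_eq[OF uv _ i]) (use co k in simp)
    then show ?thesis unfolding comb by blast
  qed
  show "(?x [^]\<^bsub>?H\<^esub> k \<otimes>\<^bsub>?H\<^esub> ?y [^]\<^bsub>?H\<^esub> l = \<one>\<^bsub>?H\<^esub>)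
     = (int (nat (AA i)) dvd k \<and> int (nat (BB i)) dvd l)" for k l :: int
  proof -
    \<comment> \<open>An admissible \<open>u'\<close> is a multiple of \<open>e\<close>, and \<open>e\<close> can be cancelled at the price of replacing the modulus \<open>a\<close> by \<open>\<delta>\<^sub>i\<close>.\<close>
    define e where "e = int a div \<delta> i"
    have e: "int a dvd e * n \<longleftrightarrow> \<delta> i dvd n" for n
      unfolding e_def using a_pos coefs_dvd by (intro div_mult_dvd_iff) simp_all
    have "(\<exists>u'. int a dvd (r ^ i - 1) * u' \<and> int a dvd k * e - (ca ^ i - 1) * u') \<longleftrightarrow> (\<exists>n. \<delta> i dvd k - (ca ^ i - 1) * n)"
    proof -
      have "int a dvd (r ^ i - 1) * (e * n) \<and> (int a dvd k * e - (ca ^ i - 1) * (e * n) \<longleftrightarrow> \<delta> i dvd k - (ca ^ i - 1) * n)" for n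
        using e[of "k - (ca ^ i - 1) * n"] \<delta>_iff[of i "e * n"] by (simp add: e_def algebra_simps)
      moreover have "\<exists>n. u' = e * n" if "int a dvd (r ^ i - 1) * u'" for u'
        using that \<delta>_iff by (auto simp: e_def)
      ultimately show ?thesis by metis
    qed
    then have "(\<exists>u'. int a dvd (r ^ i - 1) * u' \<and> int a dvd k * e - (ca ^ i - 1) * u') \<longleftrightarrow> AA i dvd k"
      by (simp add: dvd_diff_mult_iff AA_def)
    moreover have "(\<exists>v'. int b dvd l - (cb ^ i - 1) * v') \<longleftrightarrow> BB i dvd l"
      by (simp add: dvd_diff_mult_iff BB_def)
    moreover have "int (nat (AA i)) = AA i" "int (nat (BB i)) = BB i" using coefs_pos by (simp_all add: less_imp_le)
    ultimately show ?thesis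
      unfolding comb cls_one_iff[OF ocoords_cocyc[OF co]] odd_cobd_iff[OF co i] e_def[symmetric] by simp blast
  qed
  show "nat (AA i) > 0" "nat (BB i) > 0" using coefs_pos by simp_all
qed

subsection \<open>Products\<close>

lemma cup_even_even:
  assumes "i > 0" "j > 0" "F \<in> cocyc TT (2 * i)" "coords i F u v" "F' \<in> cocyc TT (2 * j)" "coords j F' u' v'"
    "K \<in> cocyc TT (2 * (i + j))" "coords (i + j) K u'' v''" "u * u' = k * u''" "v * v' = k * v''"
  shows "cup GG (2 * i) (2 * j) (cls (2 * i) F) (cls (2 * j) F') = cls (2 * (i + j)) K [^]\<^bsub>H (2 * (i + j))\<^esub> k"
proof -
  have "coords (i + j) (of_int k * K) (k * u'') (k * v'')"
    using coords_lin[OF assms(8,8), of k 0] by simp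
  moreover have "hcup (2 * i) F F' \<in> cocyc TT (2 * (i + j))"
    using cocyc_hcup[OF assms(3,5)] by (simp only: distrib_left)
  moreover have "int a dvd u * u' - k * u''" "int b dvd v * v' - k * v''"
    by (simp_all only: assms diff_self dvd_0_right)
  ultimately have "cls (2 * (i + j)) (hcup (2 * i) F F') = cls (2 * (i + j)) (of_int k * K)"
    using assms(1,7) by (intro cls_even_eq[OF _ _ _ coords_hcup[OF assms(4,6)]] cocyc_closed) simp_all
  moreover have "2 * i + 2 * j = 2 * (i + j)" by simp
  ultimately show ?thesis using assms by (simp only: cls_cup cls_pow)
qed

lemma cup_even_odd:
  assumes "i > 0" "F \<in> cocyc TT (2 * i)" "coords i F u v" "ocoords j f u' v'"
    "ocoords (i + j) g u'' v''" "u * u' = k * u''" "v * v' = k * v''"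
  shows "cup GG (2 * i) (2 * j + 1) (cls (2 * i) F) (cls (2 * j + 1) f)
    = cls (2 * (i + j) + 1) g [^]\<^bsub>H (2 * (i + j) + 1)\<^esub> k"
proof -
  have "ocoords (i + j) (of_int k * g) (k * u'') (k * v'')"
    using ocoords_lin[OF assms(5,5), of k 0] by simp
  then have "cls (2 * (i + j) + 1) (hcup (2 * i) F f) = cls (2 * (i + j) + 1) (of_int k * g)"
    using assms ocoords_hcup[OF assms(2,3,4)] by (intro cls_odd_eq) simp_all
  moreover have "2 * i + (2 * j + 1) = 2 * (i + j) + 1" by simp
  ultimately show ?thesis using assms ocoords_cocyc by (simp only: cls_cup cls_pow)
qed

lemma cup_odd_odd:
  assumes "ocoords i f u v" "ocoords j g u' v'"
  shows "cup GG (2 * i + 1) (2 * j + 1) (cls (2 * i + 1) f) (cls (2 * j + 1) g) = \<one>\<^bsub>H (2 * (i + j) + 2)\<^esub>"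
proof -
  note z = odd_hcup_odd[OF assms]
  have "2 * i + 1 + (2 * j + 1) = 2 * (i + j) + 2" by simp
  then show ?thesis
    using assms ocoords_cocyc cls_one_iff[OF cobd_cocyc[OF z]] z by (simp only: cls_cup)
qed

lemma int_pow_zero: "x [^]\<^bsub>H n\<^esub> (0::int) = \<one>\<^bsub>H n\<^esub>"
  by (simp add: int_pow_def nat_pow_def)

lemma degree_0: "H 0 \<cong> integer_group"
proof (rule infinite_cyclic(1))
  have u: "hunit \<in> cocyc TT 0" by (rule cocyc_closed)
  show "group (H 0)" using cohomology_group comm_group.axioms(2) by blast
  show "cls 0 hunit \<in> carrier (H 0)" by (intro cls_mem u)
  show "\<exists>k::int. z = cls 0 hunit [^]\<^bsub>H 0\<^esub> k" if "z \<in> carrier (H 0)" for z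
    using cls_cases[OF that] A.cocyc_0 by (auto simp: cls_pow[OF u])
  show "k = 0" if "cls 0 hunit [^]\<^bsub>H 0\<^esub> k = \<one>\<^bsub>H 0\<^esub>" for k :: int
  proof -
    have "of_int k * (hunit :: nat list \<Rightarrow> int) = 0"
      using that cls_one_iff[OF cocyc_closed(4)[OF u]] by (simp add: cls_pow[OF u])
    from fun_cong[OF this, of "[undefined]"] show ?thesis by (simp add: hunit_def)
  qed
qed

lemma degree_1: "H 1 \<cong> integer_group" "generate (H 1) {cls 1 eta} = carrier (H 1)"
proof -
  note u = eta_cocyc
  have 1: "group (H 1)" using cohomology_group comm_group.axioms(2) by blast
  have 2: "cls 1 eta \<in> carrier (H 1)" by (intro cls_mem u)
  have 3: "\<exists>k::int. z = cls 1 eta [^]\<^bsub>H 1\<^esub> k" if z: "z \<in> carrier (H 1)" for z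
  proof -
    obtain f where f: "f \<in> cocyc TT 1" "z = cls 1 f" using cls_cases[OF z] by blast
    obtain k where "f - of_int k * eta \<in> cobd TT 1" using deg1[OF f(1)] by blast
    then have "cls 1 f = cls 1 (of_int k * eta)"
      using cls_eq_iff f cocyc_closed(4)[OF u] by (simp only: cocyc_L_eq cobd_L_eq)
    then show ?thesis using f(2) cls_pow[OF u] by metis
  qed
  have 4: "k = 0" if "cls 1 eta [^]\<^bsub>H 1\<^esub> k = \<one>\<^bsub>H 1\<^esub>" for k :: int
    using that cls_one_iff[OF cocyc_closed(4)[OF u]] deg1_order by (simp only: cls_pow[OF u])
  show "H 1 \<cong> integer_group" "generate (H 1) {cls 1 eta} = carrier (H 1)"
    by (rule infinite_cyclic[OF 1 2 3 4]; assumption)+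
qed

subsection \<open>Periodicity\<close>

text \<open>
  The element \<open>E\<close> has coordinates \<open>(1, 1)\<close>, so multiplication by it keeps coordinates and takes
  the basis in degree \<open>n\<close> to the one in degree \<open>n + 2 p\<close>. The orders agree, as \<open>\<delta>\<close>, \<open>A\<close> and \<open>B\<close>
  have period \<open>p\<close>.
\<close>
lemma periodicity:
  assumes p: "p > 0" and pr: "int a dvd r ^ p - 1" and pa: "int a dvd ca ^ p - 1" and pb: "int b dvd cb ^ p - 1"
    and n: "n \<ge> 2"
  shows "(\<lambda>x. cup GG (2 * p) n (cls (2 * p) (phi_a p) \<otimes>\<^bsub>H (2 * p)\<^esub> cls (2 * p) (phi_b p)) x) \<in> iso (H n) (H (n + 2 * p))"
proof -
  define E where "E = phi_a p + phi_b p"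
  have E: "E \<in> cocyc TT (2 * p)" unfolding E_def by (intro cocyc_closed phi_a phi_b p)
  have Ecls: "cls (2 * p) (phi_a p) \<otimes>\<^bsub>H (2 * p)\<^esub> cls (2 * p) (phi_b p) = cls (2 * p) E"
    unfolding E_def by (intro cls_mult phi_a phi_b p)
  have "\<delta> p = int a" using pr by (simp add: \<delta>_def gcd_proj2_iff)
  then have "AA p = int a" "BB p = int b" using pa pb by (simp_all add: AA_def BB_def gcd_proj2_iff)
  then have Ec: "coords p E 1 1"
    unfolding E_def using coords_add[OF phi_a(2)[OF p] phi_b(2)[OF p]] a_pos b_pos by simp
  have sh: "\<delta> (p + j) = \<delta> j" "AA (p + j) = AA j" "BB (p + j) = BB j" for j
  proof -
    show d: "\<delta> (p + j) = \<delta> j" unfolding \<delta>_def using gcd_power_shift[OF pr, of j] by (simp add: add.commute)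
    have "\<delta> j dvd ca ^ p - 1" using coefs_dvd(1) pa dvd_trans by blast
    from gcd_power_shift[OF this, of j] show "AA (p + j) = AA j"
      unfolding AA_def d by (simp only: add.commute[of j p])
    show "BB (p + j) = BB j" unfolding BB_def using gcd_power_shift[OF pb, of j] by (simp add: add.commute)
  qed
  define f where "f x = cup GG (2 * p) n (cls (2 * p) E) x" for x
  have f: "f (cls n F) = cls (n + 2 * p) (hcup (2 * p) E F)" if "F \<in> cocyc TT n" for F
    unfolding f_def using cls_cup[OF E that] by (simp add: add.commute)
  have hom: "f \<in> hom (H n) (H (n + 2 * p))"
  proof (rule homI)
    have hc: "hcup (2 * p) E F \<in> cocyc TT (n + 2 * p)" if "F \<in> cocyc TT n" for F
      using cocyc_hcup[OF E that] by (simp add: add.commute)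
    fix z z' assume "z \<in> carrier (H n)" "z' \<in> carrier (H n)"
    then obtain F F' where F: "F \<in> cocyc TT n" "z = cls n F" "F' \<in> cocyc TT n" "z' = cls n F'"
      using cls_cases by metis
    show "f z \<in> carrier (H (n + 2 * p))" using F by (simp add: f cls_mem hc)
    show "f (z \<otimes>\<^bsub>H n\<^esub> z') = f z \<otimes>\<^bsub>H (n + 2 * p)\<^esub> f z'"
      using F by (simp only: f cls_mult hc cocyc_closed(2) hcup_bilinear)
  qed
  have "f \<in> iso (H n) (H (n + 2 * p))"
  proof (cases "even n")
    case True
    then obtain j where j: "n = 2 * j" by blast
    then have j0: "j > 0" using n by simp
    have n': "n + 2 * p = 2 * (p + j)" using j by simp
    have h: "2 * p + 2 * j = 2 * (p + j)" by simp
    have psi_a: "f (cls (2 * j) (phi_a j)) = cls (2 * (p + j)) (phi_a (p + j))"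
      unfolding f[unfolded j, OF phi_a(1)[OF j0]] n'[unfolded j]
      by (rule cls_even_eq[OF _ phi_a(1) _ coords_hcup[OF Ec phi_a(2)[OF j0]] phi_a(2)])
         (use cocyc_hcup[OF E phi_a(1)[OF j0]] j0 sh in \<open>simp_all add: distrib_left\<close>)
    have psi_b: "f (cls (2 * j) (phi_b j)) = cls (2 * (p + j)) (phi_b (p + j))"
      unfolding f[unfolded j, OF phi_b(1)[OF j0]] n'[unfolded j]
      by (rule cls_even_eq[OF _ phi_b(1) _ coords_hcup[OF Ec phi_b(2)[OF j0]] phi_b(2)])
         (use cocyc_hcup[OF E phi_b(1)[OF j0]] j0 sh in \<open>simp_all add: distrib_left\<close>)
    show ?thesis
      unfolding n' unfolding j
      by (rule basis2_hom_iso[OF basis_even[OF j0] _ _ psi_a psi_b])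
         (use basis_even[of "p + j"] j0 sh hom[unfolded n', unfolded j] in auto)
  next
    case False
    then obtain j where j: "n = 2 * j + 1" using oddE by blast
    then have j0: "j > 0" using n by simp
    have n': "n + 2 * p = 2 * (p + j) + 1" using j by simp
    have psi_a: "f (cls (2 * j + 1) (psi_a j)) = cls (2 * (p + j) + 1) (psi_a (p + j))"
      unfolding f[unfolded j, OF ocoords_cocyc[OF psi_a[OF j0]]] n'[unfolded j]
      by (rule cls_odd_eq[of _ _ "int a div \<delta> j" 0])
         (use ocoords_hcup[OF E Ec psi_a[OF j0]] psi_a[of "p + j"] j0 sh in simp_all)
    have psi_b: "f (cls (2 * j + 1) (psi_b j)) = cls (2 * (p + j) + 1) (psi_b (p + j))"
      unfolding f[unfolded j, OF ocoords_cocyc[OF psi_b[OF j0]]] n'[unfolded j]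
      by (rule cls_odd_eq[of _ _ 0 1])
         (use ocoords_hcup[OF E Ec psi_b[OF j0]] psi_b[of "p + j"] j0 in simp_all)
    show ?thesis
      unfolding n' unfolding j
      by (rule basis2_hom_iso[OF basis_odd[OF j0] _ _ psi_a psi_b])
         (use basis_odd[of "p + j"] j0 sh hom[unfolded n', unfolded j] in auto)
  qed
  then show ?thesis unfolding Ecls f_def .
qed

end

theorem theorem3p3:
  fixes a b :: nat
    and r c ca cb :: int
    and \<alpha> :: "int \<Rightarrow> int \<Rightarrow> int"
    and \<theta> :: "int \<Rightarrow> int \<times> int \<Rightarrow> int \<times> int"
  defines "N \<equiv> semidirect_product (integer_mod_group a) (integer_mod_group b) \<alpha>"
  defines "G \<equiv> semidirect_product N integer_group \<theta>"
  defines "H \<equiv> cohomology G"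
  defines "\<delta> \<equiv> (\<lambda>j::nat. gcd (r ^ j - 1) (int a))"
  defines "A \<equiv> (\<lambda>j::nat. gcd (ca ^ j - 1) (\<delta> j))"
  defines "B \<equiv> (\<lambda>j::nat. gcd (cb ^ j - 1) (int b))"
  defines "d \<equiv> group.ord (units_of (ZFact (int a))) (ZMod (int a) r)"
  defines "d\<^sub>c\<^sub>a \<equiv> group.ord (units_of (ZFact (int a))) (ZMod (int a) ca)"
  defines "d\<^sub>c\<^sub>b \<equiv> group.ord (units_of (ZFact (int b))) (ZMod (int b) cb)"
  defines "p \<equiv> lcm d (lcm d\<^sub>c\<^sub>a d\<^sub>c\<^sub>b)"
  assumes "a > 0" and "b > 0"
    and "gcd a b = 1"
    and "gcd (int a) ((r - 1) * int b) = 1"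
    and "[r ^ b = 1] (mod int a)"
    and "\<alpha> \<in> hom (integer_mod_group b) (AutoGroup (integer_mod_group a))"
    and "\<alpha> (1 mod int b) (1 mod int a) = r mod int a"
    and "\<theta> \<in> hom integer_group (AutoGroup N)"
    and "\<theta> 1 (1 mod int a, 0) = (ca mod int a, 0)"
    and "\<theta> 1 (0, 1 mod int b) = (c mod int a, cb mod int b)"
  shows
    "H 0 \<cong> integer_group \<and> H 1 \<cong> integer_group \<and>
     (\<forall>j>0. H (2*j) \<cong> integer_mod_group (nat (A j)) \<times>\<times> integer_mod_group (nat (B j)) \<and>
            H (2*j+1) \<cong> integer_mod_group (nat (A j)) \<times>\<times> integer_mod_group (nat (B j))) \<and>
     (\<exists>\<eta> \<phi>\<^sub>a \<phi>\<^sub>b \<psi>\<^sub>a \<psi>\<^sub>b.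
        \<eta> \<in> carrier (H 1) \<and> generate (H 1) {\<eta>} = carrier (H 1) \<and>
        (\<forall>i>0.
          \<phi>\<^sub>a i \<in> carrier (H (2*i)) \<and> \<phi>\<^sub>b i \<in> carrier (H (2*i)) \<and>
          generate (H (2*i)) {\<phi>\<^sub>a i, \<phi>\<^sub>b i} = carrier (H (2*i)) \<and>
          subgroup_generated (H (2*i)) {\<phi>\<^sub>a i} \<cong> integer_mod_group (nat (A i)) \<and>
          subgroup_generated (H (2*i)) {\<phi>\<^sub>b i} \<cong> integer_mod_group (nat (B i)) \<and>
          \<psi>\<^sub>a i \<in> carrier (H (2*i+1)) \<and> \<psi>\<^sub>b i \<in> carrier (H (2*i+1)) \<and>
          generate (H (2*i+1)) {\<psi>\<^sub>a i, \<psi>\<^sub>b i} = carrier (H (2*i+1)) \<and>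
          subgroup_generated (H (2*i+1)) {\<psi>\<^sub>a i} \<cong> integer_mod_group (nat (A i)) \<and>
          subgroup_generated (H (2*i+1)) {\<psi>\<^sub>b i} \<cong> integer_mod_group (nat (B i))) \<and>
        (\<forall>i>0.
          cup G (2*i) 1 (\<phi>\<^sub>a i) \<eta>
            = \<psi>\<^sub>a i [^]\<^bsub>H (2*i+1)\<^esub> (\<delta> i div gcd (\<delta> i) (ca ^ i - 1)) \<and>
          cup G (2*i) 1 (\<phi>\<^sub>b i) \<eta>
            = \<psi>\<^sub>b i [^]\<^bsub>H (2*i+1)\<^esub> (int b div gcd (int b) (cb ^ i - 1)) \<and>
          cup G (2*i+1) 1 (\<psi>\<^sub>a i) \<eta> = \<one>\<^bsub>H (2*i+2)\<^esub> \<and>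
          cup G (2*i+1) 1 (\<psi>\<^sub>b i) \<eta> = \<one>\<^bsub>H (2*i+2)\<^esub>) \<and>
        (\<forall>i>0. \<forall>j>0.
          cup G (2*i) (2*j) (\<phi>\<^sub>a i) (\<phi>\<^sub>a j)
            = \<phi>\<^sub>a (i+j) [^]\<^bsub>H (2*(i+j))\<^esub>
                ((int a * gcd (\<delta> (i+j)) (ca ^ (i+j) - 1))
                  div (gcd (\<delta> i) (ca ^ i - 1) * gcd (\<delta> j) (ca ^ j - 1))) \<and>
          cup G (2*i) (2*j) (\<phi>\<^sub>b i) (\<phi>\<^sub>b j)
            = \<phi>\<^sub>b (i+j) [^]\<^bsub>H (2*(i+j))\<^esub>
                ((int b * gcd (int b) (cb ^ (i+j) - 1))
                  div (gcd (int b) (cb ^ i - 1) * gcd (int b) (cb ^ j - 1))) \<and>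
          cup G (2*i) (2*j) (\<phi>\<^sub>a i) (\<phi>\<^sub>b j) = \<one>\<^bsub>H (2*(i+j))\<^esub> \<and>
          cup G (2*i) (2*j+1) (\<phi>\<^sub>a i) (\<psi>\<^sub>a j)
            = \<psi>\<^sub>a (i+j) [^]\<^bsub>H (2*(i+j)+1)\<^esub>
                ((int a * \<delta> (i+j)) div (\<delta> j * gcd (\<delta> i) (ca ^ i - 1))) \<and>
          cup G (2*i) (2*j+1) (\<phi>\<^sub>b i) (\<psi>\<^sub>b j)
            = \<psi>\<^sub>b (i+j) [^]\<^bsub>H (2*(i+j)+1)\<^esub> (int b div gcd (int b) (cb ^ i - 1)) \<and>
          cup G (2*i) (2*j+1) (\<phi>\<^sub>a i) (\<psi>\<^sub>b j) = \<one>\<^bsub>H (2*(i+j)+1)\<^esub> \<and>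
          cup G (2*i) (2*j+1) (\<phi>\<^sub>b i) (\<psi>\<^sub>a j) = \<one>\<^bsub>H (2*(i+j)+1)\<^esub> \<and>
          cup G (2*i+1) (2*j+1) (\<psi>\<^sub>a i) (\<psi>\<^sub>a j) = \<one>\<^bsub>H (2*(i+j)+2)\<^esub> \<and>
          cup G (2*i+1) (2*j+1) (\<psi>\<^sub>a i) (\<psi>\<^sub>b j) = \<one>\<^bsub>H (2*(i+j)+2)\<^esub> \<and>
          cup G (2*i+1) (2*j+1) (\<psi>\<^sub>b i) (\<psi>\<^sub>b j) = \<one>\<^bsub>H (2*(i+j)+2)\<^esub>) \<and>
        (\<forall>n\<ge>2.
          (\<lambda>x. cup G (2*p) n (\<phi>\<^sub>a p \<otimes>\<^bsub>H (2*p)\<^esub> \<phi>\<^sub>b p) x) \<in> iso (H n) (H (n + 2*p))))"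
proof -
  have cop: "coprime a b" using \<open>gcd a b = 1\<close> by (simp add: coprime_iff_gcd_eq_1)
  interpret D: metacyclic_data a b r c ca cb \<alpha> \<theta>
    by (rule metacyclic_data.intro) (use assms cop in \<open>simp_all only: N_def\<close>)
  have eqs: "G = D.GG" "\<delta> = D.\<delta>" "A = D.AA" "B = D.BB"
    by (simp_all only: G_def N_def \<delta>_def A_def B_def D.\<delta>_def[abs_def] D.AA_def[abs_def] D.BB_def[abs_def])
  have H: "H = D.H" unfolding H_def eqs ..
  have gcds: "gcd (D.\<delta> i) (ca ^ i - 1) = D.AA i" "gcd (int b) (cb ^ i - 1) = D.BB i" for i
    by (simp_all only: D.AA_def D.BB_def gcd.commute)
  have pow_dvd: "m dvd x ^ n - 1" if xk: "[x ^ k = 1] (mod m)" "k dvd n" for x m :: int and k n :: nat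
  proof -
    obtain q where "n = k * q" using xk(2) by blast
    then have "[x ^ n = 1] (mod m)" using cong_pow[OF xk(1), of q] by (simp add: power_mult)
    then show ?thesis by (simp add: cong_iff_dvd_diff)
  qed
  have ia: "int a > 0" and ib: "int b > 0" using \<open>a > 0\<close> \<open>b > 0\<close> by simp_all
  note ords = ord_ZMod[OF ia D.coprime_r, folded d_def] ord_ZMod[OF ia D.coprime_ca, folded d\<^sub>c\<^sub>a_def]
    ord_ZMod[OF ib D.coprime_cb, folded d\<^sub>c\<^sub>b_def]
  \<comment> \<open>The orders are positive, so \<open>p\<close> is a common exponent for \<open>r\<close>, \<open>c\<^sub>a\<close> and \<open>c\<^sub>b\<close>.\<close>
  have p: "p > 0" using ords(1,3,5) by (simp add: p_def lcm_pos_nat)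
  have dp: "d dvd p" "d\<^sub>c\<^sub>a dvd p" "d\<^sub>c\<^sub>b dvd p"
    unfolding p_def by (blast intro: dvd_trans[OF dvd_lcm1] dvd_trans[OF dvd_lcm2] dvd_lcm1 dvd_lcm2)+
  note per = D.periodicity[OF p pow_dvd[OF ords(2) dp(1)] pow_dvd[OF ords(4) dp(2)] pow_dvd[OF ords(6) dp(3)]]
  define \<phi>a where "\<phi>a i = D.cls (2 * i) (D.phi_a i)" for i
  define \<phi>b where "\<phi>b i = D.cls (2 * i) (D.phi_b i)" for i
  define \<psi>a where "\<psi>a i = D.cls (2 * i + 1) (D.psi_a i)" for i
  define \<psi>b where "\<psi>b i = D.cls (2 * i + 1) (D.psi_b i)" for i
  define \<eta> where "\<eta> = D.cls 1 D.eta"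
  have even: "basis2_group (D.H (2 * i)) (\<phi>a i) (\<phi>b i) (nat (D.AA i)) (nat (D.BB i))" if "i > 0" for i
    unfolding \<phi>a_def \<phi>b_def by (rule D.basis_even[OF that])
  have odd: "basis2_group (D.H (2 * i + 1)) (\<psi>a i) (\<psi>b i) (nat (D.AA i)) (nat (D.BB i))" if "i > 0" for i
    unfolding \<psi>a_def \<psi>b_def by (rule D.basis_odd[OF that])
  note pos = add_pos_pos[where ?'a = nat]
  have \<phi>a\<phi>a: "cup D.GG (2*i) (2*j) (\<phi>a i) (\<phi>a j)
      = \<phi>a (i+j) [^]\<^bsub>D.H (2*(i+j))\<^esub> (int a * D.AA (i+j) div (D.AA i * D.AA j))" if ij: "i > 0" "j > 0" for i j
    unfolding \<phi>a_def
    by (rule D.cup_even_even[OF ij D.phi_a[OF ij(1)] D.phi_a[OF ij(2)] D.phi_a[OF pos[OF ij]] D.coef_\<phi>a\<phi>a]) simp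
  have \<phi>b\<phi>b: "cup D.GG (2*i) (2*j) (\<phi>b i) (\<phi>b j)
      = \<phi>b (i+j) [^]\<^bsub>D.H (2*(i+j))\<^esub> (int b * D.BB (i+j) div (D.BB i * D.BB j))" if ij: "i > 0" "j > 0" for i j
    unfolding \<phi>b_def
    by (rule D.cup_even_even[OF ij D.phi_b[OF ij(1)] D.phi_b[OF ij(2)] D.phi_b[OF pos[OF ij]] _ D.coef_\<phi>b\<phi>b]) simp
  have \<phi>a\<phi>b: "cup D.GG (2*i) (2*j) (\<phi>a i) (\<phi>b j) = \<one>\<^bsub>D.H (2*(i+j))\<^esub>" if ij: "i > 0" "j > 0" for i j
    unfolding \<phi>a_def \<phi>b_def
    by (rule D.cup_even_even[OF ij D.phi_a[OF ij(1)] D.phi_b[OF ij(2)] D.phi_a[OF pos[OF ij]], of 0, unfolded D.int_pow_zero]) simp_all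
  have \<phi>a\<psi>a: "cup D.GG (2*i) (2*j+1) (\<phi>a i) (\<psi>a j)
      = \<psi>a (i+j) [^]\<^bsub>D.H (2*(i+j)+1)\<^esub> (int a * D.\<delta> (i+j) div (D.\<delta> j * D.AA i))" if ij: "i > 0" "j > 0" for i j
    unfolding \<phi>a_def \<psi>a_def
    by (rule D.cup_even_odd[OF ij(1) D.phi_a[OF ij(1)] D.psi_a[OF ij(2)] D.psi_a[OF pos[OF ij]] D.coef_\<phi>a\<psi>a]) simp
  have \<phi>b\<psi>b: "cup D.GG (2*i) (2*j+1) (\<phi>b i) (\<psi>b j)
      = \<psi>b (i+j) [^]\<^bsub>D.H (2*(i+j)+1)\<^esub> (int b div D.BB i)" if ij: "i > 0" "j > 0" for i j
    unfolding \<phi>b_def \<psi>b_def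
    by (rule D.cup_even_odd[OF ij(1) D.phi_b[OF ij(1)] D.psi_b[OF ij(2)] D.psi_b[OF pos[OF ij]]]) simp_all
  have \<phi>a\<psi>b: "cup D.GG (2*i) (2*j+1) (\<phi>a i) (\<psi>b j) = \<one>\<^bsub>D.H (2*(i+j)+1)\<^esub>" if ij: "i > 0" "j > 0" for i j
    unfolding \<phi>a_def \<psi>b_def
    by (rule D.cup_even_odd[OF ij(1) D.phi_a[OF ij(1)] D.psi_b[OF ij(2)] D.psi_b[OF pos[OF ij]], of 0, unfolded D.int_pow_zero]) simp_all
  have \<phi>b\<psi>a: "cup D.GG (2*i) (2*j+1) (\<phi>b i) (\<psi>a j) = \<one>\<^bsub>D.H (2*(i+j)+1)\<^esub>" if ij: "i > 0" "j > 0" for i j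
    unfolding \<phi>b_def \<psi>a_def
    by (rule D.cup_even_odd[OF ij(1) D.phi_b[OF ij(1)] D.psi_a[OF ij(2)] D.psi_a[OF pos[OF ij]], of 0, unfolded D.int_pow_zero]) simp_all
  \<comment> \<open>The class of degree one is the odd class with index \<open>0\<close> and coordinates \<open>(1, 1)\<close>.\<close>
  have z: "2 * 0 + 1 = (1::nat)" "i + 0 = i" for i :: nat by simp_all
  have \<phi>a\<eta>: "cup D.GG (2*i) 1 (\<phi>a i) \<eta> = \<psi>a i [^]\<^bsub>D.H (2*i+1)\<^esub> (D.\<delta> i div D.AA i)" if i: "i > 0" for i
    unfolding \<phi>a_def \<psi>a_def \<eta>_def
    by (rule D.cup_even_odd[OF i D.phi_a[OF i] D.ocoords_eta, unfolded z, OF D.psi_a[OF i]]) (simp_all add: D.coef_\<phi>a\<eta>)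
  have \<phi>b\<eta>: "cup D.GG (2*i) 1 (\<phi>b i) \<eta> = \<psi>b i [^]\<^bsub>D.H (2*i+1)\<^esub> (int b div D.BB i)" if i: "i > 0" for i
    unfolding \<phi>b_def \<psi>b_def \<eta>_def
    by (rule D.cup_even_odd[OF i D.phi_b[OF i] D.ocoords_eta, unfolded z, OF D.psi_b[OF i]]) simp_all
  have \<psi>a\<eta>: "cup D.GG (2*i+1) 1 (\<psi>a i) \<eta> = \<one>\<^bsub>D.H (2*i+2)\<^esub>" if i: "i > 0" for i
    unfolding \<psi>a_def \<eta>_def using D.cup_odd_odd[OF D.psi_a[OF i] D.ocoords_eta, unfolded z] .
  have \<psi>b\<eta>: "cup D.GG (2*i+1) 1 (\<psi>b i) \<eta> = \<one>\<^bsub>D.H (2*i+2)\<^esub>" if i: "i > 0" for i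
    unfolding \<psi>b_def \<eta>_def using D.cup_odd_odd[OF D.psi_b[OF i] D.ocoords_eta, unfolded z] .
  have \<psi>\<psi>: "cup D.GG (2*i+1) (2*j+1) (\<psi>a i) (\<psi>a j) = \<one>\<^bsub>D.H (2*(i+j)+2)\<^esub>"
    "cup D.GG (2*i+1) (2*j+1) (\<psi>a i) (\<psi>b j) = \<one>\<^bsub>D.H (2*(i+j)+2)\<^esub>"
    "cup D.GG (2*i+1) (2*j+1) (\<psi>b i) (\<psi>b j) = \<one>\<^bsub>D.H (2*(i+j)+2)\<^esub>"
    if ij: "i > 0" "j > 0" for i j
    unfolding \<psi>a_def \<psi>b_def
    by (fact D.cup_odd_odd[OF D.psi_a[OF ij(1)] D.psi_a[OF ij(2)]] D.cup_odd_odd[OF D.psi_a[OF ij(1)] D.psi_b[OF ij(2)]]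
      D.cup_odd_odd[OF D.psi_b[OF ij(1)] D.psi_b[OF ij(2)]])+
  have \<eta>: "\<eta> \<in> carrier (D.H 1) \<and> generate (D.H 1) {\<eta>} = carrier (D.H 1)"
    unfolding \<eta>_def using D.degree_1(2) D.cls_mem[OF D.eta_cocyc] by blast
  show ?thesis
    unfolding H eqs gcds
  proof (intro conjI, goal_cases)
    case 1 show ?case by (rule D.degree_0)
  next
    case 2 show ?case by (rule D.degree_1(1))
  next
    case 3 show ?case
      by (intro allI impI conjI)
        (erule basis2_group.iso_product[OF even] basis2_group.iso_product[OF odd])+
  next
    case 4 show ?case
    proof (rule exI[of _ \<eta>], rule exI[of _ \<phi>a], rule exI[of _ \<phi>b], rule exI[of _ \<psi>a], rule exI[of _ \<psi>b],
        intro conjI, goal_cases)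
      case 1 show ?case using \<eta> by (rule conjunct1)
    next
      case 2 show ?case using \<eta> by (rule conjunct2)
    next
      case 3 show ?case
        by (intro allI impI conjI)
          (erule basis2_group.gens[OF even] basis2_group.generate_basis[OF even]
            basis2_group.cyclic_x[OF even] basis2_group.cyclic_y[OF even]
            basis2_group.gens[OF odd] basis2_group.generate_basis[OF odd]
            basis2_group.cyclic_x[OF odd] basis2_group.cyclic_y[OF odd])+
    next
      case 4 show ?case by (intro allI impI conjI) (erule \<phi>a\<eta> \<phi>b\<eta> \<psi>a\<eta> \<psi>b\<eta>)+
    next
      case 5 show ?case
        by (intro allI impI conjI)
          (erule (1) \<phi>a\<phi>a \<phi>b\<phi>b \<phi>a\<phi>b \<phi>a\<psi>a \<phi>b\<psi>b \<phi>a\<psi>b \<phi>b\<psi>a \<psi>\<psi>)+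
    next
      case 6 show ?case unfolding \<phi>a_def \<phi>b_def by (intro allI impI) (rule per)
    qed
  qed
qed

end
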